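(* Let $\ell$ and $p$ be distinct primes. Let $X$ be a multigraph (finite, connected, with no vertex of valency one and nonzero Euler characteristic) with vertices $v_1,\dots,v_g$, let $S$ be a choice of one orientation of each undirected edge of $X$, and let $\alpha:S\to\mathbb{Z}_\ell$ be a function such that all derived multigraphs $X_n=X(\mathbb{Z}/\ell^n\mathbb{Z},S,\alpha_n)$, $n\ge 1$, are connected. Let $\kappa_n$ be the number of spanning trees of $X_n$. Let $f(T)=\det M(T)\in\mathbb{Z}[T;\mathbb{Z}_\ell]$, let $\mu=\mu(f(T))$, and write $f(T)=p^{\mu}\cdot g(T)$ with $g(T)\in\mathbb{Z}[T;\mathbb{Z}_\ell]$ and $\mu(g(T))=0$. Let $n_0$ be the minimal positive integer such that $g(\xi)\not\equiv 0\pmod{\mathfrak{m}_\infty}$ for every primitive $\ell^i$-th root of unity $\xi\in\mathbb{Q}_p(\xi_{\ell^\infty})$ with $i\ge n_0$ (such an integer exists). Then there exists an integer $\nu$ such that $$\mathrm{ord}_p(\kappa_n)=\mu\cdot\ell^n+\nu\quad\text{for all } n\ge n_0.$$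
   Context: Multigraphs: $X$ has vertex set $V_X$, undirected edge set $E_X$, and directed edge set $\vec E_X$ (each undirected edge, including each loop, gives two opposite directed edges), with incidence map $\mathrm{inc}:\vec E_X\to V_X\times V_X$ sending a directed edge to (origin, terminus). The Euler characteristic is $|V_X|-|E_X|$. $S\subseteq\vec E_X$ contains exactly one orientation of each undirected edge. For $\alpha:S\to\mathbb{Z}_\ell$, $\alpha_n:S\to\mathbb{Z}/\ell^n\mathbb{Z}$ is its reduction mod $\ell^n$. The derived multigraph $X(\mathbb{Z}/\ell^n\mathbb{Z},S,\alpha_n)$ has vertex set $V_X\times\mathbb{Z}/\ell^n\mathbb{Z}$ and, for each $s\in S$ with $\mathrm{inc}(s)=(v,w)$ and each $\sigma\in\mathbb{Z}/\ell^n\mathbb{Z}$, one edge joining $(v,\sigma)$ and $(w,\sigma+\alpha_n(s))$; these form an abelian $\ell$-tower $X\leftarrow X_1\leftarrow X_2\leftarrow\cdots$. Generalized polynomials: for a commutative ring $R$, $R[T;\mathbb{Z}_\ell]$ is the ring of finite formal sums $\sum_{a\in\mathbb{Z}_\ell}\lambda_aT^a$ ($\lambda_a\in R$, almost all zero) with $T^aT^b=T^{a+b}$. If $\xi$ is an element of a ring receiving a map from $R$ with $\xi^{\ell^m}=1$ for some $m$, then $\xi^a$ is well defined for $a\in\mathbb{Z}_\ell$ and $P(\xi)=\sum\lambda_a\xi^a$. For $P=\sum\lambda_aT^a\in\mathbb{Z}[T;\mathbb{Z}_\ell]$, $\mu(P)=\min_a\mathrm{ord}_p(\lambda_a)$.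 The matrix $M(T)\in M_{g\times g}(\mathbb{Z}[T;\mathbb{Z}_\ell])$ has $(i,j)$ entry $D_{ij}-\Big(\sum_{s\in S,\ \mathrm{inc}(s)=(v_i,v_j)}T^{\alpha(s)}+\sum_{s\in S,\ \mathrm{inc}(s)=(v_j,v_i)}T^{-\alpha(s)}\Big)$, where $D$ is the diagonal valency matrix of $X$ (a loop contributes $2$ to the valency). Local fields: $v_p$ is the valuation on $\overline{\mathbb{Q}}_p$ extending $\mathrm{ord}_p$; $\xi_{\ell^i}\in\overline{\mathbb{Q}}_p$ are compatible primitive $\ell^i$-th roots of unity; $\mathbb{Q}_p(\xi_{\ell^\infty})=\bigcup_i\mathbb{Q}_p(\xi_{\ell^i})$, with valuation ring $O_\infty$, maximal ideal $\mathfrak{m}_\infty$ and residue field $k_\infty=O_\infty/\mathfrak{m}_\infty$. *)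

theory Defs
  imports
    "HOL-Library.Poly_Mapping"
    "HOL-Library.Extended_Nat"
    "HOL-Library.Extended_Real"
    "HOL-Computational_Algebra.Fraction_Field"
    "HOL-Algebra.Generated_Fields"
    "HOL-Algebra.Algebraic_Closure_Type"
    "Jordan_Normal_Form.Determinant"
    "Berlekamp_Zassenhaus.Finite_Field"
begin

section \<open>The ring of p-adic integers\<close>

text \<open>
  The prime is the cardinality of the phantom type parameter. A p-adic integer is a coherent
  sequence in the inverse limit of the rings Z/p^n, where Z/p^n is represented by
  the residues 0, ..., p^n - 1.
\<close>

typedef 'p::prime_card padic_int =
  "{x :: nat \<Rightarrow> int. \<forall>n. x n \<in> {0..<int CARD('p) ^ n} \<and> x (Suc n) mod int CARD('p) ^ n = x n}"
  morphisms padic_red_fun Abs_padic_int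
  by (rule exI[of _ "\<lambda>_. 0"]) (auto simp: prime_card)

definition padic_red :: "nat \<Rightarrow> 'p::prime_card padic_int \<Rightarrow> int" where
  "padic_red n x = padic_red_fun x n"

lemma CARD_prime_pos [simp]: "0 < int CARD('p::prime_card) ^ n"
  by simp

lemma padic_red_range:
  "0 \<le> padic_red n (x :: 'p::prime_card padic_int)"
  "padic_red n (x :: 'p::prime_card padic_int) < int CARD('p) ^ n"
  using padic_red_fun[of x] by (auto simp: padic_red_def)

lemma padic_red_mod_self [simp]:
  "padic_red n (x :: 'p::prime_card padic_int) mod int CARD('p) ^ n = padic_red n x"
  using padic_red_range[where x = x and n = n] by simp

lemma padic_red_Suc_mod:
  "padic_red (Suc n) (x :: 'p::prime_card padic_int) mod int CARD('p) ^ n = padic_red n x"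
  using padic_red_fun[of x] by (auto simp: padic_red_def)

lemma padic_red_mod:
  assumes "m \<le> n"
  shows "padic_red n (x :: 'p::prime_card padic_int) mod int CARD('p) ^ m = padic_red m x"
  using assms
proof (induction n rule: dec_induct)
  case base
  show ?case by simp
next
  case (step n)
  have "padic_red (Suc n) x mod int CARD('p) ^ m
          = padic_red (Suc n) x mod int CARD('p) ^ n mod int CARD('p) ^ m"
    using step by (simp add: mod_mod_cancel le_imp_power_dvd)
  with step show ?case by (simp add: padic_red_Suc_mod)
qed

lemma padic_eqI: "(\<And>n. padic_red n x = padic_red n y) \<Longrightarrow> x = y"
  unfolding padic_red_def by (metis padic_red_fun_inject ext)

text \<open>Coherent sequences obtained by reducing a sequence of integers.\<close>

definition padic_of_seq :: "(nat \<Rightarrow> int) \<Rightarrow> 'p::prime_card padic_int" where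
  "padic_of_seq s = Abs_padic_int (\<lambda>n. s n mod int CARD('p) ^ n)"

lemma padic_red_of_seq:
  assumes "\<And>n. s (Suc n) mod int CARD('p) ^ n = s n mod int CARD('p) ^ n"
  shows "padic_red n (padic_of_seq s :: 'p::prime_card padic_int) = s n mod int CARD('p) ^ n"
proof -
  have "(\<lambda>n. s n mod int CARD('p) ^ n) \<in> {x :: nat \<Rightarrow> int. \<forall>n. x n \<in> {0..<int CARD('p) ^ n} \<and>
          x (Suc n) mod int CARD('p) ^ n = x n}"
    using assms by (auto simp: mod_mod_cancel)
  thus ?thesis
    unfolding padic_red_def padic_of_seq_def by (simp add: Abs_padic_int_inverse)
qed

instantiation padic_int :: (prime_card) comm_ring_1
begin

definition zero_padic_int :: "'a padic_int" where "0 = padic_of_seq (\<lambda>_. 0)"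
definition one_padic_int :: "'a padic_int" where "1 = padic_of_seq (\<lambda>_. 1)"
definition plus_padic_int :: "'a padic_int \<Rightarrow> 'a padic_int \<Rightarrow> 'a padic_int" where
  "x + y = padic_of_seq (\<lambda>n. padic_red n x + padic_red n y)"
definition times_padic_int :: "'a padic_int \<Rightarrow> 'a padic_int \<Rightarrow> 'a padic_int" where
  "x * y = padic_of_seq (\<lambda>n. padic_red n x * padic_red n y)"
definition uminus_padic_int :: "'a padic_int \<Rightarrow> 'a padic_int" where
  "- x = padic_of_seq (\<lambda>n. - padic_red n x)"
definition minus_padic_int :: "'a padic_int \<Rightarrow> 'a padic_int \<Rightarrow> 'a padic_int" where
  "x - y = padic_of_seq (\<lambda>n. padic_red n x - padic_red n y)"

lemma padic_red_0: "padic_red n (0 :: 'a padic_int) = 0"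
  unfolding zero_padic_int_def by (subst padic_red_of_seq) auto

lemma padic_red_1: "padic_red n (1 :: 'a padic_int) = 1 mod int CARD('a) ^ n"
  unfolding one_padic_int_def by (subst padic_red_of_seq) auto

lemma padic_red_add:
  "padic_red n (x + y :: 'a padic_int) = (padic_red n x + padic_red n y) mod int CARD('a) ^ n"
  unfolding plus_padic_int_def
  by (subst padic_red_of_seq) (auto intro!: mod_add_cong simp: padic_red_Suc_mod)

lemma padic_red_mult:
  "padic_red n (x * y :: 'a padic_int) = (padic_red n x * padic_red n y) mod int CARD('a) ^ n"
  unfolding times_padic_int_def
  by (subst padic_red_of_seq) (auto intro!: mod_mult_cong simp: padic_red_Suc_mod)

lemma padic_red_uminus:
  "padic_red n (- x :: 'a padic_int) = (- padic_red n x) mod int CARD('a) ^ n"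
  unfolding uminus_padic_int_def
  by (subst padic_red_of_seq) (auto intro!: mod_minus_cong simp: padic_red_Suc_mod)

lemma padic_red_diff:
  "padic_red n (x - y :: 'a padic_int) = (padic_red n x - padic_red n y) mod int CARD('a) ^ n"
  unfolding minus_padic_int_def
  by (subst padic_red_of_seq) (auto intro!: mod_diff_cong simp: padic_red_Suc_mod)

instance
proof
  fix a b c :: "'a padic_int"
  note r = padic_red_0 padic_red_1 padic_red_add padic_red_mult padic_red_uminus padic_red_diff
  show "a * b * c = a * (b * c)"
    by (rule padic_eqI) (simp add: r mod_simps mult.assoc)
  show "a * b = b * a"
    by (rule padic_eqI) (simp add: r mult.commute)
  show "1 * a = a"
    by (rule padic_eqI) (simp add: r mod_simps)
  show "a + b + c = a + (b + c)"
    by (rule padic_eqI) (simp add: r mod_simps add.assoc)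
  show "a + b = b + a"
    by (rule padic_eqI) (simp add: r add.commute)
  show "0 + a = a"
    by (rule padic_eqI) (simp add: r)
  show "- a + a = 0"
    by (rule padic_eqI) (simp add: r mod_simps)
  show "a - b = a + - b"
    by (rule padic_eqI) (simp add: r mod_simps)
  show "(a + b) * c = a * c + b * c"
    by (rule padic_eqI) (simp add: r mod_simps distrib_right)
  have "padic_red 1 (1 :: 'a padic_int) \<noteq> padic_red 1 0"
    using prime_gt_1_nat[OF prime_card[where 'a = 'a]] by (simp add: r)
  thus "(0 :: 'a padic_int) \<noteq> 1" by metis
qed

end

lemma padic_red_of_nat:
  "padic_red n (of_nat k :: 'p::prime_card padic_int) = int k mod int CARD('p) ^ n"
  by (induction k) (simp_all add: padic_red_0 padic_red_1 padic_red_add mod_simps)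

lemma padic_red_mult_eq_0:
  fixes x y :: "'p::prime_card padic_int"
  assumes "padic_red (m + n) (x * y) = 0"
  shows "padic_red m x = 0 \<or> padic_red n y = 0"
proof -
  let ?p = "int CARD('p)"
  have p: "prime ?p" using prime_card[where 'a = 'p] by simp
  have "?p ^ (m + n) dvd padic_red (m + n) x * padic_red (m + n) y"
    using assms by (simp add: padic_red_mult mod_eq_0_iff_dvd)
  hence "?p ^ m dvd padic_red (m + n) x \<or> ?p ^ n dvd padic_red (m + n) y"
  proof (cases "padic_red (m + n) x = 0 \<or> padic_red (m + n) y = 0")
    case False
    hence "m + n \<le> multiplicity ?p (padic_red (m + n) x) + multiplicity ?p (padic_red (m + n) y)"
      using p \<open>?p ^ (m + n) dvd _\<close>
      by (subst (asm) power_dvd_iff_le_multiplicity)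
         (auto simp: prime_elem_multiplicity_mult_distrib)
    hence "m \<le> multiplicity ?p (padic_red (m + n) x) \<or> n \<le> multiplicity ?p (padic_red (m + n) y)"
      by linarith
    thus ?thesis by (auto intro: multiplicity_dvd')
  qed auto
  thus ?thesis
    by (metis dvd_imp_mod_0 le_add1 le_add2 padic_red_mod)
qed

instance padic_int :: (prime_card) idom
proof
  fix x y :: "'a padic_int"
  assume "x \<noteq> 0" "y \<noteq> 0"
  then obtain m n where "padic_red m x \<noteq> 0" "padic_red n y \<noteq> 0"
    by (metis padic_eqI padic_red_0)
  hence "padic_red (m + n) (x * y) \<noteq> 0" using padic_red_mult_eq_0 by blast
  thus "x * y \<noteq> 0" by (metis padic_red_0)
qed


lemma padic_power_dvd_iff:
  "of_nat (CARD('p)) ^ n dvd (x :: 'p::prime_card padic_int) \<longleftrightarrow> padic_red n x = 0"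
proof
  assume "of_nat (CARD('p)) ^ n dvd x"
  then obtain y where "x = of_nat (CARD('p) ^ n) * y" by (auto simp: dvd_def)
  thus "padic_red n x = 0" by (simp add: padic_red_mult padic_red_of_nat del: of_nat_power) simp
next
  assume n: "padic_red n x = 0"
  let ?q = "int CARD('p)"
  define y :: "'p padic_int" where "y = padic_of_seq (\<lambda>k. padic_red (n + k) x div ?q ^ n)"
  have dv: "?q ^ n dvd padic_red (n + k) x" for k
    using padic_red_mod[of n "n + k" x] n by (simp add: mod_eq_0_iff_dvd)
  have y: "padic_red k y = (padic_red (n + k) x div ?q ^ n) mod ?q ^ k" for k
    unfolding y_def
  proof (rule padic_red_of_seq)
    fix k
    have "padic_red (n + Suc k) x div ?q ^ n mod ?q ^ k = padic_red (n + Suc k) x mod ?q ^ (n + k) div ?q ^ n"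
      by (simp add: power_add zmod_zmult2_eq)
    also have "\<dots> = padic_red (n + k) x div ?q ^ n" by (simp add: padic_red_mod)
    finally show "padic_red (n + Suc k) x div ?q ^ n mod ?q ^ k = padic_red (n + k) x div ?q ^ n mod ?q ^ k"
      by (metis mod_mod_trivial)
  qed
  have "x = of_nat (CARD('p) ^ n) * y"
  proof (rule padic_eqI)
    fix k
    have "padic_red k (of_nat (CARD('p) ^ n) * y) = (?q ^ n * (padic_red (n + k) x div ?q ^ n)) mod ?q ^ k"
      by (simp add: padic_red_mult padic_red_of_nat y mod_simps del: of_nat_power) (simp)
    also have "\<dots> = padic_red (n + k) x mod ?q ^ k" using dv[of k] by simp
    also have "\<dots> = padic_red k x" by (simp add: padic_red_mod)
    finally show "padic_red k x = padic_red k (of_nat (CARD('p) ^ n) * y)" ..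
  qed
  thus "of_nat (CARD('p)) ^ n dvd x" by (metis dvd_triv_left of_nat_power)
qed

definition padic_int_ord :: "'p::prime_card padic_int \<Rightarrow> nat" where
  "padic_int_ord x = (GREATEST n. of_nat (CARD('p)) ^ n dvd x)"

lemma padic_power_dvd_iff_le_ord:
  assumes "x \<noteq> 0"
  shows "of_nat (CARD('p)) ^ n dvd (x :: 'p::prime_card padic_int) \<longleftrightarrow> n \<le> padic_int_ord x"
proof -
  let ?q = "of_nat (CARD('p)) :: 'p padic_int"
  obtain N where N: "padic_red N x \<noteq> 0" using assms by (metis padic_eqI padic_red_0)
  have bd: "n \<le> N" if "?q ^ n dvd x" for n
    using that N by (metis dvd_trans le_imp_power_dvd linorder_le_cases padic_power_dvd_iff)
  have "?q ^ padic_int_ord x dvd x"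
    unfolding padic_int_ord_def by (rule GreatestI_nat[of _ 0 N]) (auto dest: bd)
  moreover have "n \<le> padic_int_ord x" if "?q ^ n dvd x" for n
    unfolding padic_int_ord_def using that by (rule Greatest_le_nat[of _ _ N]) (auto dest: bd)
  ultimately show ?thesis by (meson dvd_trans le_imp_power_dvd)
qed

lemma padic_int_ord_mult:
  fixes x y :: "'p::prime_card padic_int"
  assumes "x \<noteq> 0" "y \<noteq> 0"
  shows "padic_int_ord (x * y) = padic_int_ord x + padic_int_ord y"
proof (rule antisym)
  let ?q = "of_nat (CARD('p)) :: 'p padic_int"
  have "?q ^ (padic_int_ord x + padic_int_ord y) dvd x * y"
    unfolding power_add using assms by (intro mult_dvd_mono) (simp_all add: padic_power_dvd_iff_le_ord)
  thus "padic_int_ord x + padic_int_ord y \<le> padic_int_ord (x * y)"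
    using assms by (simp add: padic_power_dvd_iff_le_ord)
  obtain x' y' where x': "x = ?q ^ padic_int_ord x * x'" and y': "y = ?q ^ padic_int_ord y * y'"
    using assms padic_power_dvd_iff_le_ord by (metis dvdE order_refl)
  have nd: "padic_red 1 x' \<noteq> 0" "padic_red 1 y' \<noteq> 0"
  proof -
    have "\<not> ?q dvd x'" "\<not> ?q dvd y'"
      using assms x' y' padic_power_dvd_iff_le_ord[of x "Suc (padic_int_ord x)"]
        padic_power_dvd_iff_le_ord[of y "Suc (padic_int_ord y)"]
      by (metis Suc_n_not_le_n mult_dvd_mono dvd_refl power_Suc2)+
    thus "padic_red 1 x' \<noteq> 0" "padic_red 1 y' \<noteq> 0"
      using padic_power_dvd_iff[of 1] by (metis power_one_right)+
  qed
  have "\<not> ?q dvd x' * y'"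
  proof
    assume "?q dvd x' * y'"
    hence "padic_red 1 (x' * y') = 0" using padic_power_dvd_iff[of 1] by (metis power_one_right)
    hence "int CARD('p) dvd padic_red 1 x' * padic_red 1 y'"
      by (simp add: padic_red_mult mod_eq_0_iff_dvd)
    moreover have "prime (int CARD('p))" using prime_card[where 'a = 'p] by simp
    ultimately have "int CARD('p) dvd padic_red 1 x' \<or> int CARD('p) dvd padic_red 1 y'"
      by (simp add: prime_dvd_mult_iff)
    thus False
      using nd padic_red_mod_self[of 1 x'] padic_red_mod_self[of 1 y']
      by (metis dvd_imp_mod_0 power_one_right)
  qed
  moreover have "x * y = ?q ^ (padic_int_ord x + padic_int_ord y) * (x' * y')"
    by (subst x', subst y') (simp add: power_add algebra_simps)
  moreover have "?q ^ (padic_int_ord x + padic_int_ord y) \<noteq> 0"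
    using assms x' y' by (metis mult_eq_0_iff power_add)
  ultimately have "\<not> ?q ^ Suc (padic_int_ord x + padic_int_ord y) dvd x * y"
    unfolding power_Suc2 by (metis dvd_mult_cancel_left)
  thus "padic_int_ord (x * y) \<le> padic_int_ord x + padic_int_ord y"
    using assms by (subst (asm) padic_power_dvd_iff_le_ord) auto
qed


section \<open>The field of p-adic numbers, its algebraic closure and valuation\<close>

type_synonym 'p padic = "'p padic_int fract"

type_synonym 'p padic_ac = "'p padic alg_closure"

definition padic_ord :: "'p::prime_card padic \<Rightarrow> ereal" where
  "padic_ord x = (if x = 0 then \<infinity> else
     (THE r. \<exists>a b. a \<noteq> 0 \<and> b \<noteq> 0 \<and> x = Fract a b \<and>
        r = ereal (real (padic_int_ord a) - real (padic_int_ord b))))"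

lemma padic_ord_Fract:
  fixes a b :: "'p::prime_card padic_int"
  assumes "a \<noteq> 0" "b \<noteq> 0"
  shows "padic_ord (Fract a b) = ereal (real (padic_int_ord a) - real (padic_int_ord b))"
proof -
  have "(THE r. \<exists>c d. c \<noteq> 0 \<and> d \<noteq> 0 \<and> Fract a b = Fract c d \<and>
        r = ereal (real (padic_int_ord c) - real (padic_int_ord d)))
        = ereal (real (padic_int_ord a) - real (padic_int_ord b))"
  proof (rule the_equality)
    fix r
    assume "\<exists>c d. c \<noteq> 0 \<and> d \<noteq> 0 \<and> Fract a b = Fract c d \<and>
        r = ereal (real (padic_int_ord c) - real (padic_int_ord d))"
    then obtain c d where cd: "c \<noteq> 0" "d \<noteq> 0" "Fract a b = Fract c d"
      and r: "r = ereal (real (padic_int_ord c) - real (padic_int_ord d))" by blast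
    have "a * d = c * b" using cd assms by (simp add: eq_fract)
    hence "padic_int_ord a + padic_int_ord d = padic_int_ord c + padic_int_ord b"
      using cd assms by (metis padic_int_ord_mult)
    thus "r = ereal (real (padic_int_ord a) - real (padic_int_ord b))"
      unfolding r by simp
  qed (use assms in blast)
  moreover have "Fract a b \<noteq> 0" using assms by (simp add: Zero_fract_def eq_fract)
  ultimately show ?thesis by (simp add: padic_ord_def)
qed

text \<open>
  Valuations are written additively, with value \<open>\<infinity>\<close> exactly at 0. Exactly one valuation on the
  algebraic closure of the p-adic numbers extends \<open>padic_ord\<close>.
\<close>

definition valuation :: "('a::Fields.field \<Rightarrow> ereal) \<Rightarrow> bool" where
  "valuation v \<longleftrightarrow>
     (\<forall>x. v x = \<infinity> \<longleftrightarrow> x = 0) \<and> (\<forall>x. v x \<noteq> -\<infinity>) \<and>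
     (\<forall>x y. v (x * y) = v x + v y) \<and> (\<forall>x y. min (v x) (v y) \<le> v (x + y))"

definition extends_padic_ord :: "('p::prime_card padic_ac \<Rightarrow> ereal) \<Rightarrow> bool" where
  "extends_padic_ord v \<longleftrightarrow> (\<forall>x. v (to_ac x) = padic_ord x)"

definition primitive_root_of_unity :: "nat \<Rightarrow> 'a::monoid_mult \<Rightarrow> bool" where
  "primitive_root_of_unity N \<xi> \<longleftrightarrow> \<xi> ^ N = 1 \<and> (\<forall>k. 0 < k \<and> k < N \<longrightarrow> \<xi> ^ k \<noteq> 1)"

definition compatible_primitive_roots :: "nat \<Rightarrow> (nat \<Rightarrow> 'a::monoid_mult) \<Rightarrow> bool" where
  "compatible_primitive_roots l \<zeta> \<longleftrightarrow>
     (\<forall>i. primitive_root_of_unity (l ^ i) (\<zeta> i) \<and> \<zeta> (Suc i) ^ l = \<zeta> i)"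

definition padic_adjoin :: "'p::prime_card padic_ac \<Rightarrow> 'p padic_ac set" where
  "padic_adjoin \<xi> = generate_field ring_of_type_algebra (range to_ac \<union> {\<xi>})"

definition padic_cyclotomic_union :: "(nat \<Rightarrow> 'p::prime_card padic_ac) \<Rightarrow> 'p padic_ac set" where
  "padic_cyclotomic_union \<zeta> = (\<Union>i. padic_adjoin (\<zeta> i))"

text \<open>The maximal ideal of the valuation ring of v restricted to the subfield K.\<close>

definition maximal_ideal_on :: "('a \<Rightarrow> ereal) \<Rightarrow> 'a set \<Rightarrow> 'a set" where
  "maximal_ideal_on v K = {x \<in> K. 0 < v x}"


section \<open>Generalized polynomials\<close>

text \<open>
  The ring of finite formal sums of terms \<open>c T\<^sup>a\<close> with \<open>a\<close> an \<open>l\<close>-adic integer is the monoid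
  algebra of the additive group of \<open>l\<close>-adic integers, whose product is that of
  \<^typ>\<open>'a \<Rightarrow>\<^sub>0 'b\<close>.
\<close>

type_synonym ('l, 'r) gen_poly = "'l padic_int \<Rightarrow>\<^sub>0 'r"

definition gp_T_pow :: "'l::prime_card padic_int \<Rightarrow> ('l, 'r::comm_ring_1) gen_poly" where
  "gp_T_pow a = Poly_Mapping.single a 1"

lemma gp_T_pow_add: "gp_T_pow a * gp_T_pow b = gp_T_pow (a + b)"
  by (simp add: gp_T_pow_def Poly_Mapping.mult_single)

definition padic_power :: "'a::monoid_mult \<Rightarrow> 'l::prime_card padic_int \<Rightarrow> 'a" where
  "padic_power \<xi> a = \<xi> ^ nat (padic_red (LEAST m. \<xi> ^ (CARD('l) ^ m) = 1) a)"

lemma padic_power_eq: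
  fixes a :: "'l::prime_card padic_int" and \<xi> :: "'a::monoid_mult"
  assumes "\<xi> ^ (CARD('l) ^ m) = 1"
  shows "padic_power \<xi> a = \<xi> ^ nat (padic_red m a)"
proof -
  define k where "k = (LEAST m. \<xi> ^ (CARD('l) ^ m) = 1)"
  have k: "\<xi> ^ (CARD('l) ^ k) = 1" unfolding k_def using assms by (rule LeastI)
  have "k \<le> m" unfolding k_def using assms by (rule Least_le)
  hence "padic_red k a = padic_red m a mod int CARD('l) ^ k" by (simp add: padic_red_mod)
  hence "nat (padic_red k a) = nat (padic_red m a) mod CARD('l) ^ k"
    using padic_red_range(1)[of m a] by (simp add: nat_mod_distrib nat_power_eq)
  moreover have "\<xi> ^ (n mod CARD('l) ^ k) = \<xi> ^ n" for n
  proof -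
    have "\<xi> ^ n = \<xi> ^ (CARD('l) ^ k * (n div CARD('l) ^ k) + n mod CARD('l) ^ k)" by simp
    also have "\<dots> = \<xi> ^ (n mod CARD('l) ^ k)" unfolding power_add power_mult k by simp
    finally show ?thesis ..
  qed
  ultimately show ?thesis unfolding padic_power_def k_def[symmetric] by simp
qed

definition gp_eval :: "('l::prime_card, int) gen_poly \<Rightarrow> 'a::comm_ring_1 \<Rightarrow> 'a" where
  "gp_eval P \<xi> = (\<Sum>a\<in>Poly_Mapping.keys P. of_int (Poly_Mapping.lookup P a) * padic_power \<xi> a)"

definition int_ord :: "nat \<Rightarrow> int \<Rightarrow> enat" where
  "int_ord p c = (if c = 0 then \<infinity> else enat (multiplicity (int p) c))"

definition gp_mu :: "nat \<Rightarrow> ('l::prime_card, int) gen_poly \<Rightarrow> enat" where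
  "gp_mu p P = (INF a. int_ord p (Poly_Mapping.lookup P a))"


section \<open>Multigraphs\<close>

text \<open>
  Multigraphs are given by their directed edges together with the orientation-reversing map
  \<open>opp\<close>; an undirected edge is a pair of opposite directed edges.
\<close>

record ('v, 'e) multigraph =
  verts :: "'v set"
  darts :: "'e set"
  inc :: "'e \<Rightarrow> 'v \<times> 'v"
  opp :: "'e \<Rightarrow> 'e"

definition is_multigraph :: "('v, 'e) multigraph \<Rightarrow> bool" where
  "is_multigraph G \<longleftrightarrow>
     (\<forall>e\<in>darts G. inc G e \<in> verts G \<times> verts G \<and> opp G e \<in> darts G \<and> opp G e \<noteq> e \<and>
        opp G (opp G e) = e \<and> inc G (opp G e) = prod.swap (inc G e))"

definition finite_multigraph :: "('v, 'e) multigraph \<Rightarrow> bool" where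
  "finite_multigraph G \<longleftrightarrow> is_multigraph G \<and> finite (verts G) \<and> finite (darts G)"

definition uedge :: "('v, 'e) multigraph \<Rightarrow> 'e \<Rightarrow> 'e set" where
  "uedge G e = {e, opp G e}"

definition uedges :: "('v, 'e) multigraph \<Rightarrow> 'e set set" where
  "uedges G = uedge G ` darts G"

definition euler_char :: "('v, 'e) multigraph \<Rightarrow> int" where
  "euler_char G = int (card (verts G)) - int (card (uedges G))"

text \<open>A loop has two orientations, so it contributes 2.\<close>

definition valency :: "('v, 'e) multigraph \<Rightarrow> 'v \<Rightarrow> nat" where
  "valency G v = card {e \<in> darts G. fst (inc G e) = v}"

definition connected_multigraph :: "('v, 'e) multigraph \<Rightarrow> bool" where
  "connected_multigraph G \<longleftrightarrow>
     verts G \<noteq> {} \<and> (\<forall>u\<in>verts G. \<forall>w\<in>verts G. (u, w) \<in> (inc G ` darts G)\<^sup>*)"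

text \<open>
  A cycle of length 1 is a loop; a cycle of length 2 uses two distinct parallel edges, which is
  why distinctness of the undirected edges is required as well.
\<close>

definition is_cycle :: "('v, 'e) multigraph \<Rightarrow> 'e list \<Rightarrow> bool" where
  "is_cycle G es \<longleftrightarrow>
     es \<noteq> [] \<and> set es \<subseteq> darts G \<and>
     (\<forall>i<length es. snd (inc G (es ! i)) = fst (inc G (es ! (Suc i mod length es)))) \<and>
     distinct (map (\<lambda>e. fst (inc G e)) es) \<and> distinct (map (uedge G) es)"

definition is_tree :: "('v, 'e) multigraph \<Rightarrow> bool" where
  "is_tree G \<longleftrightarrow> connected_multigraph G \<and> (\<nexists>es. is_cycle G es)"

definition spanning_trees :: "('v, 'e) multigraph \<Rightarrow> 'e set set set" where
  "spanning_trees G = {F. F \<subseteq> uedges G \<and> is_tree (G\<lparr>darts := \<Union>F\<rparr>)}"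

definition is_orientation :: "('v, 'e) multigraph \<Rightarrow> 'e set \<Rightarrow> bool" where
  "is_orientation G S \<longleftrightarrow> S \<subseteq> darts G \<and> (\<forall>E\<in>uedges G. \<exists>!s. s \<in> S \<and> s \<in> E)"

text \<open>
  The derived multigraph for the group Z/mZ (represented by the residues 0, ..., m - 1):
  the undirected edge indexed by \<open>(s, \<sigma>)\<close> has the two orientations \<open>(s, \<sigma>, True)\<close> and
  \<open>(s, \<sigma>, False)\<close>.
\<close>

definition derived_multigraph ::
  "('v, 'e) multigraph \<Rightarrow> int \<Rightarrow> 'e set \<Rightarrow> ('e \<Rightarrow> int) \<Rightarrow> ('v \<times> int, 'e \<times> int \<times> bool) multigraph" where
  "derived_multigraph G m S \<beta> =
     \<lparr>verts = verts G \<times> {0..<m},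
      darts = S \<times> {0..<m} \<times> UNIV,
      inc = (\<lambda>(s, \<sigma>, b).
        let d = ((fst (inc G s), \<sigma>), (snd (inc G s), (\<sigma> + \<beta> s) mod m))
        in if b then d else prod.swap d),
      opp = (\<lambda>(s, \<sigma>, b). (s, \<sigma>, \<not> b))\<rparr>"

lemma finite_multigraph_derived:
  assumes "finite_multigraph G" "S \<subseteq> darts G" "0 < m"
  shows "finite_multigraph (derived_multigraph G m S \<beta>)"
  using assms unfolding finite_multigraph_def is_multigraph_def derived_multigraph_def
  by (auto simp: Let_def mem_Times_iff intro!: finite_cartesian_product intro: finite_subset)

definition tower_layer ::
  "('v, 'e) multigraph \<Rightarrow> 'e set \<Rightarrow> ('e \<Rightarrow> 'l::prime_card padic_int) \<Rightarrow> nat \<Rightarrow>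
     ('v \<times> int, 'e \<times> int \<times> bool) multigraph" where
  "tower_layer G S \<alpha> n =
     derived_multigraph G (int CARD('l) ^ n) S (\<lambda>s. padic_red n (\<alpha> s))"

text \<open>Rows and columns are indexed by the enumeration \<open>vs\<close> of the vertices.\<close>

definition voltage_matrix ::
  "('v, 'e) multigraph \<Rightarrow> 'v list \<Rightarrow> 'e set \<Rightarrow> ('e \<Rightarrow> 'l::prime_card padic_int) \<Rightarrow>
     ('l, int) gen_poly mat" where
  "voltage_matrix G vs S \<alpha> = mat (length vs) (length vs) (\<lambda>(i, j).
     (if i = j then of_nat (valency G (vs ! i)) else 0) -
     ((\<Sum>s\<in>{s \<in> S. inc G s = (vs ! i, vs ! j)}. gp_T_pow (\<alpha> s)) +
      (\<Sum>s\<in>{s \<in> S. inc G s = (vs ! j, vs ! i)}. gp_T_pow (- \<alpha> s))))"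

end

theory Submission
  imports Defs "Jordan_Normal_Form.Char_Poly"
begin

text \<open>
  By the matrix-tree theorem the number of spanning trees of \<open>X\<^sub>n\<close> is, up to the number of vertices
  and a sign, the linear coefficient of the characteristic polynomial of its Laplacian. The discrete
  Fourier transform over \<open>\<int>/l\<^sup>n\<close> block-diagonalises this Laplacian into the matrices \<open>M(\<xi>)\<close> with
  \<open>\<xi>\<close> running over the \<open>l\<^sup>n\<close>-th roots of unity, so that \<open>l\<^sup>n \<kappa>\<^sub>n\<close> is, up to sign and a factor
  independent of \<open>n\<close>, the product of the \<open>f(\<xi>)\<close> over \<open>\<xi> \<noteq> 1\<close>. Passing from \<open>n\<close> to \<open>n + 1\<close> adds one
  factor for each primitive \<open>l\<^sup>n\<^sup>+\<^sup>1\<close>-th root of unity, and each of them has valuation exactly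
  \<open>\<mu>\<close> once \<open>g(\<xi>)\<close> is a unit.

  That \<open>g(\<xi>)\<close> is a unit for all \<open>\<xi>\<close> of large order follows from the Frobenius congruence
  \<open>g(\<xi>)\<^sup>p \<equiv> g(\<xi>\<^sup>p)\<close>: if \<open>g(\<xi>)\<close> vanishes in the residue field, then so does \<open>g(\<xi>\<^sup>u)\<close> for every \<open>u\<close>
  in the subgroup generated by \<open>p\<close>, which contains all \<open>u \<equiv> 1\<close> modulo a fixed power of \<open>l\<close>; summing
  over these \<open>u\<close> against \<open>\<xi>\<^sup>-\<^sup>u\<^sup>b\<close> isolates the coefficient of \<open>T\<^sup>b\<close>, which is then divisible by \<open>p\<close>.
\<close>

section \<open>Spanning trees and arborescences\<close>

text \<open>Only incidences are checked; membership of the darts in a graph is a separate condition,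
  so a walk in a subgraph obtained by shrinking \<open>darts\<close> is at once a walk in
  \<open>G\<close>.\<close>

fun walk :: "('v, 'e) multigraph \<Rightarrow> 'v \<Rightarrow> 'e list \<Rightarrow> 'v \<Rightarrow> bool" where
  "walk G u [] w \<longleftrightarrow> u = w"
| "walk G u (e # es) w \<longleftrightarrow> fst (inc G e) = u \<and> walk G (snd (inc G e)) es w"

lemma walk_append:
  "walk G u (es @ es') w \<longleftrightarrow> (\<exists>x. walk G u es x \<and> walk G x es' w)"
  by (induction es arbitrary: u) auto

lemma walk_nth_Suc:
  "walk G u es w \<Longrightarrow> Suc i < length es \<Longrightarrow> snd (inc G (es ! i)) = fst (inc G (es ! Suc i))"
proof (induction es arbitrary: u i)
  case (Cons e es)
  show ?case
  proof (cases i)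
    case 0
    with Cons show ?thesis by (cases es) auto
  next
    case (Suc j)
    with Cons show ?thesis by auto
  qed
qed simp

lemma walk_last: "walk G u es w \<Longrightarrow> es \<noteq> [] \<Longrightarrow> snd (inc G (last es)) = w"
  by (induction es arbitrary: u) auto

lemma walk_snd_in:
  "walk G u es w \<Longrightarrow> e \<in> set es \<Longrightarrow> snd (inc G e) \<in> (\<lambda>e. fst (inc G e)) ` set es \<union> {w}"
proof (induction es arbitrary: u)
  case (Cons a es)
  show ?case
  proof (cases "e = a")
    case True
    with Cons.prems show ?thesis by (cases es) auto
  next
    case False
    with Cons show ?thesis by auto
  qed
qed simp

text \<open>Loop erasure while prepending darts: if the new origin \<open>u\<close> already occurs,
  the walk restarts at that occurrence, and if \<open>u = w\<close> it collapses to the empty walk.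
  Excluding \<open>w\<close> from the origins means that no vertex is visited twice.\<close>

lemma simple_walk_exists:
  assumes "(u, w) \<in> (inc G ` D)\<^sup>*"
  shows "\<exists>es. walk G u es w \<and> set es \<subseteq> D \<and> distinct (map (\<lambda>e. fst (inc G e)) es) \<and>
    w \<notin> (\<lambda>e. fst (inc G e)) ` set es"
  using assms
proof (induction rule: converse_rtrancl_induct)
  case base
  show ?case by (intro exI[of _ "[]"]) auto
next
  case (step u y)
  then obtain e es where e: "e \<in> D" "inc G e = (u, y)" and es: "walk G y es w" "set es \<subseteq> D"
    "distinct (map (\<lambda>e. fst (inc G e)) es)" "w \<notin> (\<lambda>e. fst (inc G e)) ` set es" by auto
  consider "u = w" | "u \<noteq> w" "u \<in> (\<lambda>e. fst (inc G e)) ` set es"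
    | "u \<noteq> w" "u \<notin> (\<lambda>e. fst (inc G e)) ` set es" by blast
  thus ?case
  proof cases
    case 1
    thus ?thesis by (intro exI[of _ "[]"]) auto
  next
    case 2
    then obtain d where d: "d \<in> set es" "fst (inc G d) = u" by auto
    then obtain xs ys where "es = xs @ d # ys" by (meson split_list)
    with es d have "walk G u (d # ys) w" "set (d # ys) \<subseteq> D"
      "distinct (map (\<lambda>e. fst (inc G e)) (d # ys))" "w \<notin> (\<lambda>e. fst (inc G e)) ` set (d # ys)"
      by (auto simp: walk_append)
    thus ?thesis by blast
  next
    case 3
    with e es show ?thesis by (intro exI[of _ "e # es"]) auto
  qed
qed

section \<open>Spanning trees correspond to arborescences directed towards a fixed root\<close>

locale rooted_multigraph =
  fixes G :: "('v, 'e) multigraph" and r :: 'v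
  assumes finite_G: "finite_multigraph G" and root_in: "r \<in> verts G"
begin

lemma multigraph_G: "is_multigraph G"
  using finite_G by (simp add: finite_multigraph_def)

lemma dartD:
  assumes "e \<in> darts G"
  shows "fst (inc G e) \<in> verts G" "snd (inc G e) \<in> verts G" "opp G e \<in> darts G"
    "opp G e \<noteq> e" "opp G (opp G e) = e" "inc G (opp G e) = prod.swap (inc G e)"
proof -
  have "inc G e \<in> verts G \<times> verts G \<and> opp G e \<in> darts G \<and> opp G e \<noteq> e \<and>
      opp G (opp G e) = e \<and> inc G (opp G e) = prod.swap (inc G e)"
    using multigraph_G assms unfolding is_multigraph_def by (rule bspec)
  thus "fst (inc G e) \<in> verts G" "snd (inc G e) \<in> verts G" "opp G e \<in> darts G"
    "opp G e \<noteq> e" "opp G (opp G e) = e" "inc G (opp G e) = prod.swap (inc G e)"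
    by (auto simp: mem_Times_iff)
qed

text \<open>A choice of darts carries no value at \<open>r\<close>; making \<open>r\<close> a fixed
  point gives a total map that can be iterated.\<close>

definition step :: "('v \<Rightarrow> 'e) \<Rightarrow> 'v \<Rightarrow> 'v" where
  "step \<phi> v = (if v = r then r else snd (inc G (\<phi> v)))"

text \<open>Extensional functions, so that a choice is determined by its values off the root and the
  choices index exactly the terms of a product over vertices of sums over outgoing darts.\<close>

definition dart_choices :: "('v \<Rightarrow> 'e) set" where
  "dart_choices = (\<Pi>\<^sub>E v\<in>verts G - {r}. {e \<in> darts G. fst (inc G e) = v})"

definition arborescences :: "('v \<Rightarrow> 'e) set" where
  "arborescences = {\<phi> \<in> dart_choices. \<forall>v\<in>verts G. \<exists>k. (step \<phi> ^^ k) v = r}"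

definition depth :: "('v \<Rightarrow> 'e) \<Rightarrow> 'v \<Rightarrow> nat" where
  "depth \<phi> v = (LEAST k. (step \<phi> ^^ k) v = r)"

definition tree_edges :: "('v \<Rightarrow> 'e) \<Rightarrow> 'e set set" where
  "tree_edges \<phi> = (\<lambda>v. uedge G (\<phi> v)) ` (verts G - {r})"

lemma finite_dart_choices: "finite dart_choices"
  using finite_G unfolding dart_choices_def finite_multigraph_def by (intro finite_PiE) auto

lemma choiceD:
  assumes "\<phi> \<in> dart_choices" "v \<in> verts G" "v \<noteq> r"
  shows "\<phi> v \<in> darts G" "fst (inc G (\<phi> v)) = v" "snd (inc G (\<phi> v)) \<in> verts G"
proof -
  show "\<phi> v \<in> darts G" "fst (inc G (\<phi> v)) = v"
    using assms by (auto simp: dart_choices_def PiE_iff)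
  thus "snd (inc G (\<phi> v)) \<in> verts G" using dartD(2) by blast
qed

lemma arb_choices: "\<phi> \<in> arborescences \<Longrightarrow> \<phi> \<in> dart_choices"
  by (simp add: arborescences_def)

lemma depth_step:
  assumes "\<phi> \<in> arborescences" "v \<in> verts G" "v \<noteq> r"
  shows "depth \<phi> v = Suc (depth \<phi> (snd (inc G (\<phi> v))))"
proof -
  obtain k where "(step \<phi> ^^ k) v = r" using assms by (auto simp: arborescences_def)
  hence "(LEAST k. (step \<phi> ^^ k) v = r) = Suc (LEAST k. (step \<phi> ^^ Suc k) v = r)"
    using assms by (intro Least_Suc) auto
  moreover have "(step \<phi> ^^ Suc k) v = (step \<phi> ^^ k) (snd (inc G (\<phi> v)))" for k
    using assms by (simp add: funpow_Suc_right step_def del: funpow.simps)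
  ultimately show ?thesis by (simp add: depth_def)
qed

text \<open>A dart of the tree lowers the depth by one if it is \<open>\<phi> w\<close> and raises
  it by one if it is the opposite; in both cases its deeper end \<open>w\<close> determines its
  edge. This is what excludes cycles.\<close>

lemma dart_in_tree_edges:
  assumes "\<phi> \<in> arborescences" "e \<in> \<Union> (tree_edges \<phi>)"
  obtains w where "w \<in> verts G" "w \<noteq> r" "e = \<phi> w" "fst (inc G e) = w"
      "depth \<phi> w = Suc (depth \<phi> (snd (inc G e)))"
  | w where "w \<in> verts G" "w \<noteq> r" "e = opp G (\<phi> w)" "snd (inc G e) = w"
      "depth \<phi> w = Suc (depth \<phi> (fst (inc G e)))"
proof -
  from assms obtain w where w: "w \<in> verts G" "w \<noteq> r" "e = \<phi> w \<or> e = opp G (\<phi> w)"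
    by (auto simp: tree_edges_def uedge_def)
  note c = choiceD[OF arb_choices[OF assms(1)] w(1,2)] and d = depth_step[OF assms(1) w(1,2)]
  from w(3) show thesis
  proof
    assume "e = \<phi> w"
    thus thesis using that(1)[of w] w c d by simp
  next
    assume "e = opp G (\<phi> w)"
    thus thesis using that(2)[of w] w c d dartD[OF c(1)] by simp
  qed
qed

lemma tree_edges_subset: "\<phi> \<in> dart_choices \<Longrightarrow> tree_edges \<phi> \<subseteq> uedges G"
  unfolding tree_edges_def uedges_def by (intro image_subsetI imageI) (auto intro: choiceD(1))

lemma Union_uedges_subset: "F \<subseteq> uedges G \<Longrightarrow> e \<in> \<Union> F \<Longrightarrow> e \<in> darts G"
  using dartD(3) unfolding uedges_def uedge_def by blast

lemma uedge_opp: "e \<in> darts G \<Longrightarrow> uedge G (opp G e) = uedge G e"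
  unfolding uedge_def dartD(5) by (rule insert_commute)

lemma uedge_of_mem: "F \<subseteq> uedges G \<Longrightarrow> E \<in> F \<Longrightarrow> e \<in> E \<Longrightarrow> uedge G e = E"
proof -
  assume *: "F \<subseteq> uedges G" "E \<in> F" "e \<in> E"
  then obtain d where "d \<in> darts G" "E = uedge G d" by (auto simp: uedges_def)
  with *(3) uedge_opp[of d] show ?thesis unfolding uedge_def by (metis insert_iff singletonD)
qed

lemma sym_inc_image:
  assumes "F \<subseteq> uedges G" shows "sym (inc G ` \<Union> F)"
proof (rule symI)
  fix u w assume "(u, w) \<in> inc G ` \<Union> F"
  then obtain e E where e: "E \<in> F" "e \<in> E" "inc G e = (u, w)" by auto
  hence "uedge G e = E" "e \<in> darts G" using assms uedge_of_mem Union_uedges_subset by blast+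
  hence "opp G e \<in> E" "inc G (opp G e) = (w, u)" using e dartD(6) by (auto simp: uedge_def)
  thus "(w, u) \<in> inc G ` \<Union> F" using e by force
qed

lemma arb_reaches_root:
  assumes "\<phi> \<in> arborescences" "v \<in> verts G"
  shows "(v, r) \<in> (inc G ` \<Union> (tree_edges \<phi>))\<^sup>*"
  using assms(2)
proof (induction "depth \<phi> v" arbitrary: v rule: less_induct)
  case less
  show ?case
  proof (cases "v = r")
    case False
    note c = choiceD[OF arb_choices[OF assms(1)] less.prems False]
    have "(snd (inc G (\<phi> v)), r) \<in> (inc G ` \<Union> (tree_edges \<phi>))\<^sup>*"
      using less.hyps c depth_step[OF assms(1) less.prems False] by simp
    moreover have "\<phi> v \<in> \<Union> (tree_edges \<phi>)"
      using False less.prems by (auto simp: tree_edges_def uedge_def)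
    hence "(v, snd (inc G (\<phi> v))) \<in> inc G ` \<Union> (tree_edges \<phi>)"
      using c(2) by (metis image_eqI prod.collapse)
    ultimately show ?thesis by (rule converse_rtrancl_into_rtrancl[rotated])
  qed simp
qed

lemma arb_connected:
  assumes "\<phi> \<in> arborescences" "u \<in> verts G" "w \<in> verts G"
  shows "(u, w) \<in> (inc G ` \<Union> (tree_edges \<phi>))\<^sup>*"
proof -
  have "sym ((inc G ` \<Union> (tree_edges \<phi>))\<^sup>*)"
    using assms by (intro sym_rtrancl sym_inc_image tree_edges_subset arb_choices)
  thus ?thesis using arb_reaches_root[OF assms(1)] assms(2,3) by (meson rtrancl_trans symD)
qed

text \<open>At a vertex of maximal depth on the cycle, the dart leaving it and the dart entering it
  both have it as their deeper end. They are then the two orientations of one edge, against the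
  distinctness of the edges.\<close>

lemma arb_no_cycle:
  assumes \<phi>: "\<phi> \<in> arborescences" and es: "is_cycle (G\<lparr>darts := \<Union> (tree_edges \<phi>)\<rparr>) es"
  shows False
proof -
  define n where "n = length es"
  define x where "x i = fst (inc G (es ! i))" for i
  have sub: "es ! i \<in> \<Union> (tree_edges \<phi>)" if "i < n" for i
    using es that by (auto simp: is_cycle_def n_def dest: nth_mem)
  have n0: "n > 0" using es by (auto simp: is_cycle_def n_def)
  have nxt: "snd (inc G (es ! i)) = x (Suc i mod n)" if "i < n" for i
    using es that by (auto simp: is_cycle_def n_def x_def)
  have dist: "i = j" if "uedge G (es ! i) = uedge G (es ! j)" "i < n" "j < n" for i j
  proof -
    have "distinct (map (uedge G) es)" using es by (simp add: is_cycle_def uedge_def[abs_def])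
    thus ?thesis using that by (auto simp: distinct_conv_nth n_def)
  qed
  define D where "D = (\<lambda>i. depth \<phi> (x i)) ` {..<n}"
  have "Max D \<in> D" using n0 by (intro Max_in) (auto simp: D_def)
  then obtain i where i: "i < n" "depth \<phi> (x i) = Max D" by (auto simp: D_def)
  have le: "depth \<phi> (x k) \<le> depth \<phi> (x i)" if "k < n" for k
    unfolding i(2) using that by (intro Max_ge) (auto simp: D_def)
  \<comment> \<open>The cyclic predecessor of \<open>i\<close>, wrapping around at 0:
    \<open>es ! j\<close> is the dart entering the deepest vertex.\<close>
  define j where "j = (if i = 0 then n - 1 else i - 1)"
  have j: "j < n" "Suc j mod n = i" using i n0 by (auto simp: j_def)
  have out: "es ! i = \<phi> (x i)"
    using \<phi> sub[OF i(1)]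
  proof (cases rule: dart_in_tree_edges)
    case (2 w)
    have "depth \<phi> w \<le> depth \<phi> (x i)"
      using nxt[OF i(1)] le[of "Suc i mod n"] 2 n0 by simp
    with 2 show ?thesis by (simp add: x_def)
  qed (simp add: x_def)
  have inn: "es ! j = opp G (\<phi> (x i))"
    using \<phi> sub[OF j(1)]
  proof (cases rule: dart_in_tree_edges)
    case (1 w)
    have "depth \<phi> w \<le> depth \<phi> (x i)" using le[OF j(1)] 1 by (simp add: x_def)
    with 1 nxt[OF j(1)] j show ?thesis by simp
  next
    case (2 w)
    with nxt[OF j(1)] j show ?thesis by simp
  qed
  have dart: "\<phi> (x i) \<in> darts G"
    using out sub[OF i(1)] Union_uedges_subset tree_edges_subset arb_choices \<phi> by metis
  have "uedge G (es ! i) = uedge G (es ! j)" using out inn uedge_opp[OF dart] by simp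
  \<comment> \<open>In a cycle of length one the two indices do coincide; then a dart would equal
    its own opposite.\<close>
  hence "i = j" using dist i j by blast
  thus False using out inn dartD(4)[OF dart] by simp
qed

lemma tree_edges_spanning_tree:
  assumes "\<phi> \<in> arborescences"
  shows "tree_edges \<phi> \<in> spanning_trees G"
proof -
  have "connected_multigraph (G\<lparr>darts := \<Union> (tree_edges \<phi>)\<rparr>)"
    unfolding connected_multigraph_def using root_in by (auto intro!: arb_connected[OF assms])
  moreover have "\<nexists>es. is_cycle (G\<lparr>darts := \<Union> (tree_edges \<phi>)\<rparr>) es"
    using arb_no_cycle[OF assms] by blast
  ultimately show ?thesis
    unfolding spanning_trees_def is_tree_def
    using tree_edges_subset[OF arb_choices[OF assms]] by blast
qed

lemma uedge_eqD: "uedge G e = uedge G e' \<Longrightarrow> e = e' \<or> e = opp G e'"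
  unfolding uedge_def by blast

text \<open>If \<open>v\<close> and \<open>w\<close> choose opposite darts of one edge, each is the
  successor of the other, so each would be deeper than the other.\<close>

lemma arb_edges_inj:
  assumes \<phi>: "\<phi> \<in> arborescences" and v: "v \<in> verts G" "v \<noteq> r" and w: "w \<in> verts G" "w \<noteq> r"
    and eq: "uedge G (\<phi> v) = uedge G (\<phi> w)"
  shows "v = w"
proof -
  note cv = choiceD[OF arb_choices[OF \<phi>] v] and cw = choiceD[OF arb_choices[OF \<phi>] w]
  from uedge_eqD[OF eq] show ?thesis
  proof
    assume "\<phi> v = opp G (\<phi> w)"
    hence "snd (inc G (\<phi> w)) = v" "snd (inc G (\<phi> v)) = w"
      using cv cw dartD(6)[OF cw(1)] by simp_all
    thus ?thesis using depth_step[OF \<phi> v] depth_step[OF \<phi> w] by simp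
  next
    assume "\<phi> v = \<phi> w"
    hence "fst (inc G (\<phi> v)) = fst (inc G (\<phi> w))" by (rule arg_cong)
    thus ?thesis unfolding cv(2) cw(2) .
  qed
qed

text \<open>Induction on the depth of \<open>v\<close> in \<open>\<phi>\<close>. The edge chosen at
  \<open>v\<close> is chosen by \<open>\<psi>\<close> at some \<open>w\<close>. If the directions
  differ, \<open>w\<close> is the successor of \<open>v\<close> under \<open>\<phi>\<close>, where
  both choices agree already, so \<open>\<phi>\<close> would choose this edge at both
  \<open>v\<close> and \<open>w\<close>.\<close>

lemma tree_edges_inj: "inj_on tree_edges arborescences"
proof (rule inj_onI)
  fix \<phi> \<psi> assume \<phi>: "\<phi> \<in> arborescences" and \<psi>: "\<psi> \<in> arborescences"
    and eq: "tree_edges \<phi> = tree_edges \<psi>"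
  have "\<phi> v = \<psi> v" if "v \<in> verts G" "v \<noteq> r" for v
    using that
  proof (induction "depth \<phi> v" arbitrary: v rule: less_induct)
    case less
    note cv = choiceD[OF arb_choices[OF \<phi>] less.prems]
    have "uedge G (\<phi> v) \<in> tree_edges \<psi>"
      unfolding eq[symmetric] using less.prems by (simp add: tree_edges_def)
    then obtain w where w: "w \<in> verts G" "w \<noteq> r" "uedge G (\<phi> v) = uedge G (\<psi> w)"
      by (auto simp: tree_edges_def)
    note cw = choiceD[OF arb_choices[OF \<psi>] w(1,2)]
    from uedge_eqD[OF w(3)] show ?case
    proof
      assume "\<phi> v = \<psi> w"
      thus ?thesis using cv cw by metis
    next
      assume "\<phi> v = opp G (\<psi> w)"
      hence "snd (inc G (\<phi> v)) = w" using cw dartD(6)[OF cw(1)] by simp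
      hence d: "depth \<phi> w < depth \<phi> v" using depth_step[OF \<phi> less.prems] by simp
      hence "\<phi> w = \<psi> w" using less.hyps w by blast
      hence "v = w" using arb_edges_inj[OF \<phi> less.prems w(1,2)] w(3) by simp
      thus ?thesis using d by simp
    qed
  qed
  moreover have "\<phi> v = \<psi> v" if "v \<notin> verts G - {r}" for v
    using PiE_arb[OF arb_choices[OF \<phi>, unfolded dart_choices_def] that]
      PiE_arb[OF arb_choices[OF \<psi>, unfolded dart_choices_def] that] by simp
  ultimately show "\<phi> = \<psi>" by (intro ext) blast
qed

text \<open>Every vertex picks the first dart of a shortest path to the root.\<close>

lemma arb_exists:
  assumes "D \<subseteq> darts G" and "\<And>v. v \<in> verts G \<Longrightarrow> (v, r) \<in> (inc G ` D)\<^sup>*"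
  shows "\<exists>\<phi>\<in>arborescences. \<forall>v\<in>verts G - {r}. \<phi> v \<in> D"
proof -
  define R where "R = inc G ` D"
  define d where "d v = (LEAST k. (v, r) \<in> R ^^ k)" for v
  have d: "(v, r) \<in> R ^^ d v" if "v \<in> verts G" for v
    unfolding d_def using assms(2)[OF that] unfolding R_def[symmetric]
    by (metis LeastI rtrancl_imp_relpow)
  have ex: "\<exists>e. e \<in> D \<and> fst (inc G e) = v \<and> d (snd (inc G e)) < d v"
    if v: "v \<in> verts G" "v \<noteq> r" for v
  proof -
    obtain m where m: "d v = Suc m" using d[OF v(1)] v(2) by (cases "d v") auto
    with d[OF v(1)] obtain y where y: "(v, y) \<in> R" "(y, r) \<in> R ^^ m"
      by (metis relpow_Suc_D2)
    have "d y \<le> m" unfolding d_def using y(2) by (rule Least_le)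
    moreover obtain e where "e \<in> D" "inc G e = (v, y)" using y(1) unfolding R_def by auto
    ultimately show ?thesis using m by (intro exI[of _ e]) auto
  qed
  define \<phi> where "\<phi> = (\<lambda>v\<in>verts G - {r}. SOME e. e \<in> D \<and> fst (inc G e) = v \<and> d (snd (inc G e)) < d v)"
  have \<phi>: "\<phi> v \<in> D" "fst (inc G (\<phi> v)) = v" "d (snd (inc G (\<phi> v))) < d v"
    if "v \<in> verts G" "v \<noteq> r" for v
    using someI_ex[OF ex[OF that]] that by (auto simp: \<phi>_def)
  have ch: "\<phi> \<in> dart_choices"
    unfolding dart_choices_def
  proof (rule PiE_I)
    show "\<phi> v \<in> {e \<in> darts G. fst (inc G e) = v}" if "v \<in> verts G - {r}" for v
      using \<phi>(1,2)[of v] assms(1) that by auto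
    show "\<phi> v = undefined" if "v \<notin> verts G - {r}" for v
      unfolding \<phi>_def restrict_def using that by (rule if_not_P)
  qed
  have "\<exists>k. (step \<phi> ^^ k) v = r" if "v \<in> verts G" for v
    using that
  proof (induction "d v" arbitrary: v rule: less_induct)
    case less
    show ?case
    proof (cases "v = r")
      case True
      hence "(step \<phi> ^^ 0) v = r" by simp
      thus ?thesis by blast
    next
      case False
      obtain k where "(step \<phi> ^^ k) (snd (inc G (\<phi> v))) = r"
        using less.hyps[of "snd (inc G (\<phi> v))"] \<phi>(3)[OF less.prems False]
          choiceD(3)[OF ch less.prems False] by blast
      hence "(step \<phi> ^^ Suc k) v = r"
        using False by (simp add: funpow_Suc_right step_def del: funpow.simps)
      thus ?thesis by blast
    qed
  qed
  thus ?thesis using ch \<phi>(1) by (intro bexI[of _ \<phi>]) (auto simp: arborescences_def)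
qed

text \<open>If \<open>e\<close> is followed later by its opposite \<open>e'\<close>, then
  \<open>e'\<close> ends at the origin of \<open>e\<close>. A terminus after \<open>e\<close> is the
  origin of a dart after \<open>e\<close> or the endpoint \<open>w\<close>, and both are
  excluded.\<close>

lemma simple_walk_distinct_uedges:
  assumes "walk G u es w" "set es \<subseteq> darts G" "distinct (map (\<lambda>e. fst (inc G e)) es)"
    "w \<notin> (\<lambda>e. fst (inc G e)) ` set es"
  shows "distinct (map (uedge G) es)"
  using assms
proof (induction es arbitrary: u)
  case (Cons e es)
  have "uedge G e \<noteq> uedge G e'" if e': "e' \<in> set es" for e'
  proof
    assume "uedge G e = uedge G e'"
    moreover have "e \<noteq> e'" using Cons.prems e' by auto
    ultimately have "e = opp G e'" using uedge_eqD by blast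
    hence "snd (inc G e') = fst (inc G e)" using Cons.prems e' dartD(6)[of e'] by auto
    moreover have "snd (inc G e') \<in> (\<lambda>e. fst (inc G e)) ` set es \<union> {w}"
      using walk_snd_in Cons.prems e' by (metis walk.simps(2))
    ultimately show False using Cons.prems by auto
  qed
  thus ?case using Cons by auto
qed simp

text \<open>The connected graph spanned by \<open>F\<close> contains an arborescence. An edge of
  \<open>F\<close> outside it would form a cycle with the simple walk in the arborescence that joins
  its ends.\<close>

lemma tree_edges_surj:
  assumes "F \<in> spanning_trees G"
  shows "F \<in> tree_edges ` arborescences"
proof -
  let ?H = "G\<lparr>darts := \<Union> F\<rparr>"
  have F: "F \<subseteq> uedges G" and con: "connected_multigraph ?H" and acyc: "\<nexists>es. is_cycle ?H es"
    using assms by (auto simp: spanning_trees_def is_tree_def)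
  obtain \<phi> where \<phi>: "\<phi> \<in> arborescences" "\<forall>v\<in>verts G - {r}. \<phi> v \<in> \<Union> F"
    using arb_exists[of "\<Union> F"] con root_in Union_uedges_subset[OF F]
    by (auto simp: connected_multigraph_def)
  have sub: "tree_edges \<phi> \<subseteq> F"
    using \<phi>(2) uedge_of_mem[OF F] by (fastforce simp: tree_edges_def)
  have "F \<subseteq> tree_edges \<phi>"
  proof (rule ccontr)
    assume "\<not> F \<subseteq> tree_edges \<phi>"
    then obtain E where E: "E \<in> F" "E \<notin> tree_edges \<phi>" by blast
    then obtain e where e: "E = uedge G e" "e \<in> darts G" using F by (auto simp: uedges_def)
    define D where "D = \<Union> (tree_edges \<phi>)"
    obtain es where es: "walk G (snd (inc G e)) es (fst (inc G e))" "set es \<subseteq> D"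
      "distinct (map (\<lambda>e. fst (inc G e)) es)" "fst (inc G e) \<notin> (\<lambda>e. fst (inc G e)) ` set es"
      using simple_walk_exists[OF arb_connected[OF \<phi>(1) dartD(2,1)[OF e(2)]]] unfolding D_def
      by blast
    note sub' = subset_trans[OF sub F]
    have D: "uedge G d \<in> tree_edges \<phi>" "d \<in> darts G" if d: "d \<in> D" for d
    proof -
      obtain E' where "E' \<in> tree_edges \<phi>" "d \<in> E'" using d by (auto simp: D_def)
      thus "uedge G d \<in> tree_edges \<phi>" using uedge_of_mem[OF sub'] by simp
      show "d \<in> darts G" using d Union_uedges_subset[OF sub'] by (simp add: D_def)
    qed
    have uH: "uedge ?H = uedge G" by (auto simp: uedge_def)
    \<comment> \<open>The edge \<open>E\<close> lies outside the tree, so it differs from every edge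
      of the returning walk. For a loop that walk is empty and the cycle has length one.\<close>
    have "is_cycle ?H (e # es)"
      unfolding is_cycle_def
    proof (intro conjI)
      show "set (e # es) \<subseteq> darts ?H"
        using E(1) e(1) es(2) sub unfolding D_def by (auto simp: uedge_def)
      show "distinct (map (\<lambda>e. fst (inc ?H e)) (e # es))" using es by simp
      show "distinct (map (uedge ?H) (e # es))"
        unfolding uH using simple_walk_distinct_uedges[OF es(1) _ es(3,4)] es(2) D E(2) e(1)
        by auto
      have w: "walk G (fst (inc G e)) (e # es) (fst (inc G e))" using es(1) by simp
      show "\<forall>i<length (e # es). snd (inc ?H ((e # es) ! i))
          = fst (inc ?H ((e # es) ! (Suc i mod length (e # es))))"
      proof (intro allI impI)
        fix i assume i: "i < length (e # es)"
        show "snd (inc ?H ((e # es) ! i)) = fst (inc ?H ((e # es) ! (Suc i mod length (e # es))))"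
        proof (cases "Suc i < length (e # es)")
          case True
          thus ?thesis using walk_nth_Suc[OF w True] by simp
        next
          case False
          hence "i = length es" using i by simp
          moreover have "snd (inc G ((e # es) ! length es)) = fst (inc G e)"
            using walk_last[OF w] unfolding last_conv_nth[OF list.distinct(2)] by simp
          ultimately show ?thesis by simp
        qed
      qed
    qed simp
    thus False using acyc by blast
  qed
  with sub \<phi>(1) show ?thesis by blast
qed

lemma card_spanning_trees: "card (spanning_trees G) = card arborescences"
proof -
  have "bij_betw tree_edges arborescences (spanning_trees G)"
    unfolding bij_betw_def
    using tree_edges_inj tree_edges_surj tree_edges_spanning_tree by blast
  thus ?thesis by (simp add: bij_betw_same_card)
qed

text \<open>A nonzero count has finite valuation, which later allows cancellation.\<close>

lemma card_spanning_trees_pos: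
  assumes "connected_multigraph G"
  shows "card (spanning_trees G) > 0"
proof -
  have "arborescences \<noteq> {}"
    using arb_exists[of "darts G"] assms root_in by (auto simp: connected_multigraph_def)
  moreover have "finite arborescences"
    using finite_dart_choices by (rule finite_subset[rotated]) (auto simp: arborescences_def)
  ultimately show ?thesis by (simp add: card_spanning_trees card_gt_0_iff)
qed

end

section \<open>The Laplacian and the matrix-tree theorem\<close>

text \<open>Valency minus adjacency, collected dart by dart: a loop contributes zero, and each row
  is a sum over outgoing darts, ready for multilinear expansion.\<close>

definition laplacian :: "('v, 'e) multigraph \<Rightarrow> 'v list \<Rightarrow> 'a::comm_ring_1 mat" where
  "laplacian G vs = mat (length vs) (length vs) (\<lambda>(i, j).
     \<Sum>e\<in>{e \<in> darts G. fst (inc G e) = vs ! i}. of_bool (i = j) - of_bool (snd (inc G e) = vs ! j))"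

lemma laplacian_carrier: "laplacian G vs \<in> carrier_mat (length vs) (length vs)"
  by (simp add: laplacian_def)

text \<open>Replacing the deleted row by a unit vector keeps the index set \<open>{0..<n}\<close>,
  so the minor becomes a sum over permutations of all indices.\<close>

lemma det_replace_row_unit:
  fixes A :: "'a::comm_ring_1 mat"
  assumes A: "A \<in> carrier_mat n n" and k: "k < n"
  shows "det (mat n n (\<lambda>(i, j). if i = k then of_bool (j = k) else A $$ (i, j)))
    = det (mat_delete A k k)"
proof -
  let ?B = "mat n n (\<lambda>(i, j). if i = k then of_bool (j = k) else A $$ (i, j))"
  have B: "?B \<in> carrier_mat n n" by simp
  have "det ?B = (\<Sum>j<n. ?B $$ (k, j) * cofactor ?B k j)"
    by (rule laplace_expansion_row[OF B k])
  also have "\<dots> = (\<Sum>j<n. if j = k then cofactor ?B k k else 0)"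
    using k by (intro sum.cong) auto
  also have "\<dots> = det (mat_delete ?B k k)"
    using k by (simp add: cofactor_def)
  also have "mat_delete ?B k k = mat_delete A k k"
    using A k by (intro eq_matI) (auto simp: mat_delete_def)
  finally show ?thesis .
qed

context rooted_multigraph
begin

context
  fixes vs :: "'v list" and k :: nat
  assumes vs: "distinct vs" "set vs = verts G" and k: "k < length vs" "vs ! k = r"
begin

text \<open>The Laplacian in which every vertex other than the root keeps only its chosen dart, with
  the row of the root replaced by a unit vector.\<close>

definition choice_matrix :: "('v \<Rightarrow> 'e) \<Rightarrow> 'a::comm_ring_1 mat" where
  "choice_matrix \<phi> = mat (length vs) (length vs) (\<lambda>(i, j).
     of_bool (i = j) - of_bool (i \<noteq> k \<and> snd (inc G (\<phi> (vs ! i))) = vs ! j))"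

lemma nth_root_iff: "i < length vs \<Longrightarrow> vs ! i = r \<longleftrightarrow> i = k"
  using vs k by (auto simp: nth_eq_iff_index_eq)

lemma step_in_verts:
  assumes "\<phi> \<in> dart_choices" "v \<in> verts G"
  shows "step \<phi> v \<in> verts G"
  using choiceD(3)[OF assms] root_in by (simp add: step_def)

text \<open>
  A permutation with a nonzero contribution moves each index either nowhere or along \<open>\<phi>\<close>, so a
  moved index would be followed by \<open>\<phi>\<close> forever without reaching the root.
\<close>

lemma det_choice_matrix_arb:
  assumes \<phi>: "\<phi> \<in> arborescences"
  shows "det (choice_matrix \<phi> :: 'a::idom mat) = 1"
proof -
  define n where "n = length vs"
  let ?B = "choice_matrix \<phi> :: 'a mat"
  have B: "?B \<in> carrier_mat n n" by (simp add: choice_matrix_def n_def)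
  have zero: "signof \<pi> * (\<Prod>i = 0..<n. ?B $$ (i, \<pi> i)) = 0"
    if \<pi>: "\<pi> permutes {0..<n}" "\<pi> \<noteq> id" for \<pi>
  proof (rule ccontr)
    assume "signof \<pi> * (\<Prod>i = 0..<n. ?B $$ (i, \<pi> i)) \<noteq> 0"
    hence nz: "?B $$ (i, \<pi> i) \<noteq> 0" if "i < n" for i using that by auto
    have lt: "\<pi> i < n" if "i < n" for i using permutes_in_image[OF \<pi>(1), of i] that by simp
    have move: "i \<noteq> k \<and> step \<phi> (vs ! i) = vs ! \<pi> i" if i: "i < n" "\<pi> i \<noteq> i" for i
    proof -
      have "i \<noteq> k \<and> snd (inc G (\<phi> (vs ! i))) = vs ! \<pi> i"
        using nz[OF i(1)] i lt[OF i(1)] by (auto simp: choice_matrix_def n_def split: if_splits)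
      moreover have "vs ! i \<noteq> r" if "i \<noteq> k" using nth_root_iff i that by (simp add: n_def)
      ultimately show ?thesis by (simp add: step_def)
    qed
    obtain i0 where "\<pi> i0 \<noteq> i0" using \<pi>(2) by (auto simp: fun_eq_iff)
    moreover hence "i0 < n" using \<pi>(1) by (metis atLeast0LessThan lessThan_iff permutes_not_in)
    ultimately have i0: "i0 < n" "\<pi> i0 \<noteq> i0" by auto
    have inv: "(\<pi> ^^ m) i0 < n \<and> \<pi> ((\<pi> ^^ m) i0) \<noteq> (\<pi> ^^ m) i0 \<and>
        (step \<phi> ^^ m) (vs ! i0) = vs ! ((\<pi> ^^ m) i0)" for m
    proof (induction m)
      case (Suc m)
      thus ?case using lt move permutes_inj[OF \<pi>(1)] by (auto simp: inj_eq)
    qed (use i0 in auto)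
    have "vs ! i0 \<in> verts G" using vs i0 by (auto simp: n_def)
    then obtain m where "(step \<phi> ^^ m) (vs ! i0) = r" using \<phi> by (auto simp: arborescences_def)
    hence "(\<pi> ^^ m) i0 = k" using inv[of m] nth_root_iff by (simp add: n_def)
    thus False using move[of k] inv[of m] by auto
  qed
  have "det ?B = (\<Sum>\<pi> | \<pi> permutes {0..<n}. signof \<pi> * (\<Prod>i = 0..<n. ?B $$ (i, \<pi> i)))"
    by (rule det_def'[OF B])
  also have "\<dots> = (\<Sum>\<pi> | \<pi> permutes {0..<n}. if \<pi> = id then (\<Prod>i = 0..<n. ?B $$ (i, i)) else 0)"
    by (intro sum.cong refl) (use zero in auto)
  also have "\<dots> = (\<Prod>i = 0..<n. ?B $$ (i, i))"
    by (simp add: finite_permutations permutes_id)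
  also have "\<dots> = 1"
  proof (intro prod.neutral ballI)
    fix i assume "i \<in> {0..<n}"
    hence i: "i < n" by simp
    have "snd (inc G (\<phi> (vs ! i))) \<noteq> vs ! i" if "i \<noteq> k"
    proof
      assume eq: "snd (inc G (\<phi> (vs ! i))) = vs ! i"
      have "vs ! i \<in> verts G" "vs ! i \<noteq> r" using vs i that nth_root_iff by (auto simp: n_def)
      from depth_step[OF \<phi> this] show False unfolding eq by simp
    qed
    thus "?B $$ (i, i) = 1" using i by (auto simp: choice_matrix_def n_def)
  qed
  finally show ?thesis .
qed

text \<open>The indicator vector of the vertices that never reach the root lies in the kernel.\<close>

lemma det_choice_matrix_not_arb:
  assumes \<phi>: "\<phi> \<in> dart_choices" and na: "\<phi> \<notin> arborescences"
  shows "det (choice_matrix \<phi> :: 'a::idom mat) = 0"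
proof -
  define n where "n = length vs"
  let ?B = "choice_matrix \<phi> :: 'a mat"
  have B: "?B \<in> carrier_mat n n" by (simp add: choice_matrix_def n_def)
  define stuck where "stuck v \<longleftrightarrow> (\<forall>m. (step \<phi> ^^ m) v \<noteq> r)" for v
  have stuck_step: "stuck (step \<phi> v) \<longleftrightarrow> stuck v" if "v \<noteq> r" for v
  proof -
    have "(step \<phi> ^^ m) (step \<phi> v) = (step \<phi> ^^ Suc m) v" for m
      by (simp add: funpow_Suc_right del: funpow.simps)
    thus ?thesis unfolding stuck_def using that by (metis funpow_0 not0_implies_Suc)
  qed
  have not_stuck_r: "\<not> stuck r" unfolding stuck_def by (metis funpow_0)
  define w :: "'a vec" where "w = vec n (\<lambda>i. of_bool (stuck (vs ! i)))"
  obtain v where "v \<in> verts G" "stuck v"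
    using \<phi> na by (auto simp: arborescences_def stuck_def)
  then obtain i where i: "i < n" "stuck (vs ! i)" using vs by (metis in_set_conv_nth n_def)
  hence "w $ i \<noteq> 0\<^sub>v n $ i" by (simp add: w_def)
  hence w0: "w \<noteq> 0\<^sub>v n" by auto
  have "?B *\<^sub>v w = 0\<^sub>v n"
  proof (rule eq_vecI)
    fix i assume "i < dim_vec (0\<^sub>v n :: 'a vec)"
    hence i: "i < n" by simp
    have "(?B *\<^sub>v w) $ i = (\<Sum>j = 0..<n. ?B $$ (i, j) * w $ j)"
      using i by (simp add: choice_matrix_def n_def scalar_prod_def w_def)
    also have "\<dots> = 0"
    proof (cases "i = k")
      case True
      have "(\<Sum>j = 0..<n. ?B $$ (i, j) * w $ j) = (\<Sum>j = 0..<n. if j = k then w $ k else 0)"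
        using True i by (intro sum.cong) (auto simp: choice_matrix_def n_def)
      also have "\<dots> = 0" using k not_stuck_r by (simp add: w_def n_def)
      finally show ?thesis .
    next
      case False
      hence vr: "vs ! i \<noteq> r" "vs ! i \<in> verts G" using i nth_root_iff vs by (auto simp: n_def)
      have st: "step \<phi> (vs ! i) = snd (inc G (\<phi> (vs ! i)))" using vr by (simp add: step_def)
      obtain j' where j': "j' < n" "vs ! j' = step \<phi> (vs ! i)"
        using step_in_verts[OF \<phi> vr(2)] vs by (metis in_set_conv_nth n_def)
      have "(\<Sum>j = 0..<n. ?B $$ (i, j) * w $ j)
          = (\<Sum>j = 0..<n. (if j = i then w $ i else 0) - (if j = j' then w $ j' else 0))"
      proof (intro sum.cong refl)
        fix j assume "j \<in> {0..<n}"
        hence j: "j < n" by simp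
        have "snd (inc G (\<phi> (vs ! i))) = vs ! j \<longleftrightarrow> j = j'"
          unfolding st[symmetric] j'(2)[symmetric] using j j' vs
          by (auto simp: nth_eq_iff_index_eq n_def)
        thus "?B $$ (i, j) * w $ j = (if j = i then w $ i else 0) - (if j = j' then w $ j' else 0)"
          using i j False by (auto simp: choice_matrix_def n_def)
      qed
      also have "\<dots> = w $ i - w $ j'" using i j' by (simp add: sum_subtractf)
      also have "\<dots> = 0" using i j' stuck_step[OF vr(1)] by (simp add: w_def)
      finally show ?thesis .
    qed
    finally show "(?B *\<^sub>v w) $ i = 0\<^sub>v n $ i" using i by simp
  qed (simp add: choice_matrix_def n_def)
  moreover have "w \<in> carrier_vec n" by (simp add: w_def)
  ultimately show ?thesis using det_0_iff_vec_prod_zero[OF B] w0 by blast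
qed

text \<open>
  Each row of the Laplacian is a sum over the darts leaving a vertex; multilinearity of the
  determinant in the rows turns it into a sum over all choices of one dart per vertex.
\<close>

theorem matrix_tree:
  "det (mat_delete (laplacian G vs) k k) = (of_nat (card (spanning_trees G)) :: 'a::idom)"
proof -
  define n where "n = length vs"
  let ?L = "laplacian G vs :: 'a mat"
  define A where "A = mat n n (\<lambda>(i, j). if i = k then of_bool (j = k) else ?L $$ (i, j))"
  let ?B = "\<lambda>\<phi>. choice_matrix \<phi> :: 'a mat"
  define out where "out v = {e \<in> darts G. fst (inc G e) = v}" for v
  \<comment> \<open>Inverse of the enumeration, to pass from products over row indices to products
    over vertices, whose expansion is indexed by \<open>dart_choices\<close>.\<close>
  define idx where "idx = the_inv_into {0..<n} ((!) vs)"
  have inj: "inj_on ((!) vs) {0..<n}" using vs by (auto simp: inj_on_def nth_eq_iff_index_eq n_def)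
  have idx: "idx (vs ! i) = i" if "i < n" for i
    unfolding idx_def using that by (intro the_inv_into_f_f inj) simp
  have bij: "bij_betw ((!) vs) ({0..<n} - {k}) (verts G - {r})"
  proof -
    have "bij_betw ((!) vs) {0..<n} (verts G)"
      using bij_betw_nth[OF vs(1)] vs(2) by (simp add: n_def atLeast0LessThan)
    thus ?thesis using k root_in by (intro bij_betw_DiffI) (auto simp: n_def)
  qed
  have fin: "finite (verts G)" "finite (darts G)" using finite_G by (auto simp: finite_multigraph_def)
  have row: "(\<Prod>i = 0..<n. A $$ (i, \<pi> i)) = (\<Sum>\<phi>\<in>dart_choices. \<Prod>i = 0..<n. ?B \<phi> $$ (i, \<pi> i))"
    if \<pi>: "\<pi> permutes {0..<n}" for \<pi>
  proof -
    have lt: "\<pi> i < n" if "i < n" for i using permutes_in_image[OF \<pi>, of i] that by simp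
    have kn: "k \<in> {0..<n}" "k < n" using k by (auto simp: n_def)
    define h where "h i e = (of_bool (i = \<pi> i) - of_bool (snd (inc G e) = vs ! \<pi> i) :: 'a)" for i e
    have "(\<Prod>i = 0..<n. A $$ (i, \<pi> i)) = A $$ (k, \<pi> k) * (\<Prod>i\<in>{0..<n} - {k}. A $$ (i, \<pi> i))"
      using kn by (simp add: prod.remove)
    also have "(\<Prod>i\<in>{0..<n} - {k}. A $$ (i, \<pi> i))
        = (\<Prod>i\<in>{0..<n} - {k}. \<Sum>e\<in>out (vs ! i). h (idx (vs ! i)) e)"
      by (intro prod.cong refl) (use lt idx in \<open>auto simp: A_def laplacian_def n_def out_def h_def\<close>)
    also have "\<dots> = (\<Prod>v\<in>verts G - {r}. \<Sum>e\<in>out v. h (idx v) e)"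
      by (rule prod.reindex_bij_betw[OF bij])
    also have "\<dots> = (\<Sum>\<phi>\<in>dart_choices. \<Prod>v\<in>verts G - {r}. h (idx v) (\<phi> v))"
      unfolding dart_choices_def out_def[symmetric]
      by (rule prod_sum_PiE) (use fin in \<open>auto simp: out_def\<close>)
    also have "\<dots> = (\<Sum>\<phi>\<in>dart_choices. \<Prod>i\<in>{0..<n} - {k}. h (idx (vs ! i)) (\<phi> (vs ! i)))"
      by (intro sum.cong refl prod.reindex_bij_betw[OF bij, symmetric])
    also have "\<dots> = (\<Sum>\<phi>\<in>dart_choices. \<Prod>i\<in>{0..<n} - {k}. ?B \<phi> $$ (i, \<pi> i))"
      by (intro sum.cong prod.cong refl)
         (use lt idx in \<open>auto simp: choice_matrix_def n_def h_def\<close>)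
    \<comment> \<open>Row \<open>k\<close> is the same unit vector in \<open>A\<close> and in every
      choice matrix, so its entry can be moved into each summand.\<close>
    also have "A $$ (k, \<pi> k) * \<dots>
        = (\<Sum>\<phi>\<in>dart_choices. ?B \<phi> $$ (k, \<pi> k) * (\<Prod>i\<in>{0..<n} - {k}. ?B \<phi> $$ (i, \<pi> i)))"
      unfolding sum_distrib_left
      by (intro sum.cong refl arg_cong2[of _ _ _ _ "(*)"])
         (use kn lt[OF kn(2)] in \<open>auto simp: choice_matrix_def A_def n_def\<close>)
    also have "\<dots> = (\<Sum>\<phi>\<in>dart_choices. \<Prod>i = 0..<n. ?B \<phi> $$ (i, \<pi> i))"
      using kn by (intro sum.cong refl prod.remove[symmetric]) auto
    finally show ?thesis .
  qed
  have "det (mat_delete ?L k k) = det A"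
    unfolding A_def using k laplacian_carrier
    by (intro det_replace_row_unit[symmetric]) (auto simp: n_def)
  also have "\<dots> = (\<Sum>\<pi> | \<pi> permutes {0..<n}. signof \<pi> * (\<Prod>i = 0..<n. A $$ (i, \<pi> i)))"
    by (rule det_def') (simp add: A_def)
  also have "\<dots> = (\<Sum>\<pi> | \<pi> permutes {0..<n}.
      \<Sum>\<phi>\<in>dart_choices. signof \<pi> * (\<Prod>i = 0..<n. ?B \<phi> $$ (i, \<pi> i)))"
    by (intro sum.cong refl) (simp add: row sum_distrib_left)
  also have "\<dots> = (\<Sum>\<phi>\<in>dart_choices. det (?B \<phi>))"
    unfolding sum.swap[of _ dart_choices]
    by (intro sum.cong refl det_def'[symmetric]) (simp add: choice_matrix_def n_def)
  also have "\<dots> = (\<Sum>\<phi>\<in>dart_choices. of_bool (\<phi> \<in> arborescences))"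
    using det_choice_matrix_arb det_choice_matrix_not_arb by (intro sum.cong refl) auto
  also have "\<dots> = of_nat (card (dart_choices \<inter> arborescences))"
    using finite_dart_choices by (simp add: of_bool_def sum.If_cases)
  also have "dart_choices \<inter> arborescences = arborescences" by (auto simp: arborescences_def)
  finally show ?thesis by (simp add: card_spanning_trees)
qed

end

end

lemma poly_char_poly_0:
  fixes A :: "'a::idom mat"
  assumes "A \<in> carrier_mat n n"
  shows "poly (char_poly A) 0 = (- 1) ^ n * det A"
proof -
  have hom: "comm_ring_hom (\<lambda>q :: 'a poly. poly q 0)" by unfold_locales auto
  have "poly (char_poly A) 0 = det (map_mat (\<lambda>q. poly q 0) (char_poly_matrix A))"
    by (simp only: char_poly_def comm_ring_hom.hom_det[OF hom])
  also have "map_mat (\<lambda>q. poly q 0) (char_poly_matrix A) = (- 1) \<cdot>\<^sub>m A"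
    using assms by (intro eq_matI) (auto simp: char_poly_matrix_def)
  finally show ?thesis using assms by simp
qed

text \<open>The derivative is the sum of the characteristic polynomials of the principal minors, and
  the matrix-tree theorem gives each of them the same value at 0, whichever vertex is deleted.
  Unlike a single minor, this coefficient is invariant under conjugation.\<close>

lemma pderiv_char_poly_laplacian:
  assumes G: "finite_multigraph G" and vs: "distinct vs" "set vs = verts G"
  shows "poly (pderiv (char_poly (laplacian G vs))) 0
    = ((- 1) ^ (length vs - 1) * of_nat (length vs * card (spanning_trees G)) :: 'a::idom)"
proof -
  let ?L = "laplacian G vs :: 'a mat" and ?n = "length vs"
  have "poly (char_poly (mat_delete ?L i i)) 0 = (- 1) ^ (?n - 1) * of_nat (card (spanning_trees G))"
    if i: "i < ?n" for i
  proof -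
    interpret rooted_multigraph G "vs ! i"
      using G vs i by unfold_locales auto
    show ?thesis
      using poly_char_poly_0[OF mat_delete_carrier[OF laplacian_carrier[of G vs, where 'a = 'a]], of i i]
        matrix_tree[OF vs i refl, where 'a = 'a] by simp
  qed
  thus ?thesis
    by (simp add: pderiv_char_poly[OF laplacian_carrier] poly_sum algebra_simps)
qed

section \<open>Diagonalisation by roots of unity\<close>

text \<open>Indices of block matrices are encoded as \<open>k = \<tau> * g + j\<close>, with block
  number \<open>\<tau>\<close> and position \<open>j\<close> inside the block.\<close>

lemma sum_blocks:
  fixes h :: "nat \<Rightarrow> nat \<Rightarrow> 'a::comm_monoid_add"
  assumes "g > 0"
  shows "(\<Sum>k = 0..<g * N. h (k mod g) (k div g)) = (\<Sum>\<tau> = 0..<N. \<Sum>j = 0..<g. h j \<tau>)"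
proof -
  have "\<tau> * g + j < N * g" if "\<tau> < N" "j < g" for \<tau> j
  proof -
    have "\<tau> * g + j < Suc \<tau> * g" using that by simp
    also have "\<dots> \<le> N * g" using that by (intro mult_le_mono1) simp
    finally show ?thesis .
  qed
  hence "(\<Sum>k = 0..<g * N. h (k mod g) (k div g)) = (\<Sum>(\<tau>, j)\<in>{0..<N} \<times> {0..<g}. h j \<tau>)"
    using assms
    by (intro sum.reindex_bij_witness[of _ "\<lambda>(\<tau>, j). \<tau> * g + j" "\<lambda>k. (k div g, k mod g)"])
       (auto simp: less_mult_imp_div_less mult.commute)
  thus ?thesis by (simp add: sum.cartesian_product)
qed

definition block_diag :: "nat \<Rightarrow> nat \<Rightarrow> (nat \<Rightarrow> 'a mat) \<Rightarrow> 'a::zero mat" where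
  "block_diag g N M = mat (g * N) (g * N) (\<lambda>(k, k').
     if k div g = k' div g then M (k div g) $$ (k mod g, k' mod g) else 0)"

text \<open>Induction on the number of blocks, splitting off the last one as a lower right block
  with zero blocks beside it.\<close>

lemma char_poly_block_diag:
  fixes M :: "nat \<Rightarrow> 'a::idom mat"
  assumes g: "g > 0" and M: "\<And>t. t < N \<Longrightarrow> M t \<in> carrier_mat g g"
  shows "char_poly (block_diag g N M) = (\<Prod>t<N. char_poly (M t))"
  using M
proof (induction N)
  case 0
  show ?case by (simp add: block_diag_def char_poly_def char_poly_matrix_def)
next
  case (Suc N)
  let ?C = "char_poly_matrix (block_diag g N M)" and ?D = "char_poly_matrix (M N)"
  have MN: "M N \<in> carrier_mat g g" using Suc.prems by simp
  have c: "?C \<in> carrier_mat (g * N) (g * N)" by (simp add: block_diag_def)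
  have d: "?D \<in> carrier_mat g g" using MN by simp
  have div_lt: "k div g < N \<longleftrightarrow> k < g * N" for k
    using g by (simp add: div_less_iff_less_mult mult.commute)
  have hi: "k div g = N \<and> k mod g = k - g * N" if "\<not> k < g * N" "k < g * N + g" for k
  proof -
    define j where "j = k - g * N"
    have "k = g * N + j" "j < g" using that by (auto simp: j_def)
    thus ?thesis using g by (simp add: div_mult_self4)
  qed
  have "char_poly_matrix (block_diag g (Suc N) M)
      = four_block_mat ?C (0\<^sub>m (g * N) g) (0\<^sub>m g (g * N)) ?D"
  proof (rule eq_matI)
    fix k k'
    assume "k < dim_row (four_block_mat ?C (0\<^sub>m (g * N) g) (0\<^sub>m g (g * N)) ?D)"
      "k' < dim_col (four_block_mat ?C (0\<^sub>m (g * N) g) (0\<^sub>m g (g * N)) ?D)"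
    hence k: "k < g * N + g" "k' < g * N + g" using c d by auto
    have neq: "k div g \<noteq> k' div g" if "k < g * N \<longleftrightarrow> \<not> k' < g * N"
      using that div_lt by metis
    show "char_poly_matrix (block_diag g (Suc N) M) $$ (k, k')
      = four_block_mat ?C (0\<^sub>m (g * N) g) (0\<^sub>m g (g * N)) ?D $$ (k, k')"
    proof (cases "k < g * N"; cases "k' < g * N")
      assume "k < g * N" "k' < g * N"
      thus ?thesis using c d MN k by (simp add: char_poly_matrix_def block_diag_def)
    next
      assume kk: "k < g * N" "\<not> k' < g * N"
      thus ?thesis using c d MN k neq by (simp add: char_poly_matrix_def block_diag_def)
    next
      assume kk: "\<not> k < g * N" "k' < g * N"
      thus ?thesis using c d MN k neq by (simp add: char_poly_matrix_def block_diag_def)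
    next
      assume kk: "\<not> k < g * N" "\<not> k' < g * N"
      have "k - g * N < g" "k' - g * N < g" using k kk by auto
      moreover have "k - g * N = k' - g * N \<longleftrightarrow> k = k'" using k kk by auto
      ultimately show ?thesis using c d MN k kk hi[of k] hi[of k']
        by (simp add: char_poly_matrix_def block_diag_def)
    qed
  qed (use c MN in \<open>simp_all add: block_diag_def char_poly_matrix_def\<close>)
  hence "char_poly (block_diag g (Suc N) M) = det ?C * det ?D"
    unfolding char_poly_def[of "block_diag g (Suc N) M"]
    using det_four_block_mat_lower_left_zero[OF c _ refl d] by simp
  thus ?case using Suc by (simp add: char_poly_def)
qed

lemma primitive_root_power_inj:
  fixes \<zeta> :: "'a::field"
  assumes z: "primitive_root_of_unity N \<zeta>" and "a < N" "b < N" "\<zeta> ^ a = \<zeta> ^ b"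
  shows "a = b"
proof -
  have *: "a = b" if "a \<le> b" "b < N" "\<zeta> ^ a = \<zeta> ^ b" for a b
  proof (rule ccontr)
    assume "a \<noteq> b"
    have "\<zeta> \<noteq> 0"
    proof
      assume "\<zeta> = 0"
      hence "(0 :: 'a) ^ N = 1" using z by (simp add: primitive_root_of_unity_def)
      thus False using that by (simp add: power_0_left split: if_splits)
    qed
    have "\<zeta> ^ a * \<zeta> ^ (b - a) = \<zeta> ^ a * 1"
      unfolding power_add[symmetric] using that(1,3) by simp
    hence "\<zeta> ^ (b - a) = 1" using \<open>\<zeta> \<noteq> 0\<close> by simp
    moreover have "0 < b - a" "b - a < N" using that \<open>a \<noteq> b\<close> by auto
    ultimately show False using z by (auto simp: primitive_root_of_unity_def)
  qed
  show ?thesis using *[of a b] *[of b a] assms by (cases "a \<le> b") auto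
qed

text \<open>A geometric sum whose ratio, the quotient of the powers of \<open>\<zeta>\<close> with
  exponents \<open>s\<close> and \<open>t\<close>, is an \<open>N\<close>-th root of unity and
  equals 1 only for \<open>s = t\<close>.\<close>

lemma primitive_root_orthogonality:
  fixes \<zeta> :: "'a::field"
  assumes z: "primitive_root_of_unity N \<zeta>" and "s < N" "t < N"
  shows "(\<Sum>\<tau> = 0..<N. \<zeta> ^ (s * \<tau>) * inverse \<zeta> ^ (\<tau> * t)) = (if s = t then of_nat N else 0)"
proof -
  have zN: "\<zeta> ^ N = 1" using z by (simp add: primitive_root_of_unity_def)
  have z0: "\<zeta> \<noteq> 0" using zN assms by (auto simp: power_0_left split: if_splits)
  define \<eta> where "\<eta> = \<zeta> ^ s * inverse \<zeta> ^ t"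
  have sum: "(\<Sum>\<tau> = 0..<N. \<zeta> ^ (s * \<tau>) * inverse \<zeta> ^ (\<tau> * t)) = (\<Sum>\<tau><N. \<eta> ^ \<tau>)"
    unfolding atLeast0LessThan \<eta>_def power_mult_distrib
    by (intro sum.cong refl) (simp add: power_mult mult.commute flip: power_mult)
  show ?thesis
  proof (cases "s = t")
    case True
    hence "\<eta> = 1" using z0 by (simp add: \<eta>_def flip: power_mult_distrib)
    thus ?thesis using True unfolding sum by simp
  next
    case False
    have "\<eta> \<noteq> 1"
    proof
      assume "\<eta> = 1"
      hence "\<zeta> ^ s = \<zeta> ^ t" using z0 by (simp add: \<eta>_def field_simps)
      thus False using primitive_root_power_inj[OF z assms(2,3)] False by simp
    qed
    moreover have "\<eta> ^ N = 1"
    proof -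
      have "\<eta> ^ N = (\<zeta> ^ N) ^ s * inverse (\<zeta> ^ N) ^ t"
        unfolding \<eta>_def by (simp add: power_mult_distrib power_inverse mult.commute flip: power_mult)
      thus ?thesis by (simp add: zN)
    qed
    ultimately show ?thesis using False unfolding sum by (simp add: geometric_sum)
  qed
qed

text \<open>
  A block matrix whose block rows act on the geometric vectors \<open>(\<zeta>^(t \<tau>))\<close> by \<open>M t\<close> is conjugate,
  by the discrete Fourier matrix, to the block diagonal matrix of the \<open>M t\<close>.
\<close>

lemma char_poly_block_fourier:
  fixes \<zeta> :: "'a::field" and M :: "nat \<Rightarrow> 'a mat" and a :: "nat \<Rightarrow> nat \<Rightarrow> nat \<Rightarrow> nat \<Rightarrow> 'a"
  assumes g: "g > 0" and N: "of_nat N \<noteq> (0 :: 'a)" and z: "primitive_root_of_unity N \<zeta>"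
    and M: "\<And>t. t < N \<Longrightarrow> M t \<in> carrier_mat g g"
    and eig: "\<And>i j \<sigma> t. i < g \<Longrightarrow> j < g \<Longrightarrow> \<sigma> < N \<Longrightarrow> t < N \<Longrightarrow>
      (\<Sum>\<tau> = 0..<N. a i \<sigma> j \<tau> * \<zeta> ^ (\<tau> * t)) = \<zeta> ^ (\<sigma> * t) * M t $$ (i, j)"
  shows "char_poly (mat (g * N) (g * N) (\<lambda>(k, k'). a (k mod g) (k div g) (k' mod g) (k' div g)))
    = (\<Prod>t<N. char_poly (M t))"
proof -
  let ?n = "g * N"
  define A where "A = mat ?n ?n (\<lambda>(k, k'). a (k mod g) (k div g) (k' mod g) (k' div g))"
  define B where "B = block_diag g N M"
  \<comment> \<open>\<open>P\<close> is the Kronecker product of the Fourier matrix of size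
    \<open>N\<close> with the identity of size \<open>g\<close>; \<open>Q\<close> will be its
    inverse.\<close>
  define P where "P = mat ?n ?n (\<lambda>(k, k').
    if k mod g = k' mod g then \<zeta> ^ ((k div g) * (k' div g)) else 0)"
  define Q where "Q = mat ?n ?n (\<lambda>(k, k').
    if k mod g = k' mod g then inverse \<zeta> ^ ((k div g) * (k' div g)) / of_nat N else 0)"
  have car: "A \<in> carrier_mat ?n ?n" "B \<in> carrier_mat ?n ?n" "P \<in> carrier_mat ?n ?n"
    "Q \<in> carrier_mat ?n ?n"
    by (simp_all add: A_def B_def P_def Q_def block_diag_def)
  have bnd: "k mod g < g" "k div g < N" if "k < ?n" for k
    using that g by (simp_all add: less_mult_imp_div_less mult.commute)
  have prod: "(U * V) $$ (k, k') = (\<Sum>\<tau> = 0..<N. \<Sum>j = 0..<g. u j \<tau> * v j \<tau>)"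
    if "U \<in> carrier_mat ?n ?n" "V \<in> carrier_mat ?n ?n" "k < ?n" "k' < ?n"
      and u: "\<And>k''. k'' < ?n \<Longrightarrow> U $$ (k, k'') = u (k'' mod g) (k'' div g)"
      and v: "\<And>k''. k'' < ?n \<Longrightarrow> V $$ (k'', k') = v (k'' mod g) (k'' div g)"
    for U V :: "'a mat" and u v k k'
  proof -
    have "(U * V) $$ (k, k') = (\<Sum>k'' = 0..<?n. U $$ (k, k'') * V $$ (k'', k'))"
      using that by (simp add: scalar_prod_def)
    also have "\<dots> = (\<Sum>k'' = 0..<?n. u (k'' mod g) (k'' div g) * v (k'' mod g) (k'' div g))"
      using u v by (intro sum.cong) auto
    also have "\<dots> = (\<Sum>\<tau> = 0..<N. \<Sum>j = 0..<g. u j \<tau> * v j \<tau>)"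
      by (rule sum_blocks[OF g, where h = "\<lambda>i \<tau>. u i \<tau> * v i \<tau>"])
    finally show ?thesis .
  qed
  have AP: "A * P = P * B"
  proof (rule eq_matI)
    fix k k' assume "k < dim_row (P * B)" "k' < dim_col (P * B)"
    hence k: "k < ?n" "k' < ?n" using car by auto
    let ?i = "k mod g" and ?s = "k div g" and ?j = "k' mod g" and ?t = "k' div g"
    have "(A * P) $$ (k, k') = (\<Sum>\<tau> = 0..<N. \<Sum>j = 0..<g.
        a ?i ?s j \<tau> * (if j = ?j then \<zeta> ^ (\<tau> * ?t) else 0))"
      using k by (intro prod car) (auto simp: A_def P_def)
    also have "\<dots> = (\<Sum>\<tau> = 0..<N. \<Sum>j = 0..<g. if j = ?j then a ?i ?s j \<tau> * \<zeta> ^ (\<tau> * ?t) else 0)"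
      by (intro sum.cong refl) auto
    also have "\<dots> = (\<Sum>\<tau> = 0..<N. a ?i ?s ?j \<tau> * \<zeta> ^ (\<tau> * ?t))"
      using g by simp
    also have "\<dots> = \<zeta> ^ (?s * ?t) * M ?t $$ (?i, ?j)"
      using k bnd by (intro eig) auto
    \<comment> \<open>The single surviving term is spread out again with Kronecker deltas, to meet
      the expansion of \<open>P * B\<close>.\<close>
    also have "\<dots> = (\<Sum>\<tau> = 0..<N. if \<tau> = ?t then \<zeta> ^ (?s * ?t) * M ?t $$ (?i, ?j) else 0)"
      using k bnd by simp
    also have "\<dots> = (\<Sum>\<tau> = 0..<N. \<Sum>j = 0..<g.
        if j = ?i then (if \<tau> = ?t then \<zeta> ^ (?s * ?t) * M ?t $$ (?i, ?j) else 0) else 0)"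
      using g by simp
    also have "\<dots> = (\<Sum>\<tau> = 0..<N. \<Sum>j = 0..<g.
        (if ?i = j then \<zeta> ^ (?s * \<tau>) else 0) * (if \<tau> = ?t then M \<tau> $$ (j, ?j) else 0))"
      by (intro sum.cong refl) auto
    also have "\<dots> = (P * B) $$ (k, k')"
      using k by (intro prod[symmetric] car) (auto simp: P_def B_def block_diag_def)
    finally show "(A * P) $$ (k, k') = (P * B) $$ (k, k')" .
  qed (use car in auto)
  have PQ: "P * Q = 1\<^sub>m ?n"
  proof (rule eq_matI)
    fix k k' assume "k < dim_row (1\<^sub>m ?n :: 'a mat)" "k' < dim_col (1\<^sub>m ?n :: 'a mat)"
    hence k: "k < ?n" "k' < ?n" by auto
    let ?i = "k mod g" and ?s = "k div g" and ?j = "k' mod g" and ?t = "k' div g"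
    have eq: "k = k' \<longleftrightarrow> ?i = ?j \<and> ?s = ?t" by (metis div_mult_mod_eq)
    have "(P * Q) $$ (k, k') = (\<Sum>\<tau> = 0..<N. \<Sum>j = 0..<g. (if ?i = j then \<zeta> ^ (?s * \<tau>) else 0) *
        (if j = ?j then inverse \<zeta> ^ (\<tau> * ?t) / of_nat N else 0))"
      using k by (intro prod car) (auto simp: P_def Q_def)
    also have "\<dots> = (\<Sum>\<tau> = 0..<N. \<Sum>j = 0..<g. if j = ?i then
        of_bool (?i = ?j) * (\<zeta> ^ (?s * \<tau>) * inverse \<zeta> ^ (\<tau> * ?t)) / of_nat N else 0)"
      by (intro sum.cong refl) auto
    also have "\<dots> = of_bool (?i = ?j) *
        (\<Sum>\<tau> = 0..<N. \<zeta> ^ (?s * \<tau>) * inverse \<zeta> ^ (\<tau> * ?t)) / of_nat N"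
      using g by (simp add: sum_distrib_left sum_divide_distrib)
    also have "\<dots> = 1\<^sub>m ?n $$ (k, k')"
      using k bnd N eq by (simp add: primitive_root_orthogonality[OF z])
    finally show "(P * Q) $$ (k, k') = 1\<^sub>m ?n $$ (k, k')" .
  qed (use car in auto)
  have QP: "Q * P = 1\<^sub>m ?n" by (rule mat_mult_left_right_inverse[OF car(3,4) PQ])
  have "A = A * (P * Q)" using car PQ by simp
  also have "\<dots> = P * B * Q" using car AP by (simp flip: assoc_mult_mat)
  finally have "similar_mat A B" using car PQ QP by (intro similar_matI[of A B P Q]) auto
  thus ?thesis
    using char_poly_similar[of A B] char_poly_block_diag[OF g M, of N] by (simp add: A_def B_def)
qed

section \<open>Evaluation of generalized polynomials\<close>

lemma power_eq_of_mod_eq: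
  fixes \<xi> :: "'a::monoid_mult"
  assumes "\<xi> ^ N = 1" "a mod N = b mod N"
  shows "\<xi> ^ a = \<xi> ^ b"
proof -
  have "\<xi> ^ c = \<xi> ^ (c mod N)" for c
  proof -
    have "\<xi> ^ c = \<xi> ^ (N * (c div N) + c mod N)" by simp
    also have "\<dots> = \<xi> ^ (c mod N)" by (simp only: power_add power_mult assms(1)) simp
    finally show ?thesis .
  qed
  thus ?thesis using assms(2) by metis
qed

text \<open>Exponents of \<open>\<xi>\<close> matter only modulo \<open>CARD('l) ^ m\<close>, and
  reduction modulo this number is additive.\<close>

lemma padic_power_add:
  fixes a b :: "'l::prime_card padic_int" and \<xi> :: "'a::comm_ring_1"
  assumes "\<xi> ^ (CARD('l) ^ m) = 1"
  shows "padic_power \<xi> (a + b) = padic_power \<xi> a * padic_power \<xi> b"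
proof -
  let ?N = "CARD('l) ^ m"
  have "nat (padic_red m (a + b)) = (nat (padic_red m a) + nat (padic_red m b)) mod ?N"
    using padic_red_range(1)[of m a] padic_red_range(1)[of m b]
    by (simp add: padic_red_add nat_mod_distrib nat_power_eq nat_add_distrib)
  thus ?thesis
    unfolding padic_power_eq[OF assms] power_add[symmetric]
    by (intro power_eq_of_mod_eq[OF assms]) simp
qed

lemma gp_eval_eq_sum:
  assumes "finite A" "Poly_Mapping.keys P \<subseteq> A"
  shows "gp_eval P \<xi> = (\<Sum>a\<in>A. of_int (Poly_Mapping.lookup P a) * padic_power \<xi> a)"
  unfolding gp_eval_def using assms by (intro sum.mono_neutral_left) (auto simp: in_keys_iff)

lemma gp_eval_add: "gp_eval (P + Q) \<xi> = gp_eval P \<xi> + gp_eval Q \<xi>"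
proof -
  let ?A = "Poly_Mapping.keys P \<union> Poly_Mapping.keys Q"
  have "gp_eval (P + Q) \<xi> = (\<Sum>a\<in>?A. of_int (Poly_Mapping.lookup (P + Q) a) * padic_power \<xi> a)"
    by (intro gp_eval_eq_sum) (auto dest: subsetD[OF Poly_Mapping.keys_add])
  also have "\<dots> = gp_eval P \<xi> + gp_eval Q \<xi>"
    by (subst (1 2) gp_eval_eq_sum[of ?A]) (auto simp: lookup_add algebra_simps sum.distrib)
  finally show ?thesis .
qed

lemma gp_eval_zero: "gp_eval 0 \<xi> = 0"
  by (simp add: gp_eval_def)

lemma gp_eval_sum: "gp_eval (\<Sum>i\<in>I. P i) \<xi> = (\<Sum>i\<in>I. gp_eval (P i) \<xi>)"
  by (induction I rule: infinite_finite_induct) (auto simp: gp_eval_add gp_eval_zero)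

lemma gp_eval_single: "gp_eval (Poly_Mapping.single a c) \<xi> = of_int c * padic_power \<xi> a"
  by (subst gp_eval_eq_sum[of "{a}"]) (auto simp: lookup_single)

lemma gen_poly_eq_sum_single:
  "P = (\<Sum>a\<in>Poly_Mapping.keys P. Poly_Mapping.single a (Poly_Mapping.lookup P a))"
proof (rule poly_mapping_eqI)
  fix k
  show "Poly_Mapping.lookup P k =
    Poly_Mapping.lookup (\<Sum>a\<in>Poly_Mapping.keys P. Poly_Mapping.single a (Poly_Mapping.lookup P a)) k"
    by (simp add: lookup_sum lookup_single when_def in_keys_iff)
qed

lemma gp_eval_mult:
  fixes P Q :: "('l::prime_card, int) gen_poly" and \<xi> :: "'a::comm_ring_1"
  assumes "\<xi> ^ (CARD('l) ^ m) = 1"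
  shows "gp_eval (P * Q) \<xi> = gp_eval P \<xi> * gp_eval Q \<xi>"
proof -
  let ?p = "Poly_Mapping.lookup P" and ?q = "Poly_Mapping.lookup Q"
  let ?K = "Poly_Mapping.keys P" and ?L = "Poly_Mapping.keys Q"
  have "P * Q = (\<Sum>a\<in>?K. \<Sum>b\<in>?L. Poly_Mapping.single (a + b) (?p a * ?q b))"
    by (subst (1) gen_poly_eq_sum_single[of P], subst (1) gen_poly_eq_sum_single[of Q])
       (simp add: sum_product Poly_Mapping.mult_single)
  hence "gp_eval (P * Q) \<xi> = (\<Sum>a\<in>?K. \<Sum>b\<in>?L. gp_eval (Poly_Mapping.single (a + b) (?p a * ?q b)) \<xi>)"
    by (simp add: gp_eval_sum)
  also have "\<dots> = (\<Sum>a\<in>?K. \<Sum>b\<in>?L. (of_int (?p a) * padic_power \<xi> a) * (of_int (?q b) * padic_power \<xi> b))"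
    by (simp add: gp_eval_single padic_power_add[OF assms] algebra_simps)
  also have "\<dots> = gp_eval P \<xi> * gp_eval Q \<xi>"
    by (simp add: gp_eval_def sum_product)
  finally show ?thesis .
qed

lemma gp_eval_T_pow: "gp_eval (gp_T_pow a) \<xi> = padic_power \<xi> a"
  by (simp add: gp_T_pow_def gp_eval_single)

text \<open>Being a ring homomorphism, evaluation commutes with determinants, so a determinant of
  generalized polynomials can be evaluated entrywise.\<close>

lemma comm_ring_hom_gp_eval:
  fixes \<xi> :: "'a::comm_ring_1"
  assumes "\<xi> ^ (CARD('l) ^ m) = 1"
  shows "comm_ring_hom (\<lambda>P :: ('l::prime_card, int) gen_poly. gp_eval P \<xi>)"
proof
  have "gp_eval (1 :: ('l, int) gen_poly) \<xi> = padic_power \<xi> (0 :: 'l padic_int)"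
    using gp_eval_single[of 0 1 \<xi>] by (simp add: single_one)
  also have "\<dots> = 1" by (simp add: padic_power_eq[OF assms] padic_red_0)
  finally show "gp_eval (1 :: ('l, int) gen_poly) \<xi> = 1" .
qed (simp_all add: gp_eval_add gp_eval_zero gp_eval_mult[OF assms])

section \<open>The Laplacians of the tower\<close>

text \<open>A dart leaving \<open>v\<close> lies in \<open>S\<close> or is the opposite of a dart of
  \<open>S\<close> ending at \<open>v\<close>. A loop of \<open>S\<close> at \<open>v\<close>
  appears in both counts and so contributes 2.\<close>

lemma valency_orientation:
  assumes G: "finite_multigraph G" and S: "is_orientation G S"
  shows "valency G v = card {s \<in> S. fst (inc G s) = v} + card {s \<in> S. snd (inc G s) = v}"
proof -
  let ?P = "{s \<in> S. fst (inc G s) = v}" and ?M = "{s \<in> S. snd (inc G s) = v}"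
  have D: "opp G e \<in> darts G" "opp G e \<noteq> e" "opp G (opp G e) = e"
    "inc G (opp G e) = prod.swap (inc G e)" if "e \<in> darts G" for e
    using G that unfolding finite_multigraph_def is_multigraph_def by blast+
  have SD: "S \<subseteq> darts G" using S by (simp add: is_orientation_def)
  have ex: "\<exists>!s. s \<in> S \<and> (s = e \<or> s = opp G e)" if "e \<in> darts G" for e
    using S that by (auto simp: is_orientation_def uedges_def uedge_def)
  have not: "opp G s \<notin> S" if "s \<in> S" for s
    using ex[of s] D(2)[of s] SD that by blast
  have "{e \<in> darts G. fst (inc G e) = v} = ?P \<union> opp G ` ?M"
  proof (intro equalityI subsetI)
    fix e assume e: "e \<in> {e \<in> darts G. fst (inc G e) = v}"
    show "e \<in> ?P \<union> opp G ` ?M"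
    proof (cases "e \<in> S")
      case False
      hence "opp G e \<in> S" using ex[of e] e by blast
      moreover have "e = opp G (opp G e)" using D(3)[of e] e by simp
      moreover have "snd (inc G (opp G e)) = v" using D(4)[of e] e by simp
      ultimately show ?thesis by blast
    qed (use e in auto)
  next
    fix e assume "e \<in> ?P \<union> opp G ` ?M"
    thus "e \<in> {e \<in> darts G. fst (inc G e) = v}" using SD D(1,4) by auto
  qed
  moreover have "?P \<inter> opp G ` ?M = {}" using not by blast
  moreover have "finite S" using SD G finite_subset by (auto simp: finite_multigraph_def)
  moreover have "inj_on (opp G) ?M"
  proof (rule inj_onI)
    fix x y assume "x \<in> ?M" "y \<in> ?M" and eq: "opp G x = opp G y"
    hence "opp G (opp G x) = x" "opp G (opp G y) = y" using SD D(3) by blast+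
    thus "x = y" using eq by metis
  qed
  ultimately show ?thesis
    unfolding valency_def by (simp add: card_Un_disjoint card_image)
qed

text \<open>Ordered sheet by sheet: the residue is the block number and the base vertex the position
  in the block, so the Laplacian upstairs becomes a block matrix with blocks of the size of the base
  graph.\<close>

definition tower_verts :: "'v list \<Rightarrow> nat \<Rightarrow> ('v \<times> int) list" where
  "tower_verts vs N = map (\<lambda>k. (vs ! (k mod length vs), int (k div length vs))) [0..<length vs * N]"

lemma tower_verts_enum:
  assumes "distinct vs" "set vs = verts G" "vs \<noteq> []" "N = CARD('l) ^ n"
  shows "distinct (tower_verts vs N)"
    "set (tower_verts vs N) = verts (tower_layer G S (\<alpha> :: 'e \<Rightarrow> 'l::prime_card padic_int) n)"
proof -
  let ?g = "length vs"
  have g: "?g > 0" using assms by simp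
  show "distinct (tower_verts vs N)"
    unfolding tower_verts_def distinct_map
  proof (intro conjI inj_onI)
    fix k k' assume "(vs ! (k mod ?g), int (k div ?g)) = (vs ! (k' mod ?g), int (k' div ?g))"
    hence "k mod ?g = k' mod ?g" "k div ?g = k' div ?g"
      using assms(1) g by (auto simp: nth_eq_iff_index_eq)
    thus "k = k'" by (metis div_mult_mod_eq)
  qed simp
  have "(vs ! i, int \<tau>) \<in> set (tower_verts vs N)" if "i < ?g" "\<tau> < N" for i \<tau>
  proof -
    have "i + ?g * \<tau> < ?g * Suc \<tau>" using that by simp
    also have "\<dots> \<le> ?g * N" using that by (intro mult_le_mono2) simp
    finally have "i + ?g * \<tau> \<in> {0..<?g * N}" by simp
    moreover have "(i + ?g * \<tau>) mod ?g = i" "(i + ?g * \<tau>) div ?g = \<tau>"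
      using that g by (simp_all add: div_mult_self2)
    ultimately show ?thesis unfolding tower_verts_def by (force simp: image_iff)
  qed
  hence "(v, \<sigma>) \<in> set (tower_verts vs N)" if "v \<in> set vs" "0 \<le> \<sigma>" "\<sigma> < int N" for v \<sigma>
    using that by (metis in_set_conv_nth nonneg_int_cases of_nat_less_iff)
  moreover have "set (tower_verts vs N) \<subseteq> set vs \<times> {0..<int N}"
    using g by (auto simp: tower_verts_def less_mult_imp_div_less mult.commute)
  ultimately show "set (tower_verts vs N) = verts (tower_layer G S \<alpha> n)"
    using assms by (auto simp: tower_layer_def derived_multigraph_def)
qed

text \<open>A lift of \<open>s\<close> is labelled by the residue at the origin of \<open>s\<close>.
  Traversed backwards from \<open>(v, \<sigma>)\<close>, it therefore carries the label of its far
  end, \<open>\<sigma>\<close> minus the voltage.\<close>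

lemma tower_out_darts:
  fixes \<alpha> :: "'e \<Rightarrow> 'l::prime_card padic_int"
  assumes N: "N = int CARD('l) ^ n" and \<sigma>: "0 \<le> \<sigma>" "\<sigma> < N"
  shows "{e \<in> darts (tower_layer G S \<alpha> n). fst (inc (tower_layer G S \<alpha> n) e) = (v, \<sigma>)}
    = (\<lambda>s. (s, \<sigma>, True)) ` {s \<in> S. fst (inc G s) = v} \<union>
      (\<lambda>s. (s, (\<sigma> - padic_red n (\<alpha> s)) mod N, False)) ` {s \<in> S. snd (inc G s) = v}"
    (is "?L = ?P \<union> ?M")
proof -
  have N0: "N > 0" unfolding N by simp
  have shift: "(x + b) mod N = \<sigma> \<longleftrightarrow> x = (\<sigma> - b) mod N" if "0 \<le> x" "x < N" for x b
  proof
    assume "(x + b) mod N = \<sigma>"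
    hence "(\<sigma> - b) mod N = (x + b - b) mod N" by (metis mod_diff_left_eq)
    thus "x = (\<sigma> - b) mod N" using that by simp
  next
    assume "x = (\<sigma> - b) mod N"
    hence "(x + b) mod N = (\<sigma> - b + b) mod N" by (metis mod_add_left_eq)
    thus "(x + b) mod N = \<sigma>" using \<sigma> by simp
  qed
  show ?thesis
  proof (intro equalityI subsetI)
    fix e assume e: "e \<in> ?L"
    obtain s x b where [simp]: "e = (s, x, b)" by (cases e)
    show "e \<in> ?P \<union> ?M"
      using e shift[of x "padic_red n (\<alpha> s)"]
      by (cases b) (auto simp: tower_layer_def derived_multigraph_def Let_def simp flip: N)
  next
    fix e assume "e \<in> ?P \<union> ?M"
    thus "e \<in> ?L"
    proof
      assume "e \<in> ?P"
      thus ?thesis using \<sigma>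
        by (auto simp: tower_layer_def derived_multigraph_def Let_def simp flip: N)
    next
      assume "e \<in> ?M"
      then obtain s where [simp]: "e = (s, (\<sigma> - padic_red n (\<alpha> s)) mod N, False)"
        and s: "s \<in> S" "snd (inc G s) = v" by auto
      have "0 \<le> (\<sigma> - padic_red n (\<alpha> s)) mod N" "(\<sigma> - padic_red n (\<alpha> s)) mod N < N"
        using N0 by simp_all
      thus ?thesis using s shift[of "(\<sigma> - padic_red n (\<alpha> s)) mod N" "padic_red n (\<alpha> s)"]
        by (auto simp: tower_layer_def derived_multigraph_def Let_def simp flip: N)
    qed
  qed
qed

text \<open>This is a row of the Laplacian applied to the character sending \<open>\<tau>\<close> to
  \<open>\<zeta> ^ (\<tau> * t)\<close>. A dart over \<open>s\<close> shifts the residue by plus or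
  minus the voltage, which multiplies the character by the matching power of
  \<open>\<zeta> ^ t\<close>; these powers are the evaluated terms of the voltage matrix.\<close>

lemma tower_laplacian_fourier:
  fixes \<alpha> :: "'e \<Rightarrow> 'l::prime_card padic_int" and \<zeta> :: "'a::comm_ring_1" and n :: nat
  assumes G: "finite_multigraph G" and S: "is_orientation G S"
    and vs: "distinct vs" "set vs = verts G"
    and N: "N = CARD('l) ^ n" and z: "\<zeta> ^ N = 1" and ij: "i < length vs" "j < length vs"
    and \<sigma>: "\<sigma> < N"
  defines "H \<equiv> tower_layer G S \<alpha> n"
  shows "(\<Sum>\<tau> = 0..<N. (\<Sum>e\<in>{e \<in> darts H. fst (inc H e) = (vs ! i, int \<sigma>)}.
        of_bool (i = j \<and> \<sigma> = \<tau>) - of_bool (snd (inc H e) = (vs ! j, int \<tau>))) * \<zeta> ^ (\<tau> * t))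
    = \<zeta> ^ (\<sigma> * t) * map_mat (\<lambda>P. gp_eval P (\<zeta> ^ t)) (voltage_matrix G vs S \<alpha>) $$ (i, j)"
proof -
  let ?\<xi> = "\<zeta> ^ t"
  let ?P = "{s \<in> S. fst (inc G s) = vs ! i}" and ?M = "{s \<in> S. snd (inc G s) = vs ! i}"
  let ?O = "{e \<in> darts H. fst (inc H e) = (vs ! i, int \<sigma>)}"
  let ?\<beta> = "\<lambda>s. padic_red n (\<alpha> s)"
  have N0: "int N > 0" and NN: "int N = int CARD('l) ^ n" using N by simp_all
  have finS: "finite S"
    using S G finite_subset by (auto simp: is_orientation_def finite_multigraph_def)
  have \<xi>N: "?\<xi> ^ (CARD('l) ^ n) = 1"
    using z unfolding N[symmetric] by (metis mult.commute power_mult power_one)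
  \<comment> \<open>Contribution of a single dart after summation over \<open>\<tau>\<close>: only
    the residue \<open>\<sigma>\<close> and the residue of the terminus survive.\<close>
  define F where "F e = of_bool (i = j) * \<zeta> ^ (\<sigma> * t)
    - of_bool (fst (snd (inc H e)) = vs ! j) * \<zeta> ^ (nat (snd (snd (inc H e))) * t)" for e
  have inc: "inc H (s, x, True) = ((fst (inc G s), x), (snd (inc G s), (x + ?\<beta> s) mod int N))"
    "inc H (s, x, False) = ((snd (inc G s), (x + ?\<beta> s) mod int N), (fst (inc G s), x))" for s x
    by (simp_all add: H_def tower_layer_def derived_multigraph_def NN)
  have tgt: "0 \<le> snd (snd (inc H e)) \<and> snd (snd (inc H e)) < int N" if e: "e \<in> darts H" for e
  proof -
    obtain s x b where [simp]: "e = (s, x, b)" by (cases e)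
    have "0 \<le> x" "x < int N"
      using e by (auto simp: H_def tower_layer_def derived_multigraph_def NN)
    thus ?thesis using N0 by (cases b) (auto simp: inc)
  qed
  have "(\<Sum>\<tau> = 0..<N. (\<Sum>e\<in>?O. of_bool (i = j \<and> \<sigma> = \<tau>) - of_bool (snd (inc H e) = (vs ! j, int \<tau>))) * \<zeta> ^ (\<tau> * t))
      = (\<Sum>e\<in>?O. \<Sum>\<tau> = 0..<N. (of_bool (i = j \<and> \<sigma> = \<tau>) - of_bool (snd (inc H e) = (vs ! j, int \<tau>))) * \<zeta> ^ (\<tau> * t))"
    unfolding sum_distrib_right by (rule sum.swap)
  also have "\<dots> = (\<Sum>e\<in>?O. F e)"
  proof (intro sum.cong refl)
    fix e assume "e \<in> ?O"
    hence r: "0 \<le> snd (snd (inc H e))" "snd (snd (inc H e)) < int N" using tgt by auto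
    define \<rho> where "\<rho> = nat (snd (snd (inc H e)))"
    have \<rho>: "\<rho> < N" and eq: "snd (inc H e) = (vs ! j, int \<tau>) \<longleftrightarrow> fst (snd (inc H e)) = vs ! j \<and> \<tau> = \<rho>" for \<tau>
      using r by (auto simp: \<rho>_def prod_eq_iff)
    have "(\<Sum>\<tau> = 0..<N. (of_bool (i = j \<and> \<sigma> = \<tau>) - of_bool (snd (inc H e) = (vs ! j, int \<tau>))) * \<zeta> ^ (\<tau> * t))
      = (\<Sum>\<tau> = 0..<N. (if \<tau> = \<sigma> then of_bool (i = j) * \<zeta> ^ (\<sigma> * t) else 0)
          - (if \<tau> = \<rho> then of_bool (fst (snd (inc H e)) = vs ! j) * \<zeta> ^ (\<rho> * t) else 0))"
      unfolding eq by (intro sum.cong refl) auto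
    also have "\<dots> = F e" using \<sigma> \<rho> by (simp add: sum_subtractf F_def \<rho>_def)
    finally show "(\<Sum>\<tau> = 0..<N. (of_bool (i = j \<and> \<sigma> = \<tau>) - of_bool (snd (inc H e) = (vs ! j, int \<tau>))) * \<zeta> ^ (\<tau> * t)) = F e" .
  qed
  also have "\<dots> = (\<Sum>s\<in>?P. F (s, int \<sigma>, True)) + (\<Sum>s\<in>?M. F (s, (int \<sigma> - ?\<beta> s) mod int N, False))"
  proof -
    have "?O = (\<lambda>s. (s, int \<sigma>, True)) ` ?P \<union> (\<lambda>s. (s, (int \<sigma> - ?\<beta> s) mod int N, False)) ` ?M"
      unfolding H_def using \<sigma> by (intro tower_out_darts NN) auto
    moreover have "(\<lambda>s. (s, int \<sigma>, True)) ` ?P \<inter> (\<lambda>s. (s, (int \<sigma> - ?\<beta> s) mod int N, False)) ` ?M = {}"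
      by auto
    ultimately show ?thesis
      using finS by (simp add: sum.union_disjoint sum.reindex inj_on_def)
  qed
  also have "(\<Sum>s\<in>?P. F (s, int \<sigma>, True))
      = (\<Sum>s\<in>?P. of_bool (i = j) * \<zeta> ^ (\<sigma> * t)
          - \<zeta> ^ (\<sigma> * t) * (if snd (inc G s) = vs ! j then padic_power ?\<xi> (\<alpha> s) else 0))"
  proof (intro sum.cong refl)
    fix s
    have "nat ((int \<sigma> + ?\<beta> s) mod int N) = (\<sigma> + nat (?\<beta> s)) mod N"
      using padic_red_range(1)[of n "\<alpha> s"] by (simp add: nat_mod_distrib nat_add_distrib)
    hence "\<zeta> ^ nat ((int \<sigma> + ?\<beta> s) mod int N) = \<zeta> ^ (\<sigma> + nat (?\<beta> s))"
      by (intro power_eq_of_mod_eq[OF z]) simp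
    hence "\<zeta> ^ (nat ((int \<sigma> + ?\<beta> s) mod int N) * t) = \<zeta> ^ (\<sigma> * t) * padic_power ?\<xi> (\<alpha> s)"
      unfolding padic_power_eq[OF \<xi>N] power_mult
      by (simp add: power_add power_mult_distrib mult.commute flip: power_mult)
    thus "F (s, int \<sigma>, True) = of_bool (i = j) * \<zeta> ^ (\<sigma> * t)
        - \<zeta> ^ (\<sigma> * t) * (if snd (inc G s) = vs ! j then padic_power ?\<xi> (\<alpha> s) else 0)"
      by (simp add: F_def inc)
  qed
  also have "\<dots> = \<zeta> ^ (\<sigma> * t) * (of_bool (i = j) * of_nat (card ?P)
      - (\<Sum>s\<in>{s \<in> S. inc G s = (vs ! i, vs ! j)}. padic_power ?\<xi> (\<alpha> s)))"
  proof -
    have "(\<Sum>s\<in>?P. if snd (inc G s) = vs ! j then padic_power ?\<xi> (\<alpha> s) else 0)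
        = (\<Sum>s\<in>{s \<in> S. inc G s = (vs ! i, vs ! j)}. padic_power ?\<xi> (\<alpha> s))"
      using finS by (intro sum.mono_neutral_cong_right) (auto simp: prod_eq_iff)
    thus ?thesis by (simp add: sum_subtractf algebra_simps flip: sum_distrib_left)
  qed
  also have "(\<Sum>s\<in>?M. F (s, (int \<sigma> - ?\<beta> s) mod int N, False))
      = (\<Sum>s\<in>?M. of_bool (i = j) * \<zeta> ^ (\<sigma> * t)
          - \<zeta> ^ (\<sigma> * t) * (if fst (inc G s) = vs ! j then padic_power ?\<xi> (- \<alpha> s) else 0))"
  proof (intro sum.cong refl)
    fix s
    have "int (nat ((int \<sigma> - ?\<beta> s) mod int N)) = int ((\<sigma> + nat (padic_red n (- \<alpha> s))) mod N)"
      using padic_red_range(1)[of n "- \<alpha> s"] N0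
      by (simp add: zmod_int padic_red_uminus mod_simps flip: NN)
    hence "nat ((int \<sigma> - ?\<beta> s) mod int N) = (\<sigma> + nat (padic_red n (- \<alpha> s))) mod N"
      by (simp only: of_nat_eq_iff)
    hence "\<zeta> ^ nat ((int \<sigma> - ?\<beta> s) mod int N) = \<zeta> ^ (\<sigma> + nat (padic_red n (- \<alpha> s)))"
      by (intro power_eq_of_mod_eq[OF z]) simp
    hence "\<zeta> ^ (nat ((int \<sigma> - ?\<beta> s) mod int N) * t) = \<zeta> ^ (\<sigma> * t) * padic_power ?\<xi> (- \<alpha> s)"
      unfolding padic_power_eq[OF \<xi>N] power_mult
      by (simp add: power_add power_mult_distrib mult.commute flip: power_mult)
    thus "F (s, (int \<sigma> - ?\<beta> s) mod int N, False) = of_bool (i = j) * \<zeta> ^ (\<sigma> * t)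
        - \<zeta> ^ (\<sigma> * t) * (if fst (inc G s) = vs ! j then padic_power ?\<xi> (- \<alpha> s) else 0)"
      by (simp add: F_def inc)
  qed
  also have "\<dots> = \<zeta> ^ (\<sigma> * t) * (of_bool (i = j) * of_nat (card ?M)
      - (\<Sum>s\<in>{s \<in> S. inc G s = (vs ! j, vs ! i)}. padic_power ?\<xi> (- \<alpha> s)))"
  proof -
    have "(\<Sum>s\<in>?M. if fst (inc G s) = vs ! j then padic_power ?\<xi> (- \<alpha> s) else 0)
        = (\<Sum>s\<in>{s \<in> S. inc G s = (vs ! j, vs ! i)}. padic_power ?\<xi> (- \<alpha> s))"
      using finS by (intro sum.mono_neutral_cong_right) (auto simp: prod_eq_iff)
    thus ?thesis by (simp add: sum_subtractf algebra_simps flip: sum_distrib_left)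
  qed
  also have "\<zeta> ^ (\<sigma> * t) * (of_bool (i = j) * of_nat (card ?P)
        - (\<Sum>s\<in>{s \<in> S. inc G s = (vs ! i, vs ! j)}. padic_power ?\<xi> (\<alpha> s)))
      + \<zeta> ^ (\<sigma> * t) * (of_bool (i = j) * of_nat (card ?M)
        - (\<Sum>s\<in>{s \<in> S. inc G s = (vs ! j, vs ! i)}. padic_power ?\<xi> (- \<alpha> s)))
      = \<zeta> ^ (\<sigma> * t) * (of_bool (i = j) * of_nat (valency G (vs ! i))
        - ((\<Sum>s\<in>{s \<in> S. inc G s = (vs ! i, vs ! j)}. padic_power ?\<xi> (\<alpha> s))
        + (\<Sum>s\<in>{s \<in> S. inc G s = (vs ! j, vs ! i)}. padic_power ?\<xi> (- \<alpha> s))))"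
    by (simp add: valency_orientation[OF G S] algebra_simps)
  also have "of_bool (i = j) * of_nat (valency G (vs ! i))
        - ((\<Sum>s\<in>{s \<in> S. inc G s = (vs ! i, vs ! j)}. padic_power ?\<xi> (\<alpha> s))
        + (\<Sum>s\<in>{s \<in> S. inc G s = (vs ! j, vs ! i)}. padic_power ?\<xi> (- \<alpha> s)))
      = map_mat (\<lambda>P. gp_eval P (\<zeta> ^ t)) (voltage_matrix G vs S \<alpha>) $$ (i, j)"
  proof -
    interpret ev: comm_ring_hom "\<lambda>P :: ('l, int) gen_poly. gp_eval P (\<zeta> ^ t)"
      by (rule comm_ring_hom_gp_eval[OF \<xi>N])
    show ?thesis using ij
      by (simp add: voltage_matrix_def ev.hom_minus ev.hom_add ev.hom_of_nat gp_eval_sum gp_eval_T_pow)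
  qed
  finally show ?thesis .
qed

text \<open>The all-ones vector lies in the kernel, because every dart adds 1 and subtracts 1 in the
  row of its origin.\<close>

lemma det_laplacian:
  assumes G: "finite_multigraph G" and vs: "distinct vs" "set vs = verts G" "vs \<noteq> []"
  shows "det (laplacian G vs :: 'a::idom mat) = 0"
proof -
  let ?L = "laplacian G vs :: 'a mat" and ?n = "length vs"
  define w :: "'a vec" where "w = vec ?n (\<lambda>_. 1)"
  have "w $ 0 \<noteq> 0\<^sub>v ?n $ 0" using vs by (simp add: w_def)
  hence "w \<noteq> 0\<^sub>v ?n" by auto
  moreover have "?L *\<^sub>v w = 0\<^sub>v ?n"
  proof (rule eq_vecI)
    fix i assume "i < dim_vec (0\<^sub>v ?n :: 'a vec)"
    hence i: "i < ?n" by simp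
    let ?O = "{e \<in> darts G. fst (inc G e) = vs ! i}"
    have "(?L *\<^sub>v w) $ i = (\<Sum>j = 0..<?n. \<Sum>e\<in>?O. of_bool (i = j) - of_bool (snd (inc G e) = vs ! j))"
      using i by (simp add: laplacian_def scalar_prod_def w_def)
    also have "\<dots> = (\<Sum>e\<in>?O. \<Sum>j = 0..<?n. of_bool (i = j) - of_bool (snd (inc G e) = vs ! j))"
      by (rule sum.swap)
    also have "\<dots> = 0"
    proof (rule sum.neutral, rule ballI)
      fix e assume "e \<in> ?O"
      hence "snd (inc G e) \<in> set vs"
        using G vs by (auto simp: finite_multigraph_def is_multigraph_def mem_Times_iff)
      then obtain j' where j': "j' < ?n" "snd (inc G e) = vs ! j'" by (metis in_set_conv_nth)
      have "(\<Sum>j = 0..<?n. of_bool (i = j) - of_bool (snd (inc G e) = vs ! j))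
          = (\<Sum>j = 0..<?n. of_bool (i = j) - of_bool (j' = j) :: 'a)"
        using vs j' by (intro sum.cong) (auto simp: nth_eq_iff_index_eq)
      also have "\<dots> = 0" using i j' by (simp add: sum_subtractf of_bool_def)
      finally show "(\<Sum>j = 0..<?n. of_bool (i = j) - of_bool (snd (inc G e) = vs ! j)) = (0 :: 'a)" .
    qed
    finally show "(?L *\<^sub>v w) $ i = 0\<^sub>v ?n $ i" using i by simp
  qed (simp add: laplacian_def)
  moreover have "w \<in> carrier_vec ?n" by (simp add: w_def)
  ultimately show ?thesis using det_0_iff_vec_prod_zero[OF laplacian_carrier] by blast
qed

lemma char_poly_tower_laplacian:
  fixes \<alpha> :: "'e \<Rightarrow> 'l::prime_card padic_int" and \<zeta> :: "'a::field"
  assumes G: "finite_multigraph G" and S: "is_orientation G S"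
    and vs: "distinct vs" "set vs = verts G" "vs \<noteq> []"
    and N: "N = CARD('l) ^ n" "of_nat N \<noteq> (0 :: 'a)" and z: "primitive_root_of_unity N \<zeta>"
  shows "char_poly (laplacian (tower_layer G S \<alpha> n) (tower_verts vs N))
    = (\<Prod>t<N. char_poly (map_mat (\<lambda>P. gp_eval P (\<zeta> ^ t)) (voltage_matrix G vs S \<alpha>)))"
proof -
  let ?g = "length vs" and ?H = "tower_layer G S \<alpha> n"
  have g: "?g > 0" using vs by simp
  define a where "a i \<sigma> j \<tau> = (\<Sum>e\<in>{e \<in> darts ?H. fst (inc ?H e) = (vs ! i, int \<sigma>)}.
    of_bool (i = j \<and> \<sigma> = \<tau>) - of_bool (snd (inc ?H e) = (vs ! j, int \<tau>)) :: 'a)" for i \<sigma> j \<tau>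
  have eq: "k = k' \<longleftrightarrow> k mod ?g = k' mod ?g \<and> k div ?g = k' div ?g" for k k'
    by (metis div_mult_mod_eq)
  have "laplacian ?H (tower_verts vs N)
      = mat (?g * N) (?g * N) (\<lambda>(k, k'). a (k mod ?g) (k div ?g) (k' mod ?g) (k' div ?g))"
    unfolding laplacian_def tower_verts_def
    by (intro eq_matI) (auto simp: a_def eq simp flip: eq)
  moreover have "char_poly (mat (?g * N) (?g * N)
        (\<lambda>(k, k'). a (k mod ?g) (k div ?g) (k' mod ?g) (k' div ?g)))
      = (\<Prod>t<N. char_poly (map_mat (\<lambda>P. gp_eval P (\<zeta> ^ t)) (voltage_matrix G vs S \<alpha>)))"
  proof (rule char_poly_block_fourier[OF g N(2) z])
    have zN: "\<zeta> ^ N = 1" using z by (simp add: primitive_root_of_unity_def)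
    show "(\<Sum>\<tau> = 0..<N. a i \<sigma> j \<tau> * \<zeta> ^ (\<tau> * t))
        = \<zeta> ^ (\<sigma> * t) * map_mat (\<lambda>P. gp_eval P (\<zeta> ^ t)) (voltage_matrix G vs S \<alpha>) $$ (i, j)"
      if "i < ?g" "j < ?g" "\<sigma> < N" "t < N" for i j \<sigma> t
      unfolding a_def using that by (intro tower_laplacian_fourier[OF G S vs(1,2) N(1) zN])
  qed (simp add: voltage_matrix_def)
  ultimately show ?thesis by simp
qed

text \<open>
  Compare the linear coefficients of the characteristic polynomials: the factor at the trivial
  root of unity vanishes at 0, all other factors contribute their determinants.
\<close>

theorem tower_spanning_trees:
  fixes \<alpha> :: "'e \<Rightarrow> 'l::prime_card padic_int" and \<zeta> :: "'a::field"
  assumes G: "finite_multigraph G" and S: "is_orientation G S"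
    and vs: "distinct vs" "set vs = verts G" "vs \<noteq> []"
    and N: "N = CARD('l) ^ n" "of_nat N \<noteq> (0 :: 'a)" and z: "primitive_root_of_unity N \<zeta>"
  shows "(- 1) ^ (length vs * N - 1) *
      of_nat (length vs * N * card (spanning_trees (tower_layer G S \<alpha> n)))
    = poly (pderiv (char_poly (map_mat (\<lambda>P. gp_eval P (1 :: 'a)) (voltage_matrix G vs S \<alpha>)))) 0 *
      (\<Prod>t\<in>{1..<N}. (- 1) ^ length vs * gp_eval (det (voltage_matrix G vs S \<alpha>)) (\<zeta> ^ t))"
proof -
  let ?g = "length vs"
  define E where "E t = map_mat (\<lambda>P. gp_eval P (\<zeta> ^ t)) (voltage_matrix G vs S \<alpha>)" for t
  have E: "E t \<in> carrier_mat ?g ?g" for t by (simp add: E_def voltage_matrix_def)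
  have SD: "S \<subseteq> darts G" using S by (simp add: is_orientation_def)
  have fin: "finite_multigraph (tower_layer G S \<alpha> m)" for m
    unfolding tower_layer_def by (intro finite_multigraph_derived G SD) simp
  have zN: "\<zeta> ^ N = 1" using z by (simp add: primitive_root_of_unity_def)
  have N0: "N > 0" using N by simp
  have len: "length (tower_verts vs M) = ?g * M" for M by (simp add: tower_verts_def)
  \<comment> \<open>The matrix at the trivial character has the characteristic polynomial of the
    Laplacian of layer 0, the derived graph of the trivial group, so its determinant
    vanishes.\<close>
  have E0: "poly (char_poly (E 0)) 0 = 0"
  proof -
    have "char_poly (laplacian (tower_layer G S \<alpha> 0) (tower_verts vs 1)) = char_poly (E 0)"
    proof -
      have "primitive_root_of_unity 1 (1 :: 'a)" by (auto simp: primitive_root_of_unity_def)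
      from char_poly_tower_laplacian[OF G S vs _ _ this, of 0 \<alpha>] show ?thesis
        by (simp add: E_def)
    qed
    moreover have "tower_verts vs 1 \<noteq> []" using vs(3) by (simp add: tower_verts_def)
    hence "det (laplacian (tower_layer G S \<alpha> 0) (tower_verts vs 1) :: 'a mat) = 0"
      using tower_verts_enum(1)[OF vs, where 'l = 'l and N = 1 and n = 0]
        tower_verts_enum(2)[OF vs, where 'l = 'l and N = 1 and n = 0]
      by (intro det_laplacian fin) simp_all
    ultimately show ?thesis using poly_char_poly_0[OF laplacian_carrier] by (metis mult_zero_right)
  qed
  have Et: "poly (char_poly (E t)) 0 = (- 1) ^ ?g * gp_eval (det (voltage_matrix G vs S \<alpha>)) (\<zeta> ^ t)" for t
  proof -
    have "(\<zeta> ^ t) ^ (CARD('l) ^ n) = 1"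
      using zN unfolding N(1)[symmetric] by (metis mult.commute power_mult power_one)
    hence "comm_ring_hom (\<lambda>P :: ('l, int) gen_poly. gp_eval P (\<zeta> ^ t))"
      by (rule comm_ring_hom_gp_eval)
    thus ?thesis using poly_char_poly_0[OF E[of t]] comm_ring_hom.hom_det
      unfolding E_def by metis
  qed
  have split: "{..<N} = insert 0 {1..<N}" using N0 by auto
  have "(- 1) ^ (?g * N - 1) * of_nat (?g * N * card (spanning_trees (tower_layer G S \<alpha> n)))
      = poly (pderiv (char_poly (laplacian (tower_layer G S \<alpha> n) (tower_verts vs N)))) (0 :: 'a)"
    using pderiv_char_poly_laplacian[OF fin tower_verts_enum[OF vs N(1)], where 'a = 'a]
    by (simp add: len)
  also have "\<dots> = poly (pderiv (\<Prod>t<N. char_poly (E t))) 0"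
    unfolding E_def by (subst char_poly_tower_laplacian[OF G S vs N z]) simp
  also have "\<dots> = poly (pderiv (char_poly (E 0))) 0 * (\<Prod>t\<in>{1..<N}. poly (char_poly (E t)) 0)"
    unfolding split by (simp add: pderiv_mult E0 poly_prod)
  finally show ?thesis unfolding Et by (simp add: E_def)
qed

section \<open>Powers of an integer modulo prime powers\<close>

lemma one_plus_power_expand: "\<exists>r :: int. (1 + y) ^ n = 1 + int n * y + y\<^sup>2 * r"
proof (induction n)
  case 0
  show ?case by (intro exI[of _ 0]) simp
next
  case (Suc n)
  then obtain r where "(1 + y) ^ n = 1 + int n * y + y\<^sup>2 * r" by blast
  hence "(1 + y) ^ Suc n = 1 + int (Suc n) * y + y\<^sup>2 * (int n + r + y * r)"
    by (simp add: algebra_simps power2_eq_square)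
  thus ?case by blast
qed

text \<open>Each \<open>l\<close>-th power raises the exact exponent of \<open>l\<close> in the
  difference to 1 by one. Since \<open>e \<ge> 2\<close>, the quadratic remainder is divisible by
  one more power of \<open>l\<close> than the linear term, uniformly in \<open>l\<close>, including
  \<open>l = 2\<close>.\<close>

lemma power_prime_power_expand:
  fixes u :: int
  assumes l: "prime l" and e: "e \<ge> 2" and q: "q = 1 + int l ^ e * u" "\<not> int l dvd u"
  shows "\<exists>u'. q ^ (l ^ j) = 1 + int l ^ (e + j) * u' \<and> \<not> int l dvd u'"
proof (induction j)
  case 0
  show ?case using q by auto
next
  case (Suc j)
  then obtain u' where u': "q ^ (l ^ j) = 1 + int l ^ (e + j) * u'" "\<not> int l dvd u'" by blast
  let ?y = "int l ^ (e + j) * u'"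
  obtain r where r: "(1 + ?y) ^ l = 1 + int l * ?y + ?y\<^sup>2 * r"
    using one_plus_power_expand by blast
  obtain d where d: "e + j = d + 2" using e by (metis le_add_diff_inverse2 trans_le_add1)
  let ?u = "u' + int l * (int l ^ d * u'\<^sup>2 * r)"
  have "q ^ (l ^ Suc j) = (q ^ (l ^ j)) ^ l" by (simp add: mult.commute flip: power_mult)
  also have "\<dots> = (1 + ?y) ^ l" unfolding u'(1) ..
  also have "\<dots> = 1 + int l ^ (e + Suc j) * ?u"
    unfolding r by (simp add: d power2_eq_square power_add algebra_simps)
  finally have "q ^ (l ^ Suc j) = 1 + int l ^ (e + Suc j) * ?u" .
  moreover have "\<not> int l dvd ?u" using u'(2) by (simp add: dvd_add_left_iff)
  ultimately show ?case by blast
qed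

text \<open>The subgroup of the units modulo \<open>l^i\<close> generated by \<open>p\<close> has index bounded in \<open>i\<close>.\<close>

lemma powers_cover_principal_units:
  assumes l: "prime l" and p: "p > 1" "coprime p l"
  shows "\<exists>c. \<forall>i\<ge>c. \<forall>t. \<exists>k. int l ^ i dvd int p ^ k - (1 + int l ^ c * t)"
proof -
  \<comment> \<open>By Euler's theorem this power of \<open>p\<close> is 1 modulo the square of
    \<open>l\<close>, so the exact exponent \<open>c\<close> defined below is at least 2.\<close>
  define q where "q = int (p ^ totient (l ^ 2))"
  have l2: "l \<ge> 2" using l prime_ge_2_nat by blast
  have "[p ^ totient (l ^ 2) = 1] (mod l ^ 2)"
    by (rule euler_theorem) (use p in simp)
  hence "[q = 1] (mod int l ^ 2)"
    unfolding q_def by (metis cong_int_iff of_nat_1 of_nat_power)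
  hence dv: "int l ^ 2 dvd q - 1" by (simp add: cong_iff_dvd_diff)
  have "totient (l ^ 2) > 0" using l2 by simp
  hence "q > 1" unfolding q_def using p(1) by (simp add: one_less_power)
  hence q1: "q - 1 \<noteq> 0" by simp
  define c where "c = multiplicity (int l) (q - 1)"
  have c: "c \<ge> 2"
    unfolding c_def using dv l2 q1 by (intro multiplicity_geI) (auto)
  obtain u where u: "q - 1 = int l ^ c * u" "\<not> int l dvd u"
    unfolding c_def using multiplicity_decompose'[OF q1, of "int l"] l2 by auto
  have q: "q = 1 + int l ^ c * u" using u(1) by simp
  have "\<exists>k. int l ^ i dvd q ^ k - (1 + int l ^ c * t)" if "i \<ge> c" for i t
    using that
  proof (induction i rule: dec_induct)
    case base
    show ?case by (intro exI[of _ 0]) simp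
  next
    case (step i)
    then obtain k s where s: "q ^ k - (1 + int l ^ c * t) = int l ^ i * s" by (auto simp: dvd_def)
    obtain u' where u': "q ^ (l ^ (i - c)) = 1 + int l ^ i * u'" "\<not> int l dvd u'"
      using power_prime_power_expand[OF l c q u(2), of "i - c"] step by auto
    have "coprime u' (int l)"
      using u'(2) l by (metis coprime_commute prime_imp_coprime prime_nat_int_transfer)
    \<comment> \<open>With this \<open>x\<close>, multiplying \<open>q ^ k\<close> by the
      \<open>x\<close>-th power of \<open>q ^ (l ^ (i - c))\<close> cancels the error
      \<open>l ^ i * s\<close> modulo the next power of \<open>l\<close>.\<close>
    then obtain x where x: "[u' * x = - s] (mod int l)" by (metis cong_solve_coprime_int cong_scalar_right mult.assoc mult_1 cong_def)
    define j where "j = nat (x mod int l)"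
    have j: "int j = x mod int l" using l2 by (simp add: j_def)
    have "[u' * int j = - s] (mod int l)"
      unfolding j using x by (simp add: cong_def mod_simps)
    hence "int l dvd u' * int j + s" by (simp add: cong_iff_dvd_diff)
    then obtain w where w: "u' * int j + s = int l * w" by (auto simp: dvd_def)
    obtain r where r: "(1 + int l ^ i * u') ^ j = 1 + int j * (int l ^ i * u') + (int l ^ i * u')\<^sup>2 * r"
      using one_plus_power_expand by blast
    obtain d where d: "i = Suc d" using step c by (cases i) auto
    \<comment> \<open>Since \<open>q ^ k\<close> is 1 modulo \<open>l\<close>, the correction enters
      the product with coefficient 1 up to a multiple of \<open>l ^ Suc i\<close>.\<close>
    have "int l dvd q - 1" using dv by (metis dvd_mult_left power2_eq_square)
    moreover have "q - 1 dvd q ^ k - 1" by (metis power_diff_1_eq dvd_triv_left)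
    ultimately obtain z where z: "q ^ k = 1 + int l * z"
      by (metis dvd_trans dvd_def diff_add_cancel add.commute)
    have "q ^ (k + l ^ (i - c) * j) = q ^ k * (1 + int l ^ i * u') ^ j"
      by (simp add: power_add power_mult u'(1))
    also have "\<dots> = q ^ k + (1 + int l * z) * int j * (int l ^ i * u') + q ^ k * ((int l ^ i * u')\<^sup>2 * r)"
      unfolding r by (simp add: z algebra_simps)
    also have "\<dots> = 1 + int l ^ c * t + int l ^ i * (u' * int j + s)
        + int l ^ Suc i * (z * int j * u' + q ^ k * (int l ^ d * u'\<^sup>2 * r))"
      using s by (simp add: d algebra_simps power2_eq_square)
    also have "\<dots> = 1 + int l ^ c * t
        + int l ^ Suc i * (w + z * int j * u' + q ^ k * (int l ^ d * u'\<^sup>2 * r))"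
      unfolding w by (simp add: algebra_simps)
    finally have "int l ^ Suc i dvd q ^ (k + l ^ (i - c) * j) - (1 + int l ^ c * t)" by simp
    thus ?case by blast
  qed
  moreover have "q ^ k = int p ^ (totient (l ^ 2) * k)" for k
    by (simp add: q_def power_mult)
  ultimately show ?thesis by metis
qed

section \<open>Valuations\<close>

locale valued_field =
  fixes v :: "'a::field \<Rightarrow> ereal"
  assumes val: "valuation v"
begin

lemma v_eq_PInf: "v x = \<infinity> \<longleftrightarrow> x = 0" and v_neq_MInf: "v x \<noteq> - \<infinity>"
  and v_mult: "v (x * y) = v x + v y" and v_add: "min (v x) (v y) \<le> v (x + y)"
  using val by (auto simp: valuation_def)

lemma v_0: "v 0 = \<infinity>" by (simp add: v_eq_PInf)

lemma v_finite: "x \<noteq> 0 \<Longrightarrow> \<exists>r. v x = ereal r"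
  using v_eq_PInf[of x] v_neq_MInf[of x] by (cases "v x") auto

lemma v_1: "v 1 = 0"
proof -
  obtain r where "v 1 = ereal r" using v_finite[of 1] by auto
  thus ?thesis using v_mult[of 1 1] by (simp add: zero_ereal_def)
qed

lemma v_power: "v (x ^ n) = ereal (real n) * v x"
proof (cases "x = 0")
  case True
  thus ?thesis by (cases n) (auto simp: v_1 v_0)
next
  case False
  then obtain r where r: "v x = ereal r" using v_finite by blast
  show ?thesis
    by (induction n) (auto simp: v_1 v_mult r algebra_simps zero_ereal_def)
qed

lemma v_root_of_unity: "x ^ N = 1 \<Longrightarrow> N > 0 \<Longrightarrow> v x = 0"
  using v_power[of x N] v_1 by (cases "v x") (auto simp: zero_ereal_def)

lemma v_minus: "v (- x) = v x"
proof -
  have "v (- 1) = 0" by (rule v_root_of_unity[of _ 2]) auto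
  thus ?thesis using v_mult[of "- 1" x] by simp
qed

lemma nonneg_add: "0 \<le> v x \<Longrightarrow> 0 \<le> v y \<Longrightarrow> 0 \<le> v (x + y)"
  using v_add[of x y] by (auto simp: min_def split: if_splits intro: order_trans)

lemma pos_add: "0 < v x \<Longrightarrow> 0 < v y \<Longrightarrow> 0 < v (x + y)"
  using v_add[of x y] by (auto simp: min_def split: if_splits intro: less_le_trans)

lemma pos_diff: "0 < v x \<Longrightarrow> 0 < v y \<Longrightarrow> 0 < v (x - y)"
  using pos_add[of x "- y"] by (simp add: v_minus)

lemma nonneg_mult: "0 \<le> v x \<Longrightarrow> 0 \<le> v y \<Longrightarrow> 0 \<le> v (x * y)"
  by (simp add: v_mult)

lemma pos_mult: "0 < v x \<Longrightarrow> 0 \<le> v y \<Longrightarrow> 0 < v (x * y)"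
  by (simp add: v_mult add_pos_nonneg)

lemma nonneg_sum: "(\<And>a. a \<in> A \<Longrightarrow> 0 \<le> v (y a)) \<Longrightarrow> 0 \<le> v (\<Sum>a\<in>A. y a)"
  by (induction A rule: infinite_finite_induct) (auto simp: v_0 nonneg_add)

lemma pos_sum: "(\<And>a. a \<in> A \<Longrightarrow> 0 < v (y a)) \<Longrightarrow> 0 < v (\<Sum>a\<in>A. y a)"
  by (induction A rule: infinite_finite_induct) (auto simp: v_0 pos_add)

lemma nonneg_power: "0 \<le> v x \<Longrightarrow> 0 \<le> v (x ^ n)"
  by (simp add: v_power)

lemma nonneg_of_nat: "0 \<le> v (of_nat n)"
  by (induction n) (auto simp: v_0 v_1 nonneg_add)

lemma nonneg_of_int: "0 \<le> v (of_int n)"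
  by (cases n) (auto simp: v_minus nonneg_of_nat simp del: of_nat_Suc)

lemma v_prod: "v (\<Prod>a\<in>A. y a) = (\<Sum>a\<in>A. v (y a))"
  by (induction A rule: infinite_finite_induct) (auto simp: v_1 v_mult)

end

section \<open>Valuations normalised at p and the Frobenius congruence\<close>

locale padic_valued_field = valued_field v for v :: "'a::field \<Rightarrow> ereal" +
  fixes p :: nat
  assumes p: "prime p" and v_p: "v (of_nat p) = 1"
begin

text \<open>By Bezout, an integer prime to \<open>p\<close> with positive valuation would force 1 to
  have positive valuation.\<close>

lemma pos_of_int_iff: "0 < v (of_int k) \<longleftrightarrow> int p dvd k"
proof
  assume "int p dvd k"
  then obtain m where "k = int p * m" by (auto simp: dvd_def)
  thus "0 < v (of_int k)" using pos_mult[of "of_nat p" "of_int m"] v_p nonneg_of_int by simp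
next
  assume k: "0 < v (of_int k)"
  show "int p dvd k"
  proof (rule ccontr)
    assume "\<not> int p dvd k"
    hence "coprime (int p) k" using p by (simp add: prime_imp_coprime)
    then obtain a b where "a * int p + b * k = 1" by (metis bezout_int coprime_imp_gcd_eq_1)
    hence "(1 :: 'a) = of_nat p * of_int a + of_int k * of_int b"
      by (metis mult.commute of_int_1 of_int_add of_int_mult of_int_of_nat_eq)
    moreover have "0 < v (of_nat p * of_int a + of_int k * of_int b)"
      using k v_p by (intro pos_add pos_mult nonneg_of_int) auto
    ultimately show False by (simp add: v_1)
  qed
qed

lemma v_of_nat:
  assumes "k \<noteq> 0" shows "v (of_nat k) = ereal (real (multiplicity p k))"
proof -
  obtain m where m: "k = p ^ multiplicity p k * m" "\<not> p dvd m"
    using multiplicity_decompose'[OF assms, of p] p not_prime_unit by metis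
  have "\<not> 0 < v (of_nat m)" using pos_of_int_iff[of "int m"] m(2) by simp
  hence "v (of_nat m) = 0" using nonneg_of_nat[of m] by (metis less_le)
  moreover have "v (of_nat k) = v (of_nat p ^ multiplicity p k * of_nat m)"
    by (subst m(1)) simp
  ultimately show ?thesis by (simp add: v_mult v_power v_p)
qed

text \<open>The middle binomial coefficients are divisible by \<open>p\<close>, and the powers they
  multiply are integral.\<close>

lemma frobenius_add:
  assumes "0 \<le> v x" "0 \<le> v y"
  shows "0 < v ((x + y) ^ p - (x ^ p + y ^ p))"
proof -
  have "p > 0" using p prime_gt_0_nat by blast
  hence split: "{..p} = insert 0 (insert p {1..<p})" by auto
  have "(x + y) ^ p = (\<Sum>k\<le>p. of_nat (p choose k) * x ^ k * y ^ (p - k))" by (rule binomial_ring)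
  also have "\<dots> = y ^ p + (x ^ p + (\<Sum>k\<in>{1..<p}. of_nat (p choose k) * x ^ k * y ^ (p - k)))"
    unfolding split using \<open>p > 0\<close> by (subst sum.insert; simp)+
  finally have eq: "(x + y) ^ p - (x ^ p + y ^ p) = (\<Sum>k\<in>{1..<p}. of_nat (p choose k) * x ^ k * y ^ (p - k))"
    by simp
  have "0 < v (of_nat (p choose k) * x ^ k * y ^ (p - k))" if "k \<in> {1..<p}" for k
  proof -
    have "p dvd p choose k" using that p by (intro dvd_choose_prime) auto
    hence "0 < v (of_nat (p choose k))" using pos_of_int_iff[of "int (p choose k)"] by simp
    thus ?thesis using assms by (intro pos_mult nonneg_power)
  qed
  thus ?thesis unfolding eq by (rule pos_sum)
qed

lemma frobenius_sum:
  assumes "\<And>a. a \<in> A \<Longrightarrow> 0 \<le> v (y a)"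
  shows "0 < v ((\<Sum>a\<in>A. y a) ^ p - (\<Sum>a\<in>A. y a ^ p))"
  using assms
proof (induction A rule: infinite_finite_induct)
  case (insert b A)
  let ?s = "\<Sum>a\<in>A. y a"
  have eq: "(y b + ?s) ^ p - (y b ^ p + (\<Sum>a\<in>A. y a ^ p))
      = ((y b + ?s) ^ p - (y b ^ p + ?s ^ p)) + (?s ^ p - (\<Sum>a\<in>A. y a ^ p))" by simp
  have "0 < v ((y b + ?s) ^ p - (y b ^ p + ?s ^ p))"
    using insert.prems by (intro frobenius_add nonneg_sum) auto
  moreover have "0 < v (?s ^ p - (\<Sum>a\<in>A. y a ^ p))" using insert by simp
  ultimately have "0 < v ((y b + ?s) ^ p - (y b ^ p + (\<Sum>a\<in>A. y a ^ p)))"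
    unfolding eq by (rule pos_add)
  thus ?case using insert.hyps by simp
qed (use p prime_gt_0_nat in \<open>auto simp: v_0 power_0_left\<close>)

lemma fermat_int: "int p dvd k ^ p - k"
proof -
  have "[k ^ p = k] (mod int p)"
  proof (cases "int p dvd k")
    case True
    thus ?thesis using p prime_gt_0_nat by (simp add: cong_iff_dvd_diff dvd_diff dvd_power_same
          prime_dvd_power_iff)
  next
    case False
    define m where "m = nat (k mod int p)"
    have p0: "p > 0" using p prime_gt_0_nat by blast
    have m: "int m = k mod int p" using p0 by (simp add: m_def)
    have "\<not> p dvd m" using False m by (metis dvd_mod_iff int_dvd_int_iff dvd_refl)
    hence "[m ^ (p - 1) = 1] (mod p)" using fermat_theorem p by blast
    hence "[m ^ (p - 1) * m = 1 * m] (mod p)" by (rule cong_scalar_right)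
    hence "[m ^ p = m] (mod p)" using power_minus_mult[OF p0, of m] by simp
    hence "[int m ^ p = int m] (mod int p)" by (metis cong_int_iff of_nat_power)
    thus ?thesis unfolding m by (simp add: cong_def power_mod)
  qed
  thus ?thesis by (simp add: cong_iff_dvd_diff)
qed

end

lemma padic_power_power:
  fixes a :: "'l::prime_card padic_int" and \<xi> :: "'a::comm_ring_1"
  assumes "\<xi> ^ (CARD('l) ^ m) = 1"
  shows "padic_power (\<xi> ^ u) a = padic_power \<xi> a ^ u"
proof -
  have "(\<xi> ^ u) ^ (CARD('l) ^ m) = 1" by (metis assms mult.commute power_mult power_one)
  thus ?thesis
    unfolding padic_power_eq[OF assms] padic_power_eq[OF \<open>(\<xi> ^ u) ^ (CARD('l) ^ m) = 1\<close>]
    by (simp add: mult.commute flip: power_mult)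
qed

context padic_valued_field
begin

lemma v_padic_power:
  fixes a :: "'l::prime_card padic_int"
  assumes "\<xi> ^ (CARD('l) ^ m) = 1"
  shows "v (padic_power \<xi> a) = 0"
proof (rule v_root_of_unity)
  show "padic_power \<xi> a ^ (CARD('l) ^ m) = 1"
    unfolding padic_power_eq[OF assms] by (metis assms mult.commute power_mult power_one)
qed simp

lemma gp_eval_nonneg:
  fixes P :: "('l::prime_card, int) gen_poly"
  assumes "\<xi> ^ (CARD('l) ^ m) = 1"
  shows "0 \<le> v (gp_eval P \<xi>)"
  unfolding gp_eval_def
  by (intro nonneg_sum nonneg_mult nonneg_of_int) (simp add: v_padic_power[OF assms])

text \<open>Up to elements of positive valuation, the \<open>p\<close>-th power is additive and
  fixes integer coefficients by Fermat's theorem, so the \<open>p\<close>-th power of the value at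
  \<open>\<xi>\<close> is congruent to the value at \<open>\<xi> ^ p\<close>.\<close>

lemma gp_eval_frobenius:
  fixes P :: "('l::prime_card, int) gen_poly"
  assumes \<xi>: "\<xi> ^ (CARD('l) ^ m) = 1" and pos: "0 < v (gp_eval P \<xi>)"
  shows "0 < v (gp_eval P (\<xi> ^ p))"
proof -
  let ?K = "Poly_Mapping.keys P" and ?c = "Poly_Mapping.lookup P"
  have eq: "gp_eval P \<xi> ^ p - (\<Sum>a\<in>?K. (of_int (?c a) * padic_power \<xi> a) ^ p)
      + (\<Sum>a\<in>?K. of_int (?c a ^ p - ?c a) * padic_power \<xi> a ^ p)
      = gp_eval P \<xi> ^ p - gp_eval P (\<xi> ^ p)"
    unfolding gp_eval_def padic_power_power[OF \<xi>]
    by (simp add: power_mult_distrib sum_subtractf algebra_simps)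
  have "0 < v (gp_eval P \<xi> ^ p - (\<Sum>a\<in>?K. (of_int (?c a) * padic_power \<xi> a) ^ p))"
    unfolding gp_eval_def
    by (intro frobenius_sum nonneg_mult nonneg_of_int) (simp add: v_padic_power[OF \<xi>])
  moreover have "0 < v (\<Sum>a\<in>?K. of_int (?c a ^ p - ?c a) * padic_power \<xi> a ^ p)"
  proof (intro pos_sum pos_mult nonneg_power)
    show "0 < v (of_int (?c a ^ p - ?c a))" for a using pos_of_int_iff fermat_int by blast
  qed (simp add: v_padic_power[OF \<xi>])
  ultimately have d: "0 < v (gp_eval P \<xi> ^ p - gp_eval P (\<xi> ^ p))"
    unfolding eq[symmetric] by (rule pos_add)
  obtain p' where "p = Suc p'" using p prime_gt_0_nat by (metis gr0_implies_Suc)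
  hence "0 < v (gp_eval P \<xi> ^ p)" using pos by (simp add: pos_mult nonneg_power)
  from pos_diff[OF this d] show ?thesis by simp
qed

lemma gp_eval_frobenius_power:
  fixes P :: "('l::prime_card, int) gen_poly"
  assumes \<xi>: "\<xi> ^ (CARD('l) ^ m) = 1" and pos: "0 < v (gp_eval P \<xi>)"
  shows "0 < v (gp_eval P (\<xi> ^ (p ^ k)))"
proof (induction k)
  case 0
  show ?case using pos by simp
next
  case (Suc k)
  have "(\<xi> ^ (p ^ k)) ^ (CARD('l) ^ m) = 1" by (metis \<xi> mult.commute power_mult power_one)
  from gp_eval_frobenius[OF this Suc.IH] show ?case
    by (simp add: mult.commute flip: power_mult)
qed

end

section \<open>Non-vanishing in the residue field at roots of unity of large order\<close>

lemma padic_red_separates: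
  fixes A :: "'l::prime_card padic_int set"
  assumes "finite A"
  shows "\<exists>r. \<forall>m\<ge>r. inj_on (padic_red m) A"
proof -
  have "\<exists>r. \<forall>m\<ge>r. padic_red m a = padic_red m b \<longrightarrow> a = b" for a b :: "'l padic_int"
  proof (cases "a = b")
    case False
    then obtain r where r: "padic_red r a \<noteq> padic_red r b" using padic_eqI by blast
    have "padic_red m a \<noteq> padic_red m b" if "m \<ge> r" for m
      using r padic_red_mod[OF that, of a] padic_red_mod[OF that, of b] by metis
    thus ?thesis by blast
  qed simp
  then obtain R where R: "\<And>a b m. m \<ge> R a b \<Longrightarrow> padic_red m a = padic_red m b \<Longrightarrow> a = (b :: 'l padic_int)"
    by metis
  \<comment> \<open>A common bound: the sum over all pairs dominates each single level
    \<open>R a b\<close>.\<close>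
  define r where "r = (\<Sum>a\<in>A. \<Sum>b\<in>A. R a b)"
  have "R a b \<le> r" if "a \<in> A" "b \<in> A" for a b
  proof -
    have "R a b \<le> (\<Sum>b\<in>A. R a b)" using assms that by (intro member_le_sum) auto
    also have "\<dots> \<le> r" unfolding r_def using assms that by (intro member_le_sum) auto
    finally show ?thesis .
  qed
  hence "\<forall>m\<ge>r. inj_on (padic_red m) A" using R by (meson inj_onI le_trans)
  thus ?thesis by blast
qed

context padic_valued_field
begin

text \<open>
  If \<open>P(\<xi>)\<close> vanishes in the residue field, then so do its Frobenius conjugates, hence
  \<open>P(\<xi>^u)\<close> for all \<open>u = 1 + l^c t\<close>. Averaging \<open>P(\<xi>^u) \<xi>^(-ub)\<close> over \<open>t\<close> isolates the
  coefficient of \<open>T^b\<close> as soon as the exponents of \<open>P\<close> are distinct modulo \<open>l^(i-c)\<close>.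
\<close>

theorem gp_eval_eventually_unit:
  fixes P :: "('l::prime_card, int) gen_poly"
  assumes lp: "CARD('l) \<noteq> p" and b: "\<not> int p dvd Poly_Mapping.lookup P b"
  shows "\<exists>n. \<forall>i\<ge>n. \<forall>\<xi>. primitive_root_of_unity (CARD('l) ^ i) \<xi> \<longrightarrow> \<not> 0 < v (gp_eval P \<xi>)"
proof -
  let ?l = "CARD('l)" and ?K = "Poly_Mapping.keys P" and ?c = "Poly_Mapping.lookup P"
  have l: "prime ?l" by (rule prime_card)
  have bK: "b \<in> ?K" using b by (auto simp: in_keys_iff)
  have cop: "coprime p ?l" using p l lp by (metis primes_coprime)
  obtain c where c: "\<And>i t. i \<ge> c \<Longrightarrow> \<exists>k. int ?l ^ i dvd int p ^ k - (1 + int ?l ^ c * t)"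
    using powers_cover_principal_units[OF l _ cop] p prime_gt_1_nat by metis
  obtain r where r: "\<And>m. m \<ge> r \<Longrightarrow> inj_on (padic_red m) ?K"
    using padic_red_separates[of ?K] by auto
  \<comment> \<open>From \<open>i \<ge> c\<close> the powers of \<open>p\<close> reach every
    \<open>1 + l ^ c * t\<close> modulo \<open>l ^ i\<close>; from \<open>i - c \<ge> r\<close> the
    exponents of \<open>P\<close> stay distinct modulo \<open>l ^ (i - c)\<close>.\<close>
  have "\<not> 0 < v (gp_eval P \<xi>)"
    if i: "i \<ge> c + r" and prim: "primitive_root_of_unity (?l ^ i) \<xi>" for i \<xi>
  proof
    assume pos: "0 < v (gp_eval P \<xi>)"
    have \<xi>: "\<xi> ^ (?l ^ i) = 1" using prim by (simp add: primitive_root_of_unity_def)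
    have ic: "i \<ge> c" "i - c \<ge> r" using i by auto
    let ?M = "?l ^ (i - c)"
    have lc: "?l ^ c * ?M = ?l ^ i" using ic by (simp flip: power_add)
    define U where "U t = 1 + ?l ^ c * t" for t
    have posU: "0 < v (gp_eval P (\<xi> ^ U t))" for t
    proof -
      obtain k where "int ?l ^ i dvd int p ^ k - (1 + int ?l ^ c * int t)" using c[OF ic(1)] by blast
      hence "int ?l ^ i dvd int (p ^ k) - int (U t)" by (simp add: U_def)
      hence "[p ^ k = U t] (mod ?l ^ i)"
        by (metis cong_iff_dvd_diff cong_int_iff of_nat_power)
      hence "\<xi> ^ (p ^ k) = \<xi> ^ U t" by (intro power_eq_of_mod_eq[OF \<xi>]) (simp add: cong_def)
      thus ?thesis using gp_eval_frobenius_power[OF \<xi> pos, of k] by simp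
    qed
    define \<omega> where "\<omega> a = padic_power \<xi> (a - b)" for a
    have summand: "gp_eval P (\<xi> ^ U t) * padic_power (\<xi> ^ U t) (- b) = (\<Sum>a\<in>?K. of_int (?c a) * \<omega> a ^ U t)" for t
    proof -
      have "padic_power \<xi> a * padic_power \<xi> (- b) = \<omega> a" for a
        unfolding \<omega>_def using padic_power_add[OF \<xi>, of a "- b"] by simp
      hence "padic_power \<xi> a ^ U t * padic_power \<xi> (- b) ^ U t = \<omega> a ^ U t" for a
        by (metis power_mult_distrib)
      thus ?thesis
        unfolding gp_eval_def padic_power_power[OF \<xi>] by (simp add: sum_distrib_right mult.assoc)
    qed
    \<comment> \<open>A geometric sum whose ratio, the \<open>l ^ c\<close>-th power of
      \<open>\<omega> a\<close>, is a root of unity of order dividing \<open>?M\<close> and equals 1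
      only if \<open>a\<close> and \<open>b\<close> agree modulo \<open>?M\<close>.\<close>
    have inner: "(\<Sum>t<?M. \<omega> a ^ U t) = (if a = b then of_nat ?M else 0)" if a: "a \<in> ?K" for a
    proof -
      define d where "d = nat (padic_red i (a - b))"
      have \<omega>: "\<omega> a = \<xi> ^ d" unfolding \<omega>_def d_def by (rule padic_power_eq[OF \<xi>])
      have expand: "(\<Sum>t<?M. \<omega> a ^ U t) = \<omega> a * (\<Sum>t<?M. (\<omega> a ^ (?l ^ c)) ^ t)"
        unfolding U_def sum_distrib_left by (simp add: power_mult)
      show ?thesis
      proof (cases "a = b")
        case True
        hence "\<omega> a = 1" unfolding \<omega> d_def by (simp add: padic_red_0)
        thus ?thesis using True by simp
      next
        case False
        have "(\<omega> a ^ (?l ^ c)) ^ ?M = 1"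
          unfolding \<omega> power_mult[symmetric] mult.assoc lc
          by (metis \<xi> mult.commute power_mult power_one)
        moreover have "\<omega> a ^ (?l ^ c) \<noteq> 1"
        proof
          assume "\<omega> a ^ (?l ^ c) = 1"
          hence one: "\<xi> ^ (d * ?l ^ c) = 1" by (simp add: \<omega> power_mult)
          have "\<xi> ^ ((d * ?l ^ c) mod ?l ^ i) = 1"
            using power_eq_of_mod_eq[OF \<xi>, of "(d * ?l ^ c) mod ?l ^ i" "d * ?l ^ c"] one by simp
          moreover have "(d * ?l ^ c) mod ?l ^ i < ?l ^ i" using l by simp
          ultimately have "(d * ?l ^ c) mod ?l ^ i = 0"
            using prim unfolding primitive_root_of_unity_def by (metis gr0I)
          hence "?l ^ c * ?M dvd ?l ^ c * d" unfolding lc by (simp add: mult.commute mod_eq_0_iff_dvd)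
          hence "?M dvd d" by simp
          hence "int ?l ^ (i - c) dvd padic_red i (a - b)"
            using padic_red_range(1)[of i "a - b"] unfolding d_def
            by (metis int_dvd_int_iff int_nat_eq of_nat_power)
          hence "padic_red (i - c) (a - b) = 0"
            using padic_red_mod[of "i - c" i "a - b"] by simp
          hence "(padic_red (i - c) a - padic_red (i - c) b) mod int ?l ^ (i - c) = 0"
            by (simp add: padic_red_diff)
          hence "padic_red (i - c) a mod int ?l ^ (i - c) = padic_red (i - c) b mod int ?l ^ (i - c)"
            by (simp add: mod_eq_dvd_iff mod_eq_0_iff_dvd del: padic_red_mod_self)
          hence "padic_red (i - c) a = padic_red (i - c) b" by simp
          thus False using r[OF ic(2)] a bK False by (auto dest: inj_onD)
        qed
        ultimately show ?thesis using False unfolding expand by (simp add: geometric_sum)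
      qed
    qed
    have "(\<Sum>t<?M. gp_eval P (\<xi> ^ U t) * padic_power (\<xi> ^ U t) (- b))
        = (\<Sum>a\<in>?K. of_int (?c a) * (\<Sum>t<?M. \<omega> a ^ U t))"
      unfolding summand sum_distrib_left by (rule sum.swap)
    also have "\<dots> = (\<Sum>a\<in>?K. if a = b then of_int (?c b) * of_nat ?M else 0)"
      by (intro sum.cong refl) (simp add: inner)
    also have "\<dots> = of_int (?c b * int ?M)" using bK by simp
    finally have sum: "(\<Sum>t<?M. gp_eval P (\<xi> ^ U t) * padic_power (\<xi> ^ U t) (- b))
      = of_int (?c b * int ?M)" .
    have "0 < v (\<Sum>t<?M. gp_eval P (\<xi> ^ U t) * padic_power (\<xi> ^ U t) (- b))"
    proof (intro pos_sum pos_mult posU)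
      fix t
      have "(\<xi> ^ U t) ^ (?l ^ i) = 1" by (metis \<xi> mult.commute power_mult power_one)
      thus "0 \<le> v (padic_power (\<xi> ^ U t) (- b))" by (simp add: v_padic_power)
    qed
    \<comment> \<open>The sum has positive valuation and equals this integer. As \<open>?M\<close>
      is a power of \<open>l\<close>, the factor \<open>p\<close> must divide the
      coefficient.\<close>
    hence "int p dvd ?c b * int ?M" unfolding sum using pos_of_int_iff by blast
    hence "int p dvd int ?M" using b p by (simp add: prime_dvd_mult_iff)
    hence "p dvd ?l" using p by (metis int_dvd_int_iff prime_dvd_power)
    thus False using p l lp by (metis primes_dvd_imp_eq)
  qed
  thus ?thesis by blast
qed

end

section \<open>The valuation on the algebraic closure\<close>

text \<open>The prime does not vanish modulo its square, which shows that it is nonzero and bounds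
  its order by 1.\<close>

lemma padic_of_nat_card: "padic_int_ord (of_nat (CARD('p)) :: 'p::prime_card padic_int) = 1"
  "(of_nat (CARD('p)) :: 'p padic_int) \<noteq> 0"
proof -
  let ?q = "of_nat (CARD('p)) :: 'p padic_int"
  have p: "CARD('p) > 1" using prime_card[where 'a = 'p] prime_gt_1_nat by blast
  hence "int CARD('p) < int CARD('p) ^ 2" by (simp add: power2_eq_square)
  hence red: "padic_red 2 ?q \<noteq> 0" using p by (simp add: padic_red_of_nat)
  thus nz: "?q \<noteq> 0" by (metis padic_red_0)
  have "1 \<le> padic_int_ord ?q" using padic_power_dvd_iff_le_ord[OF nz, of 1] by simp
  moreover have "\<not> 2 \<le> padic_int_ord ?q"
    using padic_power_dvd_iff_le_ord[OF nz, of 2] padic_power_dvd_iff[of 2 ?q] red by simp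
  ultimately show "padic_int_ord ?q = 1" by simp
qed

lemma padic_int_ord_1: "padic_int_ord (1 :: 'p::prime_card padic_int) = 0"
  using padic_int_ord_mult[of 1 "1 :: 'p padic_int"] by simp

lemma extends_padic_ord_card:
  fixes v :: "'p::prime_card padic_ac \<Rightarrow> ereal"
  assumes "extends_padic_ord v"
  shows "v (of_nat CARD('p)) = 1"
proof -
  have "v (of_nat CARD('p)) = padic_ord (of_nat CARD('p) :: 'p padic)"
    using assms unfolding extends_padic_ord_def by (metis to_ac_of_nat)
  also have "(of_nat CARD('p) :: 'p padic) = Fract (of_nat CARD('p)) 1" by (rule of_nat_fract)
  also have "padic_ord \<dots> = 1"
    using padic_of_nat_card[where 'p = 'p]
    by (subst padic_ord_Fract) (simp_all add: padic_int_ord_1 one_ereal_def)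
  finally show ?thesis .
qed

lemma padic_adjoin_closed:
  fixes \<xi> x y :: "'p::prime_card padic_ac"
  shows "of_int k \<in> padic_adjoin \<xi>" "\<xi> \<in> padic_adjoin \<xi>"
    "x \<in> padic_adjoin \<xi> \<Longrightarrow> y \<in> padic_adjoin \<xi> \<Longrightarrow> x + y \<in> padic_adjoin \<xi>"
    "x \<in> padic_adjoin \<xi> \<Longrightarrow> y \<in> padic_adjoin \<xi> \<Longrightarrow> x * y \<in> padic_adjoin \<xi>"
proof -
  let ?H = "range to_ac \<union> {\<xi>}"
  have "of_int k \<in> ?H" by (metis UnI1 rangeI to_ac_of_int)
  thus "of_int k \<in> padic_adjoin \<xi>" unfolding padic_adjoin_def by (rule generate_field.incl)
  show "\<xi> \<in> padic_adjoin \<xi>" unfolding padic_adjoin_def by (rule generate_field.incl) simp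
  show "x + y \<in> padic_adjoin \<xi>" if "x \<in> padic_adjoin \<xi>" "y \<in> padic_adjoin \<xi>"
    using generate_field.eng_add[OF that[unfolded padic_adjoin_def]]
    by (simp add: padic_adjoin_def ring_of_type_algebra_def)
  show "x * y \<in> padic_adjoin \<xi>" if "x \<in> padic_adjoin \<xi>" "y \<in> padic_adjoin \<xi>"
    using generate_field.eng_mult[OF that[unfolded padic_adjoin_def]]
    by (simp add: padic_adjoin_def ring_of_type_algebra_def)
qed

lemma padic_adjoin_power: "x \<in> padic_adjoin \<xi> \<Longrightarrow> x ^ n \<in> padic_adjoin \<xi>"
  using padic_adjoin_closed(1)[of 1 \<xi>] by (induction n) (auto intro: padic_adjoin_closed(4))

text \<open>\<open>padic_power\<close> takes natural exponents, so a value is built from integers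
  and powers of \<open>x\<close> by sums and products. Membership in the field is part of belonging
  to the maximal ideal.\<close>

lemma gp_eval_in_padic_adjoin:
  assumes "x \<in> padic_adjoin \<xi>" shows "gp_eval P x \<in> padic_adjoin \<xi>"
proof -
  have "(\<Sum>a\<in>A. of_int (c a) * padic_power x (e a)) \<in> padic_adjoin \<xi>" for A c e
    using padic_adjoin_closed(1)[of 0 \<xi>] assms
    by (induction A rule: infinite_finite_induct)
       (auto simp: padic_power_def intro!: padic_adjoin_closed(1,3,4) padic_adjoin_power)
  thus ?thesis unfolding gp_eval_def .
qed

section \<open>The \<open>\<mu>\<close>-invariant\<close>

lemma lookup_of_nat_mult:
  fixes P :: "('l::prime_card, int) gen_poly"
  shows "Poly_Mapping.lookup (of_nat k * P) a = int k * Poly_Mapping.lookup P a"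
  by (induction k) (simp_all add: distrib_right lookup_add)

text \<open>Exponents outside the support have infinite order, so the infimum is a minimum over the
  finite support, attained at \<open>b\<close>. The quotient coefficient at \<open>b\<close> is
  prime to \<open>p\<close>; it is the witness from which eventual non-vanishing is deduced.\<close>

lemma gp_mu_decompose:
  fixes P :: "('l::prime_card, int) gen_poly"
  assumes p: "prime p" and P: "P \<noteq> 0"
  obtains \<mu> g b where "gp_mu p P = enat \<mu>" "P = of_nat (p ^ \<mu>) * g" "gp_mu p g = 0"
    "\<not> int p dvd Poly_Mapping.lookup g b"
proof -
  let ?c = "Poly_Mapping.lookup P" and ?m = "\<lambda>a. multiplicity (int p) (Poly_Mapping.lookup P a)"
  have pp: "prime (int p)" using p by simp
  have "\<exists>a. a \<in> Poly_Mapping.keys P" using P by (metis all_not_in_conv keys_eq_empty)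
  then obtain b where b: "b \<in> Poly_Mapping.keys P" "\<And>a. a \<in> Poly_Mapping.keys P \<Longrightarrow> ?m b \<le> ?m a"
    using ex_has_least_nat[of "\<lambda>a. a \<in> Poly_Mapping.keys P" _ ?m] by blast
  have cb: "?c b \<noteq> 0" using b(1) by (simp add: in_keys_iff)
  define \<mu> where "\<mu> = ?m b"
  have mu: "gp_mu p P = enat \<mu>"
    unfolding gp_mu_def
  proof (rule antisym)
    show "(INF a. int_ord p (?c a)) \<le> enat \<mu>"
      by (rule INF_lower2[of b]) (simp_all add: int_ord_def cb \<mu>_def)
    show "enat \<mu> \<le> (INF a. int_ord p (?c a))"
      by (rule INF_greatest) (use b(2) in \<open>auto simp: int_ord_def \<mu>_def in_keys_iff\<close>)
  qed
  have dv: "int p ^ \<mu> dvd ?c a" for a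
  proof (cases "?c a = 0")
    case False
    thus ?thesis using b(2)[of a] by (intro multiplicity_dvd') (simp add: \<mu>_def in_keys_iff)
  qed simp
  define g where "g = Poly_Mapping.map (\<lambda>c. c div int p ^ \<mu>) P"
  have g: "Poly_Mapping.lookup g a = ?c a div int p ^ \<mu>" for a
    by (simp add: g_def Poly_Mapping.map.rep_eq when_def)
  have fac: "P = of_nat (p ^ \<mu>) * g"
    by (rule poly_mapping_eqI) (simp add: lookup_of_nat_mult g dv del: of_nat_power, simp add: dv)
  have nd: "\<not> int p dvd Poly_Mapping.lookup g b"
  proof -
    have "\<not> int p dvd ?c b div int p ^ multiplicity (int p) (?c b)"
      using cb pp by (intro multiplicity_decompose) auto
    thus ?thesis by (simp add: g \<mu>_def)
  qed
  have "(INF a. int_ord p (Poly_Mapping.lookup g a)) \<le> 0"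
  proof (rule INF_lower2[of b])
    show "int_ord p (Poly_Mapping.lookup g b) \<le> 0"
      using nd by (auto simp: int_ord_def not_dvd_imp_multiplicity_0 zero_enat_def)
  qed simp
  hence "gp_mu p g = 0" by (simp add: gp_mu_def)
  with mu fac nd show thesis using that by blast
qed

lemma primitive_root_coprime_power:
  fixes \<zeta> :: "'a::monoid_mult"
  assumes z: "primitive_root_of_unity N \<zeta>" and t: "coprime t N" and N: "N > 0"
  shows "primitive_root_of_unity N (\<zeta> ^ t)"
proof -
  have zN: "\<zeta> ^ N = 1" using z by (simp add: primitive_root_of_unity_def)
  have "(\<zeta> ^ t) ^ k \<noteq> 1" if "0 < k" "k < N" for k
  proof
    assume "(\<zeta> ^ t) ^ k = 1"
    hence "\<zeta> ^ ((t * k) mod N) = 1"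
      using power_eq_of_mod_eq[OF zN, of "(t * k) mod N" "t * k"] by (simp add: power_mult)
    hence "(t * k) mod N = 0"
      using z N unfolding primitive_root_of_unity_def by (metis gr0I mod_less_divisor)
    hence "N dvd t * k" by auto
    hence "N dvd k" using t by (metis coprime_commute coprime_dvd_mult_right_iff)
    thus False using that by (auto dest: dvd_imp_le)
  qed
  moreover have "(\<zeta> ^ t) ^ N = 1" by (metis zN mult.commute power_mult power_one)
  ultimately show ?thesis by (simp add: primitive_root_of_unity_def)
qed

section \<open>Growth of the p-adic order of the number of spanning trees along the tower\<close>

theorem theorem2p1:
  fixes l p :: nat
    and G :: "('v, 'e) multigraph"
    and vs :: "'v list"
    and S :: "'e set"
    and \<alpha> :: "'e \<Rightarrow> 'l::prime_card padic_int"
    and v_p :: "'p::prime_card padic_ac \<Rightarrow> ereal"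
    and \<zeta> :: "nat \<Rightarrow> 'p padic_ac"
    and K_inf m_inf :: "'p padic_ac set"
    and \<kappa> :: "nat \<Rightarrow> nat"
    and f :: "('l, int) gen_poly"
  assumes "l = CARD('l)" and "p = CARD('p)" and "l \<noteq> p"
    and "finite_multigraph G" and "connected_multigraph G"
    and "\<forall>v\<in>verts G. valency G v \<noteq> 1"
    and "euler_char G \<noteq> 0"
    and "distinct vs" and "set vs = verts G"
    and "is_orientation G S"
    and "\<forall>n\<ge>1. connected_multigraph (tower_layer G S \<alpha> n)"
    and "\<forall>n. \<kappa> n = card (spanning_trees (tower_layer G S \<alpha> n))"
    and "f = det (voltage_matrix G vs S \<alpha>)"
    and "valuation v_p" and "extends_padic_ord v_p"
    and "compatible_primitive_roots l \<zeta>"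
    and "K_inf = padic_cyclotomic_union \<zeta>"
    and "m_inf = maximal_ideal_on v_p K_inf"
  shows "\<exists>(\<mu>::nat) g.
    gp_mu p f = enat \<mu> \<and> f = of_nat (p ^ \<mu>) * g \<and> gp_mu p g = 0 \<and>
    (let nonvanishing_from = (\<lambda>n. \<forall>i\<ge>n. \<forall>\<xi>\<in>K_inf.
           primitive_root_of_unity (l ^ i) \<xi> \<longrightarrow> gp_eval g \<xi> \<notin> m_inf)
     in \<exists>n0. 0 < n0 \<and> nonvanishing_from n0 \<and> (\<forall>m. 0 < m \<and> nonvanishing_from m \<longrightarrow> n0 \<le> m) \<and>
       (\<exists>\<nu>::int. \<forall>n\<ge>n0. int (multiplicity p (\<kappa> n)) = int \<mu> * int l ^ n + \<nu>))"
proof -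
  note lC = assms(1) and pC = assms(2) and lp = assms(3) and G = assms(4) and conG = assms(5)
    and vs = assms(8,9) and S = assms(10) and con = assms(11) and \<kappa> = assms(12) and f = assms(13)
    and roots = assms(16) and K = assms(17) and m = assms(18)
  have lprime: "prime l" and pprime: "prime p" unfolding lC pC by (rule prime_card)+
  have l2: "l \<ge> 2" using lprime prime_ge_2_nat by blast
  interpret padic_valued_field v_p p
    using assms(14) pprime extends_padic_ord_card[OF assms(15)] by unfold_locales (simp_all add: pC)
  have vne: "vs \<noteq> []" using conG vs by (auto simp: connected_multigraph_def)
  let ?g = "length vs"
  have g0: "?g \<noteq> 0" using vne by simp
  have prim: "primitive_root_of_unity (l ^ n) (\<zeta> n)" and comp: "\<zeta> (Suc n) ^ l = \<zeta> n" for n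
    using roots by (auto simp: compatible_primitive_roots_def)
  \<comment> \<open>As \<open>l\<close> differs from \<open>p\<close>, the factor
    \<open>l ^ n\<close> is a unit: it can be inverted in the Fourier transform and drops out of the
    valuation.\<close>
  have v_lpow: "v_p (of_nat (l ^ n)) = 0" for n
  proof -
    have "\<not> p dvd l ^ n"
      using pprime lprime lp by (metis prime_dvd_power primes_dvd_imp_eq)
    thus ?thesis using l2 v_of_nat[of "l ^ n"] by (simp add: not_dvd_imp_multiplicity_0 zero_ereal_def)
  qed
  have lpow_nz: "(of_nat (l ^ n) :: 'p padic_ac) \<noteq> 0" for n
    using v_lpow[of n] v_0 by (metis PInfty_neq_ereal(1) zero_ereal_def)
  have SD: "S \<subseteq> darts G" using S by (simp add: is_orientation_def)
  have \<kappa>_pos: "\<kappa> n \<noteq> 0" if n: "n \<ge> 1" for n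
  proof -
    have c: "connected_multigraph (tower_layer G S \<alpha> n)" using con n by blast
    then obtain r where "r \<in> verts (tower_layer G S \<alpha> n)" by (auto simp: connected_multigraph_def)
    moreover have "finite_multigraph (tower_layer G S \<alpha> n)"
      unfolding tower_layer_def by (intro finite_multigraph_derived G SD) simp
    ultimately interpret rooted_multigraph "tower_layer G S \<alpha> n" r by unfold_locales
    show ?thesis using card_spanning_trees_pos[OF c] \<kappa> by simp
  qed
  have lN: "l ^ n = CARD('l) ^ n" for n using lC by simp
  \<comment> \<open>The factor of the trivial character does not depend on \<open>n\<close>, so its
    valuation goes into the constant \<open>\<nu>\<close>.\<close>
  define C where "C = poly (pderiv (char_poly
    (map_mat (\<lambda>P. gp_eval P (1 :: 'p padic_ac)) (voltage_matrix G vs S \<alpha>)))) 0"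
  have tree: "(- 1) ^ (?g * l ^ n - 1) * of_nat (?g * l ^ n * \<kappa> n)
      = C * (\<Prod>t\<in>{1..<l ^ n}. (- 1) ^ ?g * gp_eval f (\<zeta> n ^ t))" for n
    using tower_spanning_trees[OF G S vs vne lN[of n] lpow_nz[of n] prim[of n], of \<alpha>] \<kappa>
    unfolding C_def f by simp
  have sgn: "v_p ((- 1) ^ k) = 0" for k
    by (rule v_root_of_unity[of _ 2]) (simp_all flip: power_mult)
  define h where "h n = (\<Sum>t\<in>{1..<l ^ n}. v_p (gp_eval f (\<zeta> n ^ t)))" for n
  define A where "A = real (multiplicity p ?g)"
  \<comment> \<open>The left side is finite because \<open>\<kappa> n\<close> is nonzero, so neither
    \<open>v_p C\<close> nor \<open>h n\<close> can be infinite.\<close>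
  have vtree: "ereal (A + real (multiplicity p (\<kappa> n))) = v_p C + h n" if n: "n \<ge> 1" for n
  proof -
    have "v_p (C * (\<Prod>t\<in>{1..<l ^ n}. (- 1) ^ ?g * gp_eval f (\<zeta> n ^ t))) = v_p C + h n"
      by (simp add: v_mult v_prod sgn h_def)
    moreover have "v_p ((- 1) ^ (?g * l ^ n - 1) * of_nat (?g * l ^ n * \<kappa> n))
        = v_p (of_nat ?g) + v_p (of_nat (l ^ n)) + v_p (of_nat (\<kappa> n))"
      by (simp add: v_mult sgn del: of_nat_power)
    moreover have "\<dots> = ereal (A + real (multiplicity p (\<kappa> n)))"
      unfolding v_lpow v_of_nat[OF g0] v_of_nat[OF \<kappa>_pos[OF n]] by (simp add: A_def)
    ultimately show ?thesis unfolding tree by simp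
  qed
  \<comment> \<open>A vanishing \<open>f\<close> would make \<open>h 1\<close> infinite, as
    \<open>l \<ge> 2\<close> leaves at least one nontrivial root of unity, whereas
    \<open>\<kappa> 1\<close> is nonzero.\<close>
  have "f \<noteq> 0"
  proof
    assume "f = 0"
    hence "h 1 = (\<Sum>t\<in>{1..<l}. \<infinity>)" by (simp add: h_def gp_eval_zero v_0)
    also have "\<dots> = \<infinity>" using l2 by (auto simp: sum_Pinfty intro!: exI[of _ 1])
    finally have "v_p C + h 1 = \<infinity>" by simp
    hence "ereal (A + real (multiplicity p (\<kappa> 1))) = \<infinity>"
      unfolding vtree[OF order_refl] .
    thus False by simp
  qed
  then obtain \<mu> g b where mu: "gp_mu p f = enat \<mu>" and fg: "f = of_nat (p ^ \<mu>) * g"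
    and mug: "gp_mu p g = 0" and b: "\<not> int p dvd Poly_Mapping.lookup g b"
    using gp_mu_decompose[OF pprime] by metis
  define nonvanishing_from where "nonvanishing_from = (\<lambda>n. \<forall>i\<ge>n. \<forall>\<xi>\<in>K_inf.
    primitive_root_of_unity (l ^ i) \<xi> \<longrightarrow> gp_eval g \<xi> \<notin> m_inf)"
  obtain n1 where n1: "\<forall>i\<ge>n1. \<forall>\<xi>. primitive_root_of_unity (l ^ i) \<xi> \<longrightarrow> \<not> 0 < v_p (gp_eval g \<xi>)"
    using gp_eval_eventually_unit[OF _ b] lp unfolding lC by blast
  \<comment> \<open>The successor secures positivity, since \<open>n1\<close> may be 0.\<close>
  have "nonvanishing_from (Suc n1)"
    unfolding nonvanishing_from_def m maximal_ideal_on_def using n1 by (blast dest: Suc_leD)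
  hence ex: "\<exists>n. 0 < n \<and> nonvanishing_from n" by blast
  define n0 where "n0 = (LEAST n. 0 < n \<and> nonvanishing_from n)"
  have n0: "0 < n0" "nonvanishing_from n0" using LeastI_ex[OF ex] by (auto simp: n0_def)
  have least: "n0 \<le> k" if "0 < k" "nonvanishing_from k" for k
    unfolding n0_def using that by (intro Least_le) simp
  \<comment> \<open>For \<open>t\<close> prime to \<open>l\<close> the power is again a primitive
    root in \<open>K_inf\<close>. There \<open>g\<close> is integral and outside the maximal ideal,
    hence of valuation 0, and only the factor \<open>p ^ \<mu>\<close> counts.\<close>
  have unit: "v_p (gp_eval f (\<zeta> i ^ t)) = ereal (real \<mu>)" if i: "i \<ge> n0" and t: "\<not> l dvd t" for i t
  proof -
    let ?\<xi> = "\<zeta> i ^ t"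
    have "coprime t (l ^ i)" using t lprime
      by (metis coprime_commute coprime_power_right_iff prime_imp_coprime)
    hence pr: "primitive_root_of_unity (l ^ i) ?\<xi>"
      using primitive_root_coprime_power[OF prim] l2 by simp
    hence \<xi>: "?\<xi> ^ (CARD('l) ^ i) = 1" by (simp add: primitive_root_of_unity_def lC)
    have adj: "?\<xi> \<in> padic_adjoin (\<zeta> i)" by (intro padic_adjoin_power padic_adjoin_closed(2))
    hence "?\<xi> \<in> K_inf" "gp_eval g ?\<xi> \<in> K_inf"
      using gp_eval_in_padic_adjoin unfolding K padic_cyclotomic_union_def by blast+
    hence "\<not> 0 < v_p (gp_eval g ?\<xi>)"
      using n0(2) i pr unfolding nonvanishing_from_def m maximal_ideal_on_def by blast
    hence vg: "v_p (gp_eval g ?\<xi>) = 0" using gp_eval_nonneg[OF \<xi>, of g] by (metis less_le)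
    interpret ev: comm_ring_hom "\<lambda>P :: ('l, int) gen_poly. gp_eval P ?\<xi>"
      by (rule comm_ring_hom_gp_eval[OF \<xi>])
    have "gp_eval f ?\<xi> = of_nat (p ^ \<mu>) * gp_eval g ?\<xi>"
      unfolding fg by (simp only: ev.hom_mult ev.hom_of_nat)
    thus ?thesis by (simp add: v_mult vg v_power v_p)
  qed
  \<comment> \<open>The exponents divisible by \<open>l\<close> reproduce \<open>h n\<close>,
    because the \<open>l\<close>-th power of \<open>\<zeta> (Suc n)\<close> is
    \<open>\<zeta> n\<close>. All others, collected in \<open>R\<close>, give primitive roots and
    contribute \<open>\<mu>\<close> each.\<close>
  have h_Suc: "h (Suc n) = h n + ereal (real \<mu> * (real (l ^ Suc n) - real (l ^ n)))" if n: "n \<ge> n0" for n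
  proof -
    let ?D = "(*) l ` {1..<l ^ n}"
    define R where "R = {1..<l ^ Suc n} - ?D"
    have sub: "?D \<subseteq> {1..<l ^ Suc n}" using l2 by auto
    have inj: "inj_on ((*) l) {1..<l ^ n}" using l2 by (auto simp: inj_on_def)
    have nd: "\<not> l dvd t" if "t \<in> R" for t
    proof
      assume "l dvd t"
      then obtain k where "t = l * k" by (auto simp: dvd_def)
      thus False using that l2 by (auto simp: R_def)
    qed
    have cR: "real (card R) = real (l ^ Suc n) - real (l ^ n)"
    proof -
      have "card R = card {1..<l ^ Suc n} - card ?D"
        unfolding R_def using sub by (intro card_Diff_subset) auto
      also have "\<dots> = (l ^ Suc n - 1) - (l ^ n - 1)" using card_image[OF inj] by simp
      finally have "card R = (l ^ Suc n - 1) - (l ^ n - 1)" .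
      moreover have "l ^ n \<le> l ^ Suc n" "1 \<le> l ^ n" using l2 by auto
      ultimately show ?thesis by (simp add: of_nat_diff)
    qed
    have "h (Suc n) = (\<Sum>t\<in>R. v_p (gp_eval f (\<zeta> (Suc n) ^ t))) + (\<Sum>t\<in>?D. v_p (gp_eval f (\<zeta> (Suc n) ^ t)))"
      unfolding h_def R_def using sub by (intro sum.subset_diff) auto
    also have "(\<Sum>t\<in>R. v_p (gp_eval f (\<zeta> (Suc n) ^ t))) = (\<Sum>t\<in>R. ereal (real \<mu>))"
      using n nd by (intro sum.cong refl unit) auto
    also have "\<dots> = ereal (real \<mu> * (real (l ^ Suc n) - real (l ^ n)))"
      by (simp add: cR sum_ereal mult.commute flip: of_nat_power)
    also have "(\<Sum>t\<in>?D. v_p (gp_eval f (\<zeta> (Suc n) ^ t))) = h n"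
      unfolding h_def sum.reindex[OF inj] by (simp add: power_mult comp)
    finally show ?thesis by (simp add: add.commute)
  qed
  \<comment> \<open>\<open>v_p C + h n\<close> is replaced by its finite value from
    \<open>vtree\<close>, after which the constant \<open>A\<close> cancels.\<close>
  have inc: "real (multiplicity p (\<kappa> (Suc n)))
      = real (multiplicity p (\<kappa> n)) + real \<mu> * (real (l ^ Suc n) - real (l ^ n))" if n: "n \<ge> n0" for n
  proof -
    have "ereal (A + real (multiplicity p (\<kappa> (Suc n)))) = v_p C + h n
        + ereal (real \<mu> * (real (l ^ Suc n) - real (l ^ n)))"
      using vtree[of "Suc n"] h_Suc[OF n] by (simp add: add.assoc)
    also have "v_p C + h n = ereal (A + real (multiplicity p (\<kappa> n)))" using vtree[of n] n n0(1) by simp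
    finally show ?thesis by simp
  qed
  \<comment> \<open>Forced by the case \<open>n = n0\<close>; the increments do the rest.\<close>
  define \<nu> where "\<nu> = int (multiplicity p (\<kappa> n0)) - int \<mu> * int l ^ n0"
  have final: "int (multiplicity p (\<kappa> n)) = int \<mu> * int l ^ n + \<nu>" if "n \<ge> n0" for n
    using that
  proof (induction n rule: dec_induct)
    case base
    show ?case by (simp add: \<nu>_def)
  next
    case (step n)
    have "real_of_int (int (multiplicity p (\<kappa> (Suc n))))
        = real_of_int (int (multiplicity p (\<kappa> n)) + int \<mu> * (int l ^ Suc n - int l ^ n))"
      using inc[of n] step.hyps by simp
    hence "int (multiplicity p (\<kappa> (Suc n))) = int (multiplicity p (\<kappa> n)) + int \<mu> * (int l ^ Suc n - int l ^ n)"
      by (simp only: of_int_eq_iff)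
    thus ?case using step.IH by (simp add: algebra_simps)
  qed
  have "\<exists>n0. 0 < n0 \<and> nonvanishing_from n0 \<and> (\<forall>m. 0 < m \<and> nonvanishing_from m \<longrightarrow> n0 \<le> m) \<and>
      (\<exists>\<nu>::int. \<forall>n\<ge>n0. int (multiplicity p (\<kappa> n)) = int \<mu> * int l ^ n + \<nu>)"
    using n0 least final by (intro exI[of _ n0] conjI exI[of _ \<nu>]) simp_all
  note main = this[unfolded nonvanishing_from_def]
  show ?thesis
    unfolding Let_def
    by (rule exI[of _ \<mu>], rule exI[of _ g], intro conjI) (rule mu fg mug main)+
qed

end
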